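(* There exists an absolute constant $C>0$ such that the following holds. Let $d\ge1$, $N\ge 2$ be integers, $A\in\mathcal{M}_{d\times d}(\mathbb{R})$, $B\in\mathcal{M}_{d\times d}(\mathbb{R})$ non-singular, and let $x_1,\dots,x_N$ be generated by the linear state space model with parameters $A,B$. Then for every $t\ge 1$, with probability at least $1-e^{-t}$, $$\left|\Psi^{-1/2}\left(\sum_{i=1}^{N-1}x_ix_i^*\right)\Psi^{-1/2}-I_d\right|_{S_\infty}\le C\,\Delta_{A,1}(t).$$
   Context: Model: $x_0=0$ and $x_{i+1}=Ax_i+B\varepsilon_i$ for $0\le i\le N-1$, where $\varepsilon_0,\dots,\varepsilon_{N-1}$ are i.i.d. $\mathcal{N}(0,I_d)$ random vectors. $|\cdot|_{S_\infty}$ is the operator norm; $^*$ is the (conjugate) transpose; $a\vee b=\max(a,b)$. $\Psi:=\mathbb{E}\left(\sum_{i=1}^{N-1}x_ix_i^*\right)=\sum_{k=1}^{N-1}(N-k)A^{k-1}BB^*(A^* )^{k-1}$. $\mathcal{L}_{A,B}:=\sup_{s\in[0,1]}\left|\Psi^{-1/2}\left(\sum_{k=0}^{N-2}A^k e^{\mathrm{j}2\pi ks}\right)B\right|_{S_\infty}^2$, with $\mathrm{j}$ the imaginary unit. $\Delta_{A,1}(t):=(d\vee t)\,\mathcal{L}_{A,B}+(d\vee t)^{1/2}\,\mathcal{L}_{A,B}^{1/2}$. *)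

theory Defs
  imports "HOL-Probability.Probability" "Jordan_Normal_Form.Gauss_Jordan_Elimination"
begin

unbundle no vec_syntax
unbundle no inner_syntax

text \<open>
  The constant of the theorem must not depend on the dimension \<open>d\<close>, so \<open>d\<close> is a number and not
  a type: vectors and matrices are those of Jordan_Normal_Form.
\<close>

text \<open>Matrices of a fixed size are not a type, hence \<open>sum\<close> does not apply to them directly.\<close>

definition mat_sum :: "nat \<Rightarrow> ('i \<Rightarrow> 'a::comm_monoid_add mat) \<Rightarrow> 'i set \<Rightarrow> 'a mat" where
  "mat_sum d F I = mat d d (\<lambda>(i, j). \<Sum>k\<in>I. F k $$ (i, j))"

definition outer_prod :: "real vec \<Rightarrow> real vec \<Rightarrow> real mat" where
  "outer_prod x y = mat (dim_vec x) (dim_vec y) (\<lambda>(i, j). x $ i * y $ j)"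

definition euclid_norm :: "'a::real_normed_field vec \<Rightarrow> real" where
  "euclid_norm v = L2_set (\<lambda>i. norm (v $ i)) {..<dim_vec v}"

definition op_norm :: "'a::real_normed_field mat \<Rightarrow> real" where
  "op_norm M = (SUP v\<in>{v \<in> carrier_vec (dim_col M). euclid_norm v \<le> 1}. euclid_norm (M *\<^sub>v v))"

definition psd_mat :: "nat \<Rightarrow> real mat \<Rightarrow> bool" where
  "psd_mat d R \<longleftrightarrow> R \<in> carrier_mat d d \<and> transpose_mat R = R
     \<and> (\<forall>v\<in>carrier_vec d. 0 \<le> v \<bullet> (R *\<^sub>v v))"

definition psd_sqrt :: "real mat \<Rightarrow> real mat" where
  "psd_sqrt P = (THE R. psd_mat (dim_row P) R \<and> R * R = P)"

text \<open>\<open>P\<^sup>-\<^sup>1\<^sup>/\<^sup>2\<close>, meaningful for symmetric positive definite \<open>P\<close>.\<close>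

definition inv_sqrt :: "real mat \<Rightarrow> real mat" where
  "inv_sqrt P = psd_sqrt (the (mat_inverse P))"

text \<open>The Borel \<open>\<sigma>\<close>-algebra of \<open>\<real>\<^sup>d\<close>: it is generated by the coordinate maps.\<close>

definition vec_borel :: "nat \<Rightarrow> real vec measure" where
  "vec_borel d = vimage_algebra (carrier_vec d) (\<lambda>v. \<lambda>i\<in>{..<d}. v $ i) (Pi\<^sub>M {..<d} (\<lambda>_. borel))"

definition std_gaussian :: "nat \<Rightarrow> real vec measure" where
  "std_gaussian d =
     distr (Pi\<^sub>M {..<d} (\<lambda>_. density lborel (\<lambda>x. ennreal (std_normal_density x)))) (vec_borel d) (vec d)"

definition iid_std_gaussian :: "'w measure \<Rightarrow> nat \<Rightarrow> nat \<Rightarrow> (nat \<Rightarrow> 'w \<Rightarrow> real vec) \<Rightarrow> bool" where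
  "iid_std_gaussian M d N \<epsilon> \<longleftrightarrow>
     prob_space.indep_vars M (\<lambda>_. vec_borel d) \<epsilon> {..<N}
     \<and> (\<forall>i<N. distr M (vec_borel d) (\<epsilon> i) = std_gaussian d)"

fun state :: "real mat \<Rightarrow> real mat \<Rightarrow> (nat \<Rightarrow> real vec) \<Rightarrow> nat \<Rightarrow> real vec" where
  "state A B e 0 = 0\<^sub>v (dim_row A)"
| "state A B e (Suc i) = A *\<^sub>v state A B e i + B *\<^sub>v e i"

definition gram :: "nat \<Rightarrow> real mat \<Rightarrow> real mat \<Rightarrow> (nat \<Rightarrow> real vec) \<Rightarrow> real mat" where
  "gram N A B e = mat_sum (dim_row A) (\<lambda>i. outer_prod (state A B e i) (state A B e i)) {1..N - 1}"

text \<open>The expectation of the random matrix \<open>gram\<close>, taken entrywise.\<close>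

definition Psi :: "'w measure \<Rightarrow> nat \<Rightarrow> real mat \<Rightarrow> real mat \<Rightarrow> (nat \<Rightarrow> 'w \<Rightarrow> real vec) \<Rightarrow> real mat" where
  "Psi M N A B \<epsilon> = mat (dim_row A) (dim_row A)
     (\<lambda>(i, j). prob_space.expectation M (\<lambda>\<omega>. gram N A B (\<lambda>k. \<epsilon> k \<omega>) $$ (i, j)))"

abbreviation cmat :: "real mat \<Rightarrow> complex mat" where
  "cmat \<equiv> map_mat complex_of_real"

text \<open>\<open>\<L>\<^bsub>A,B\<^esub>\<close>, with the matrix \<open>\<Psi>\<close> as its first argument \<open>P\<close>.\<close>

definition L_sup :: "real mat \<Rightarrow> nat \<Rightarrow> real mat \<Rightarrow> real mat \<Rightarrow> real" where
  "L_sup P N A B = (SUP s\<in>{0..1::real}.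
     (op_norm (cmat (inv_sqrt P)
        * mat_sum (dim_row A)
            (\<lambda>k. exp (\<i> * complex_of_real (2 * pi * real k * s)) \<cdot>\<^sub>m cmat (A ^\<^sub>m k)) {0..N - 2}
        * cmat B))\<^sup>2)"

definition Delta :: "real mat \<Rightarrow> nat \<Rightarrow> real mat \<Rightarrow> real mat \<Rightarrow> real \<Rightarrow> real" where
  "Delta P N A B t = (let m = max (real (dim_row A)) t; L = L_sup P N A B
     in m * L + sqrt m * sqrt L)"

text \<open>
  The constant must not depend on the sample space either, but a statement cannot quantify over
  types below \<open>\<exists>C\<close>. The bound with constant \<open>C\<close> is therefore a predicate of \<open>C\<close> and of the type \<open>'w\<close>
  of outcomes, ranging over all probability spaces and noises on \<open>'w\<close>. The theorem asserts it for
  the type of sequences of vectors, on which independent Gaussian vectors exist in every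
  dimension, and asserts that a constant valid there is valid for every other \<open>'w\<close>.
\<close>

definition deviation_bound :: "real \<Rightarrow> 'w itself \<Rightarrow> bool" where
  "deviation_bound C _ \<longleftrightarrow>
     (\<forall>d N A B (M :: 'w measure) \<epsilon>.
        1 \<le> d \<and> 2 \<le> N \<and> A \<in> carrier_mat d d \<and> B \<in> carrier_mat d d \<and> invertible_mat B
        \<and> prob_space M \<and> iid_std_gaussian M d N \<epsilon> \<longrightarrow>
        (let P = Psi M N A B \<epsilon>; Q = inv_sqrt P in
          \<forall>t\<ge>1. measure M {\<omega> \<in> space M.
             op_norm (Q * gram N A B (\<lambda>k. \<epsilon> k \<omega>) * Q - 1\<^sub>m d) \<le> C * Delta P N A B t}
           \<ge> 1 - exp (- t)))"

end

theory Submission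
  imports Defs "Jordan_Normal_Form.Determinant"
begin

text \<open>
  For a unit vector \<open>p\<close> and \<open>Q = \<Psi>\<^sup>-\<^sup>1\<^sup>/\<^sup>2\<close>, the quadratic form of \<open>Q (\<Sum> x\<^sub>i x\<^sub>i\<^sup>*) Q\<close> at \<open>p\<close> is
  \<open>|\<Gamma> g|\<^sup>2\<close> for the vector \<open>g\<close> of all noise coordinates and a block Toeplitz matrix \<open>\<Gamma>\<close> that depends
  linearly on \<open>p\<close>; its mean is \<open>1\<close>. The rows of \<open>\<Gamma>\<close> are shifts of one impulse response, so by Parseval
  the squared operator norm of \<open>\<Gamma>\<close> is at most the supremum \<open>\<L>\<close> of its transfer function.

  Write \<open>f(\<lambda>) = E exp(\<lambda>|\<Gamma> g|\<^sup>2)\<close>. Rotating two independent copies of \<open>g\<close> by 45 degrees shows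
  \<open>f(\<lambda>) f(-\<lambda>) \<le> f(2 \<lambda>\<^sup>2 \<L>)\<close>; with \<open>f(-\<lambda>) \<ge> exp(-\<lambda>)\<close> (Jensen) and \<open>f(\<mu>/2)\<^sup>2 \<le> f(\<mu>)\<close> this gives
  \<open>f(\<lambda>) \<le> exp(\<lambda> + 4 \<lambda>\<^sup>2 \<L>)\<close> for \<open>|\<lambda>| \<le> 1 / (4 \<L>)\<close>, hence a Bernstein tail. A union bound over a
  lattice net of the unit ball with at most \<open>(3 \<cdot> 2\<^sup>1\<^sup>6)\<^sup>d\<close> points passes from one direction to the operator norm.

  The bound is proved on one canonical product space. It transfers to every sample space because
  \<open>\<Psi>\<close> and the probability of the event depend on the noise only through its law.
\<close>

subsection \<open>Gaussian product measures\<close>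

text \<open>Eigenvalues are avoided throughout. Diagonalizing \<open>\<Gamma>\<close> would give the
  Laplace transform of the quadratic form exactly, but the rotation argument needs only two numbers:
  the squared Frobenius norm of \<open>\<Gamma>\<close>, which is the mean, and a bound
  \<open>L\<close> on its squared operator norm. These control the variance, which is at most 2 L
  times the mean, and so produce deviations of order sqrt (u L) for small \<open>u\<close> and u L
  for large \<open>u\<close>, the two terms of \<open>Delta\<close>. Likewise the square root of a
  positive semidefinite matrix is a binomial series. The net has exponentially many points in
  \<open>d\<close>, so \<open>u\<close> must be of the order of the maximum of \<open>d\<close> and
  \<open>t\<close>; this is where the maximum in \<open>Delta\<close> comes from. The constant 320
  is 2 * 8 * 20: a net of width 1/4 costs a factor 2, the tail has \<open>8 * u * L\<close>, and
  \<open>u\<close> is 20 times the maximum, of which 19 parts pay for the union bound. The transfer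
  function is used only at the frequencies l / (2 N); the doubled period keeps the cyclic
  correlation equal to the linear one.\<close>

abbreviation gaussian_family :: "'c set \<Rightarrow> ('c \<Rightarrow> real) measure" where
  "gaussian_family C \<equiv> Pi\<^sub>M C (\<lambda>_. std_normal_distribution)"

lemma prob_space_std_normal: "prob_space std_normal_distribution"
  by (rule prob_space_normal_density) simp

lemma product_sigma_finite_std_normal: "product_sigma_finite (\<lambda>_. std_normal_distribution)"
  by (intro product_sigma_finite.intro prob_space_imp_sigma_finite prob_space_std_normal)

lemmas measurable_nn_integral_std_normal =
  sigma_finite_measure.borel_measurable_nn_integral[OF prob_space_imp_sigma_finite[OF prob_space_std_normal]]

lemma prob_space_gaussian_family: "prob_space (gaussian_family C)"
  by (intro prob_space_PiM prob_space_std_normal)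

text \<open>The orthogonal map is a composition of shears, hence of affine substitutions in one variable.\<close>

lemma std_normal_rotation:
  fixes g :: "real \<Rightarrow> real \<Rightarrow> ennreal"
  assumes [measurable]: "case_prod g \<in> borel_measurable borel"
  shows "(\<integral>\<^sup>+s. \<integral>\<^sup>+t. g s t \<partial>std_normal_distribution \<partial>std_normal_distribution)
       = (\<integral>\<^sup>+s. \<integral>\<^sup>+t. g ((s + t) / sqrt 2) ((s - t) / sqrt 2) \<partial>std_normal_distribution \<partial>std_normal_distribution)"
proof -
  have [measurable]: "case_prod g \<in> borel_measurable (borel \<Otimes>\<^sub>M borel)"
    using assms by (simp add: borel_prod)
  define \<phi> where "\<phi> x = ennreal (std_normal_density x)" for x
  have [measurable]: "\<phi> \<in> borel_measurable borel" unfolding \<phi>_def by measurable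
  define H where "H s t = \<phi> s * (\<phi> t * g s t)" for s t
  have Hm[measurable]: "case_prod H \<in> borel_measurable (borel \<Otimes>\<^sub>M borel)" unfolding H_def by measurable
  have dens: "(\<integral>\<^sup>+s. \<integral>\<^sup>+t. k s t \<partial>std_normal_distribution \<partial>std_normal_distribution)
     = (\<integral>\<^sup>+s. \<integral>\<^sup>+t. \<phi> s * (\<phi> t * k s t) \<partial>lborel \<partial>lborel)"
    if [measurable]: "case_prod k \<in> borel_measurable (borel \<Otimes>\<^sub>M borel)" for k
    by (simp add: nn_integral_density \<phi>_def nn_integral_cmult)
  \<comment> \<open>The rotation is orthogonal: the squares of the two arguments on the right add up
    to \<open>s\<^sup>2 + t\<^sup>2\<close>.\<close>
  have phi2: "\<phi> s * \<phi> t = \<phi> ((s + t) / sqrt 2) * \<phi> ((s - t) / sqrt 2)" for s t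
  proof -
    have "std_normal_density s * std_normal_density t
        = std_normal_density ((s + t) / sqrt 2) * std_normal_density ((s - t) / sqrt 2)"
      by (simp add: std_normal_density_def power_divide exp_add[symmetric] power2_eq_square field_simps)
    then show ?thesis by (simp add: \<phi>_def ennreal_mult'[symmetric])
  qed
  have H_rot: "H ((s + t) / sqrt 2) ((s - t) / sqrt 2) = \<phi> s * (\<phi> t * g ((s + t) / sqrt 2) ((s - t) / sqrt 2))" for s t
    using phi2[of s t] by (simp add: H_def mult.assoc[symmetric])
  have "(\<integral>\<^sup>+s. \<integral>\<^sup>+t. g ((s + t) / sqrt 2) ((s - t) / sqrt 2) \<partial>std_normal_distribution \<partial>std_normal_distribution)
      = (\<integral>\<^sup>+s. \<integral>\<^sup>+t. H ((s + t) / sqrt 2) ((s - t) / sqrt 2) \<partial>lborel \<partial>lborel)"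
    by (subst dens) (simp_all add: H_rot)
  also have "\<dots> = (\<integral>\<^sup>+t. \<integral>\<^sup>+s. H ((s + t) / sqrt 2) ((s - t) / sqrt 2) \<partial>lborel \<partial>lborel)"
    by (intro lborel_pair.Fubini') simp
  \<comment> \<open>First shear: for fixed \<open>t\<close>, put
    \<open>a = (s + t) / sqrt 2\<close>. The Jacobian \<open>sqrt 2\<close> stays outside until the
    second shear, \<open>b = a - sqrt 2 * t\<close>, absorbs it.\<close>
  also have "\<dots> = (\<integral>\<^sup>+t. ennreal (sqrt 2) * (\<integral>\<^sup>+a. H a (a - sqrt 2 * t) \<partial>lborel) \<partial>lborel)"
  proof (intro nn_integral_cong)
    fix t
    have "(\<integral>\<^sup>+s. H ((s + t) / sqrt 2) ((s - t) / sqrt 2) \<partial>lborel)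
      = ennreal \<bar>sqrt 2\<bar> * (\<integral>\<^sup>+a. H ((- t + sqrt 2 * a + t) / sqrt 2) ((- t + sqrt 2 * a - t) / sqrt 2) \<partial>lborel)"
      by (rule nn_integral_real_affine) auto
    moreover have "(- t + sqrt 2 * a - t) / sqrt 2 = a - sqrt 2 * t" for a
      by (simp add: field_simps)
    ultimately show "(\<integral>\<^sup>+s. H ((s + t) / sqrt 2) ((s - t) / sqrt 2) \<partial>lborel)
      = ennreal (sqrt 2) * (\<integral>\<^sup>+a. H a (a - sqrt 2 * t) \<partial>lborel)" by simp
  qed
  also have "\<dots> = ennreal (sqrt 2) * (\<integral>\<^sup>+t. \<integral>\<^sup>+a. H a (a - sqrt 2 * t) \<partial>lborel \<partial>lborel)"
    by (rule nn_integral_cmult) measurable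
  also have "\<dots> = ennreal (sqrt 2) * (\<integral>\<^sup>+a. \<integral>\<^sup>+t. H a (a - sqrt 2 * t) \<partial>lborel \<partial>lborel)"
    by (subst lborel_pair.Fubini') auto
  also have "\<dots> = (\<integral>\<^sup>+a. ennreal (sqrt 2) * (\<integral>\<^sup>+t. H a (a - sqrt 2 * t) \<partial>lborel) \<partial>lborel)"
    by (rule nn_integral_cmult[symmetric]) measurable
  also have "\<dots> = (\<integral>\<^sup>+a. \<integral>\<^sup>+b. H a b \<partial>lborel \<partial>lborel)"
  proof (intro nn_integral_cong)
    fix a
    have "(\<integral>\<^sup>+b. H a b \<partial>lborel) = ennreal \<bar>- sqrt 2\<bar> * (\<integral>\<^sup>+t. H a (a + (- sqrt 2) * t) \<partial>lborel)"
      by (rule nn_integral_real_affine) auto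
    then show "ennreal (sqrt 2) * (\<integral>\<^sup>+t. H a (a - sqrt 2 * t) \<partial>lborel) = (\<integral>\<^sup>+b. H a b \<partial>lborel)"
      by simp
  qed
  also have "\<dots> = (\<integral>\<^sup>+s. \<integral>\<^sup>+t. g s t \<partial>std_normal_distribution \<partial>std_normal_distribution)"
    by (subst dens) (simp_all add: H_def[abs_def])
  finally show ?thesis by simp
qed

lemma nn_integral_std_normal_exp_linear:
  "(\<integral>\<^sup>+x. ennreal (exp (a * x)) \<partial>std_normal_distribution) = ennreal (exp (a\<^sup>2 / 2))"
proof -
  have "(\<integral>\<^sup>+x. ennreal (exp (a * x)) \<partial>std_normal_distribution)
      = (\<integral>\<^sup>+x. ennreal (std_normal_density x * exp (a * x)) \<partial>lborel)"
    by (simp add: nn_integral_density ennreal_mult')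
  \<comment> \<open>The shift by \<open>a\<close> completes the square and leaves the factor exp
    (a^2 / 2).\<close>
  also have "\<dots> = ennreal \<bar>1\<bar> * (\<integral>\<^sup>+x. ennreal (std_normal_density (a + 1 * x) * exp (a * (a + 1 * x))) \<partial>lborel)"
    by (rule nn_integral_real_affine) auto
  also have "\<dots> = (\<integral>\<^sup>+x. ennreal (exp (a\<^sup>2 / 2)) * ennreal (std_normal_density x) \<partial>lborel)"
  proof -
    have "std_normal_density (a + 1 * x) * exp (a * (a + 1 * x)) = exp (a\<^sup>2 / 2) * std_normal_density x" for x
      by (simp add: std_normal_density_def exp_add[symmetric] power2_eq_square field_simps)
    then show ?thesis by (simp add: ennreal_mult')
  qed
  also have "\<dots> = ennreal (exp (a\<^sup>2 / 2)) * (\<integral>\<^sup>+x. ennreal (std_normal_density x) \<partial>lborel)"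
    by (rule nn_integral_cmult) measurable
  also have "(\<integral>\<^sup>+x. ennreal (std_normal_density x) \<partial>lborel) = 1"
    using prob_space.emeasure_space_1[OF prob_space_std_normal] by (simp add: emeasure_density)
  finally show ?thesis by simp
qed

lemma nn_integral_std_normal_exp_square:
  assumes "a < 1 / 2"
  shows "(\<integral>\<^sup>+x. ennreal (exp (a * x\<^sup>2)) \<partial>std_normal_distribution) < \<infinity>"
proof -
  \<comment> \<open>\<open>c\<close> turns the integrand into the density at \<open>c * x\<close>,
    so the integral is \<open>1 / c\<close>; the assumption on \<open>a\<close> makes
    \<open>c\<close> positive.\<close>
  define c where "c = sqrt (1 - 2 * a)"
  have c: "c > 0" "c\<^sup>2 = 1 - 2 * a" using assms by (auto simp: c_def)
  have "(\<integral>\<^sup>+x. ennreal (exp (a * x\<^sup>2)) \<partial>std_normal_distribution)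
      = (\<integral>\<^sup>+x. ennreal (std_normal_density x * exp (a * x\<^sup>2)) \<partial>lborel)"
    by (simp add: nn_integral_density ennreal_mult')
  also have "\<dots> = (\<integral>\<^sup>+x. ennreal (std_normal_density (0 + c * x)) \<partial>lborel)"
  proof -
    have "std_normal_density x * exp (a * x\<^sup>2) = std_normal_density (0 + c * x)" for x
      by (simp add: std_normal_density_def exp_add[symmetric] power_mult_distrib c field_simps)
    then show ?thesis by simp
  qed
  finally have *: "(\<integral>\<^sup>+x. ennreal (exp (a * x\<^sup>2)) \<partial>std_normal_distribution)
     = (\<integral>\<^sup>+x. ennreal (std_normal_density (0 + c * x)) \<partial>lborel)" .
  have "1 = (\<integral>\<^sup>+x. ennreal (std_normal_density x) \<partial>lborel)"
    using prob_space.emeasure_space_1[OF prob_space_std_normal] by (simp add: emeasure_density)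
  also have "\<dots> = ennreal \<bar>c\<bar> * (\<integral>\<^sup>+x. ennreal (std_normal_density (0 + c * x)) \<partial>lborel)"
    using c by (intro nn_integral_real_affine) auto
  finally show ?thesis unfolding *
    using c by (metis ennreal_mult_eq_top_iff ennreal_one_neq_top infinity_ennreal_def less_top abs_of_pos
      ennreal_eq_0_iff not_le)
qed

text \<open>Peels one coordinate off both copies and moves the two scalar integrals innermost, where
  the planar rotation applies; only the integrals over \<open>s\<close> and \<open>y\<close> have to
  be exchanged.\<close>

lemma nn_integral_gaussian_family_insert2:
  fixes K :: "('c \<Rightarrow> real) \<Rightarrow> ('c \<Rightarrow> real) \<Rightarrow> ennreal"
  assumes C: "finite C" "c \<notin> C"
    and K: "case_prod K \<in> borel_measurable (gaussian_family (insert c C) \<Otimes>\<^sub>M gaussian_family (insert c C))"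
  shows "(\<integral>\<^sup>+x. \<integral>\<^sup>+y. K x y \<partial>gaussian_family (insert c C) \<partial>gaussian_family (insert c C))
     = (\<integral>\<^sup>+x. \<integral>\<^sup>+y. \<integral>\<^sup>+s. \<integral>\<^sup>+t. K (x(c := s)) (y(c := t)) \<partial>std_normal_distribution \<partial>std_normal_distribution
         \<partial>gaussian_family C \<partial>gaussian_family C)"
proof -
  interpret product_sigma_finite "\<lambda>_::'c. std_normal_distribution" by (rule product_sigma_finite_std_normal)
  interpret P: prob_space "gaussian_family C" by (rule prob_space_gaussian_family)
  interpret P': prob_space "gaussian_family (insert c C)" by (rule prob_space_gaussian_family)
  interpret N: prob_space std_normal_distribution by (rule prob_space_std_normal)
  interpret NP: pair_sigma_finite std_normal_distribution "gaussian_family C" ..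
  note [measurable] = K
  have "(\<integral>\<^sup>+x. \<integral>\<^sup>+y. K x y \<partial>gaussian_family (insert c C) \<partial>gaussian_family (insert c C))
      = (\<integral>\<^sup>+x. \<integral>\<^sup>+s. \<integral>\<^sup>+y. K (x(c := s)) y \<partial>gaussian_family (insert c C) \<partial>std_normal_distribution \<partial>gaussian_family C)"
    using C by (intro product_nn_integral_insert P'.borel_measurable_nn_integral) auto
  also have "\<dots> = (\<integral>\<^sup>+x. \<integral>\<^sup>+s. \<integral>\<^sup>+y. \<integral>\<^sup>+t. K (x(c := s)) (y(c := t)) \<partial>std_normal_distribution \<partial>gaussian_family C
        \<partial>std_normal_distribution \<partial>gaussian_family C)"
  proof (intro nn_integral_cong product_nn_integral_insert C)
    fix x s assume "x \<in> space (gaussian_family C)" "s \<in> space std_normal_distribution"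
    then have "x(c := s) \<in> space (gaussian_family (insert c C))" by (auto simp: space_PiM PiE_def extensional_def)
    then show "K (x(c := s)) \<in> borel_measurable (gaussian_family (insert c C))"
      using measurable_Pair2[OF K] by auto
  qed
  also have "\<dots> = (\<integral>\<^sup>+x. \<integral>\<^sup>+y. \<integral>\<^sup>+s. \<integral>\<^sup>+t. K (x(c := s)) (y(c := t)) \<partial>std_normal_distribution \<partial>std_normal_distribution
         \<partial>gaussian_family C \<partial>gaussian_family C)"
  proof (intro nn_integral_cong NP.Fubini'[symmetric])
    fix x assume x: "x \<in> space (gaussian_family C)"
    let ?M = "(std_normal_distribution \<Otimes>\<^sub>M gaussian_family C) \<Otimes>\<^sub>M std_normal_distribution"
    have 1: "(\<lambda>z. x(c := fst (fst z))) \<in> ?M \<rightarrow>\<^sub>M gaussian_family (insert c C)"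
      using x by (intro measurable_fun_upd[where J = C]) auto
    have 2: "(\<lambda>z. (snd (fst z))(c := snd z)) \<in> ?M \<rightarrow>\<^sub>M gaussian_family (insert c C)"
      by (intro measurable_fun_upd[where J = C]) auto
    have "(\<lambda>z. K (x(c := fst (fst z))) ((snd (fst z))(c := snd z))) \<in> borel_measurable ?M"
      using measurable_compose[OF measurable_Pair[OF 1 2] K] by simp
    then have "(\<lambda>z. \<integral>\<^sup>+t. K (x(c := fst z)) ((snd z)(c := t)) \<partial>std_normal_distribution)
        \<in> borel_measurable (std_normal_distribution \<Otimes>\<^sub>M gaussian_family C)"
      by (intro measurable_nn_integral_std_normal) (auto simp: case_prod_beta')
    then show "(\<lambda>(s, y). \<integral>\<^sup>+t. K (x(c := s)) (y(c := t)) \<partial>std_normal_distribution)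
        \<in> borel_measurable (std_normal_distribution \<Otimes>\<^sub>M gaussian_family C)"
      by (simp add: case_prod_beta')
  qed
  finally show ?thesis .
qed

text \<open>The rotation acts on each pair of equal coordinates separately, so induction over the
  coordinates reduces it to the planar case.\<close>

lemma gaussian_family_rotation:
  fixes G :: "('c \<Rightarrow> real) \<Rightarrow> ('c \<Rightarrow> real) \<Rightarrow> ennreal"
  assumes "finite C"
    and "case_prod G \<in> borel_measurable (gaussian_family C \<Otimes>\<^sub>M gaussian_family C)"
  shows "(\<integral>\<^sup>+x. \<integral>\<^sup>+y. G x y \<partial>gaussian_family C \<partial>gaussian_family C)
       = (\<integral>\<^sup>+x. \<integral>\<^sup>+y. G (\<lambda>c\<in>C. (x c + y c) / sqrt 2) (\<lambda>c\<in>C. (x c - y c) / sqrt 2)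
            \<partial>gaussian_family C \<partial>gaussian_family C)"
  using assms
proof (induction C arbitrary: G rule: finite_induct)
  case empty
  then show ?case by (simp add: PiM_empty nn_integral_count_space_finite)
next
  case (insert c C)
  have Gm: "(\<lambda>z. G ((a z)(c := u z)) ((b z)(c := v z))) \<in> borel_measurable M"
    if "a \<in> M \<rightarrow>\<^sub>M gaussian_family C" "b \<in> M \<rightarrow>\<^sub>M gaussian_family C"
      "u \<in> borel_measurable M" "v \<in> borel_measurable M" for a b u v M
  proof -
    have "(\<lambda>z. ((a z)(c := u z), (b z)(c := v z))) \<in> M \<rightarrow>\<^sub>M
        gaussian_family (insert c C) \<Otimes>\<^sub>M gaussian_family (insert c C)"
      using that by (intro measurable_Pair measurable_fun_upd[where J = C]) auto
    from measurable_compose[OF this insert.prems] show ?thesis by simp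
  qed
  \<comment> \<open>The new pair of coordinates is rotated and integrated out; the induction
    hypothesis then rotates the remaining ones inside \<open>G'\<close>.\<close>
  define G' where "G' x y = (\<integral>\<^sup>+s. \<integral>\<^sup>+t. G (x(c := (s + t) / sqrt 2)) (y(c := (s - t) / sqrt 2))
      \<partial>std_normal_distribution \<partial>std_normal_distribution)" for x y
  have G'm: "case_prod G' \<in> borel_measurable (gaussian_family C \<Otimes>\<^sub>M gaussian_family C)"
    unfolding G'_def case_prod_beta'
    by (intro measurable_nn_integral_std_normal) (auto simp: case_prod_beta' intro!: measurable_nn_integral_std_normal Gm)
  let ?r = "\<lambda>C (x :: 'c \<Rightarrow> real) y. (\<lambda>c\<in>C. (x c + y c) / sqrt 2)"
  let ?r' = "\<lambda>C (x :: 'c \<Rightarrow> real) y. (\<lambda>c\<in>C. (x c - y c) / sqrt 2)"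
  have "(\<integral>\<^sup>+x. \<integral>\<^sup>+y. G x y \<partial>gaussian_family (insert c C) \<partial>gaussian_family (insert c C))
     = (\<integral>\<^sup>+x. \<integral>\<^sup>+y. \<integral>\<^sup>+s. \<integral>\<^sup>+t. G (x(c := s)) (y(c := t)) \<partial>std_normal_distribution \<partial>std_normal_distribution
         \<partial>gaussian_family C \<partial>gaussian_family C)"
    by (rule nn_integral_gaussian_family_insert2) (use insert in auto)
  also have "\<dots> = (\<integral>\<^sup>+x. \<integral>\<^sup>+y. G' x y \<partial>gaussian_family C \<partial>gaussian_family C)"
    unfolding G'_def
  proof (rule nn_integral_cong, rule nn_integral_cong, rule std_normal_rotation)
    fix x y assume xy: "x \<in> space (gaussian_family C)" "y \<in> space (gaussian_family C)"
    have "(\<lambda>z. G (x(c := fst z)) (y(c := snd z))) \<in> borel_measurable (borel :: (real \<times> real) measure)"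
      using xy by (intro Gm) (auto intro!: borel_measurable_continuous_onI continuous_intros)
    then show "(\<lambda>(s, t). G (x(c := s)) (y(c := t))) \<in> borel_measurable borel"
      by (simp add: case_prod_beta')
  qed
  also have "\<dots> = (\<integral>\<^sup>+x. \<integral>\<^sup>+y. G' (?r C x y) (?r' C x y) \<partial>gaussian_family C \<partial>gaussian_family C)"
    by (rule insert.IH) (rule G'm)
  also have "\<dots> = (\<integral>\<^sup>+x. \<integral>\<^sup>+y. G (?r (insert c C) x y) (?r' (insert c C) x y)
      \<partial>gaussian_family (insert c C) \<partial>gaussian_family (insert c C))"
  proof (subst nn_integral_gaussian_family_insert2[OF insert.hyps])
    have 1: "(\<lambda>z. ?r (insert c C) (fst z) (snd z)) \<in> gaussian_family (insert c C) \<Otimes>\<^sub>M gaussian_family (insert c C)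
        \<rightarrow>\<^sub>M gaussian_family (insert c C)"
      by (intro measurable_restrict) simp
    have 2: "(\<lambda>z. ?r' (insert c C) (fst z) (snd z)) \<in> gaussian_family (insert c C) \<Otimes>\<^sub>M gaussian_family (insert c C)
        \<rightarrow>\<^sub>M gaussian_family (insert c C)"
      by (intro measurable_restrict) simp
    show "(\<lambda>(x, y). G (?r (insert c C) x y) (?r' (insert c C) x y)) \<in> borel_measurable
        (gaussian_family (insert c C) \<Otimes>\<^sub>M gaussian_family (insert c C))"
      using measurable_compose[OF measurable_Pair[OF 1 2] insert.prems] by (simp add: case_prod_beta')
    have r: "(?r C x y)(c := (s + t) / sqrt 2) = ?r (insert c C) (x(c := s)) (y(c := t))"
      "(?r' C x y)(c := (s - t) / sqrt 2) = ?r' (insert c C) (x(c := s)) (y(c := t))" for x y s t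
      using insert.hyps by (auto simp: fun_eq_iff restrict_def)
    show "(\<integral>\<^sup>+x. \<integral>\<^sup>+y. G' (?r C x y) (?r' C x y) \<partial>gaussian_family C \<partial>gaussian_family C)
      = (\<integral>\<^sup>+x. \<integral>\<^sup>+y. \<integral>\<^sup>+s. \<integral>\<^sup>+t. G (?r (insert c C) (x(c := s)) (y(c := t))) (?r' (insert c C) (x(c := s)) (y(c := t)))
         \<partial>std_normal_distribution \<partial>std_normal_distribution \<partial>gaussian_family C \<partial>gaussian_family C)"
      unfolding G'_def r ..
  qed
  finally show ?case .
qed

section \<open>Second moments of Gaussian linear forms\<close>

lemma std_normal_power_integrable: "integrable std_normal_distribution (\<lambda>x. x ^ k)"
  by (rule integrable_std_normal_distribution_moment)

lemma std_normal_mean: "(LINT x|std_normal_distribution. x) = 0"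
  using integral_std_normal_distribution_moment_odd[of 1] by simp

lemma std_normal_second_moment: "(LINT x|std_normal_distribution. x\<^sup>2) = 1"
  using std_normal_distribution_even_moments(1)[of 1] by simp

lemma gaussian_family_covariance:
  assumes "finite C" "c \<in> C" "d \<in> C"
  shows "integrable (gaussian_family C) (\<lambda>x. x c * x d)"
    and "(LINT x|gaussian_family C. x c * x d) = (if c = d then 1 else 0)"
proof -
  interpret product_sigma_finite "\<lambda>_. std_normal_distribution" by (rule product_sigma_finite_std_normal)
  \<comment> \<open>With these exponents \<open>x c * x d\<close> becomes a product over all
    coordinates, so one product formula covers the exponent 2 at \<open>c = d\<close> and the
    exponents 1 at two distinct indices.\<close>
  define k where "k i = (if i = c then 1 else 0) + (if i = d then 1 else 0 :: nat)" for i
  have "(\<Prod>i\<in>C. x i ^ k i) = (\<Prod>i\<in>C. if c = i then x i else 1) * (\<Prod>i\<in>C. if d = i then x i else 1)" for x :: "'a \<Rightarrow> real"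
    by (auto simp: prod.distrib[symmetric] k_def power_add intro!: prod.cong)
  then have eq: "(\<Prod>i\<in>C. x i ^ k i) = x c * x d" for x :: "'a \<Rightarrow> real"
    using assms by (simp add: prod.delta)
  show "integrable (gaussian_family C) (\<lambda>x. x c * x d)"
    using product_integrable_prod[OF assms(1), of "\<lambda>i x. x ^ k i"] by (simp add: eq std_normal_power_integrable)
  have "(LINT x|gaussian_family C. x c * x d) = (\<Prod>i\<in>C. LINT x|std_normal_distribution. x ^ k i)"
    using product_integral_prod[OF assms(1), of "\<lambda>i x. x ^ k i"] by (simp add: eq std_normal_power_integrable)
  also have "\<dots> = (if c = d then 1 else 0)"
  proof (cases "c = d")
    case True
    have "(LINT x|std_normal_distribution. x ^ k i) = 1" for i
      using True prob_space.prob_space[OF prob_space_std_normal]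
      using std_normal_second_moment by (simp add: k_def numeral_2_eq_2)
    then show ?thesis using True by simp
  next
    case False
    then have "(LINT x|std_normal_distribution. x ^ k c) = 0" by (simp add: k_def std_normal_mean)
    then show ?thesis using assms False by (auto intro!: prod_zero)
  qed
  finally show "(LINT x|gaussian_family C. x c * x d) = (if c = d then 1 else 0)" .
qed

lemma gaussian_family_square_linear:
  assumes "finite C"
  shows "integrable (gaussian_family C) (\<lambda>x. (\<Sum>c\<in>C. a c * x c) * (\<Sum>c\<in>C. b c * x c))"
    and "(LINT x|gaussian_family C. (\<Sum>c\<in>C. a c * x c) * (\<Sum>c\<in>C. b c * x c)) = (\<Sum>c\<in>C. a c * b c)"
proof -
  have eq: "(\<Sum>c\<in>C. a c * x c) * (\<Sum>c\<in>C. b c * x c) = (\<Sum>c\<in>C. \<Sum>d\<in>C. (a c * b d) * (x c * x d))" for x :: "'a \<Rightarrow> real"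
    by (simp add: sum_product algebra_simps)
  show "integrable (gaussian_family C) (\<lambda>x. (\<Sum>c\<in>C. a c * x c) * (\<Sum>c\<in>C. b c * x c))"
    unfolding eq by (intro Bochner_Integration.integrable_sum integrable_mult_right gaussian_family_covariance assms)
  have "(LINT x|gaussian_family C. (\<Sum>c\<in>C. a c * x c) * (\<Sum>c\<in>C. b c * x c))
     = (\<Sum>c\<in>C. \<Sum>d\<in>C. (a c * b d) * (if c = d then 1 else 0))"
    unfolding eq using assms
    by (simp add: Bochner_Integration.integral_sum gaussian_family_covariance)
  also have "\<dots> = (\<Sum>c\<in>C. a c * b c)"
    using assms by (auto intro!: sum.cong simp: if_distrib[of "\<lambda>z. _ * z"] cong: if_cong)
  finally show "(LINT x|gaussian_family C. (\<Sum>c\<in>C. a c * x c) * (\<Sum>c\<in>C. b c * x c)) = (\<Sum>c\<in>C. a c * b c)" .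
qed

subsection \<open>Concentration of Gaussian quadratic forms\<close>

text \<open>\<open>adjoint_bound\<close> says that the transpose of \<open>\<Gamma>\<close> has
  squared operator norm at most \<open>L\<close>. The transpose is what the Toeplitz estimate bounds
  and what the decoupling uses, through \<open>half_grad\<close>; the bound for
  \<open>\<Gamma>\<close> itself is derived in \<open>qf_le\<close>.\<close>

locale gaussian_chaos =
  fixes C :: "'c set" and R :: "'r set" and \<Gamma> :: "'r \<Rightarrow> 'c \<Rightarrow> real" and L :: real
  assumes finC: "finite C" and finR: "finite R" and L_pos: "0 < L"
    and adjoint_bound: "\<And>y. (\<Sum>c\<in>C. (\<Sum>r\<in>R. \<Gamma> r c * y r)\<^sup>2) \<le> L * (\<Sum>r\<in>R. (y r)\<^sup>2)"
begin

definition lin :: "'r \<Rightarrow> ('c \<Rightarrow> real) \<Rightarrow> real" where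
  "lin r x = (\<Sum>c\<in>C. \<Gamma> r c * x c)"

definition qf :: "('c \<Rightarrow> real) \<Rightarrow> real" where
  "qf x = (\<Sum>r\<in>R. (lin r x)\<^sup>2)"

text \<open>The squared Frobenius norm of \<open>\<Gamma>\<close>; \<open>qf_mean\<close> identifies
  it with the expectation of \<open>qf\<close>.\<close>

definition mean :: real where
  "mean = (\<Sum>r\<in>R. \<Sum>c\<in>C. (\<Gamma> r c)\<^sup>2)"

definition half_grad :: "('c \<Rightarrow> real) \<Rightarrow> 'c \<Rightarrow> real" where
  "half_grad x c = (\<Sum>r\<in>R. \<Gamma> r c * lin r x)"

definition mgf :: "real \<Rightarrow> real" where
  "mgf l = (LINT x|gaussian_family C. exp (l * qf x))"

lemma signed_le:
  assumes "\<bar>l\<bar> * L \<le> 1 / 4"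
  shows "l * L \<le> 1 / 4" "- l * L \<le> 1 / 4"
proof -
  have "l * L \<le> \<bar>l\<bar> * L" "- l * L \<le> \<bar>l\<bar> * L" using L_pos by (intro mult_right_mono; simp)+
  then show "l * L \<le> 1 / 4" "- l * L \<le> 1 / 4" using assms by linarith+
qed

lemma qf_nonneg: "0 \<le> qf x"
  by (simp add: qf_def sum_nonneg)

lemma half_grad_bound: "(\<Sum>c\<in>C. (half_grad x c)\<^sup>2) \<le> L * qf x"
  unfolding half_grad_def qf_def by (rule adjoint_bound)

lemma sum_half_grad: "(\<Sum>c\<in>C. y c * half_grad x c) = (\<Sum>r\<in>R. lin r y * lin r x)"
proof -
  have "(\<Sum>c\<in>C. y c * half_grad x c) = (\<Sum>c\<in>C. \<Sum>r\<in>R. \<Gamma> r c * y c * lin r x)"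
    by (simp add: half_grad_def sum_distrib_left mult_ac)
  also have "\<dots> = (\<Sum>r\<in>R. \<Sum>c\<in>C. \<Gamma> r c * y c * lin r x)" by (rule sum.swap)
  also have "\<dots> = (\<Sum>r\<in>R. lin r y * lin r x)" by (simp only: lin_def[of _ y] sum_distrib_right)
  finally show ?thesis .
qed

text \<open>A matrix and its transpose have the same operator norm: \<open>qf x\<close> is the
  scalar product of \<open>x\<close> and \<open>half_grad x\<close>, so Cauchy-Schwarz and
  \<open>half_grad_bound\<close> give qf^2 <= |x|^2 L qf, and one factor cancels.\<close>

lemma qf_le: "qf x \<le> L * (\<Sum>c\<in>C. (x c)\<^sup>2)"
proof (cases "qf x = 0")
  case True
  then show ?thesis using L_pos by (simp add: sum_nonneg)
next
  case False
  then have pos: "qf x > 0" using qf_nonneg[of x] by simp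
  have "(qf x)\<^sup>2 = (\<Sum>c\<in>C. x c * half_grad x c)\<^sup>2"
    by (simp add: sum_half_grad qf_def power2_eq_square)
  also have "\<dots> \<le> (\<Sum>c\<in>C. (x c)\<^sup>2) * (\<Sum>c\<in>C. (half_grad x c)\<^sup>2)"
    by (rule Cauchy_Schwarz_ineq_sum)
  also have "\<dots> \<le> (\<Sum>c\<in>C. (x c)\<^sup>2) * (L * qf x)"
    by (intro mult_left_mono half_grad_bound sum_nonneg) auto
  finally have "qf x * qf x \<le> (L * (\<Sum>c\<in>C. (x c)\<^sup>2)) * qf x"
    by (simp add: power2_eq_square algebra_simps)
  then show ?thesis using pos by (simp only: mult_le_cancel_right_pos)
qed

text \<open>Polarization: (a + b)^2 - (a - b)^2 = 4ab, halved by the factors 1 / sqrt 2. The two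
  copies are then coupled only bilinearly, with coefficient vector
  \<open>half_grad x\<close>.\<close>

lemma qf_rotation:
  "qf (\<lambda>c\<in>C. (x c + y c) / sqrt 2) - qf (\<lambda>c\<in>C. (x c - y c) / sqrt 2) = 2 * (\<Sum>c\<in>C. y c * half_grad x c)"
proof -
  have 1: "lin r (\<lambda>c\<in>C. (x c + y c) / sqrt 2) = (lin r x + lin r y) / sqrt 2" for r
    by (simp add: lin_def sum.distrib[symmetric] sum_divide_distrib algebra_simps)
  have 2: "lin r (\<lambda>c\<in>C. (x c - y c) / sqrt 2) = (lin r x - lin r y) / sqrt 2" for r
    by (simp add: lin_def sum_subtractf[symmetric] sum_divide_distrib algebra_simps)
  have "((lin r x + lin r y) / sqrt 2)\<^sup>2 - ((lin r x - lin r y) / sqrt 2)\<^sup>2 = 2 * (lin r y * lin r x)" for r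
    by (simp add: power_divide power2_eq_square field_simps)
  then show ?thesis
    by (simp add: sum_half_grad qf_def 1 2 sum_subtractf[symmetric] sum_distrib_left)
qed

lemma qf_measurable[measurable]: "qf \<in> borel_measurable (gaussian_family C)"
  unfolding qf_def lin_def by measurable

lemma qf_integrable: "integrable (gaussian_family C) qf"
  unfolding qf_def[abs_def] lin_def power2_eq_square
  by (intro Bochner_Integration.integrable_sum gaussian_family_square_linear finC)

lemma qf_mean: "(LINT x|gaussian_family C. qf x) = mean"
  unfolding qf_def lin_def power2_eq_square mean_def using finC
  by (simp add: Bochner_Integration.integral_sum gaussian_family_square_linear)

text \<open>By \<open>qf_le\<close> the integrand is dominated by a product of functions of single
  coordinates, each integrable because \<open>l * L\<close> stays below 1/2.\<close>

lemma nn_exp_qf_finite: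
  assumes "l * L \<le> 1 / 4"
  shows "(\<integral>\<^sup>+x. ennreal (exp (l * qf x)) \<partial>gaussian_family C) < \<infinity>"
proof -
  interpret product_sigma_finite "\<lambda>_::'c. std_normal_distribution" by (rule product_sigma_finite_std_normal)
  \<comment> \<open>For negative \<open>l\<close> the upper bound on \<open>qf\<close> goes the
    wrong way; there the exponent is simply bounded by 0.\<close>
  define m where "m = max l 0"
  have m: "m * L < 1 / 2" "l \<le> m" "0 \<le> m" using assms by (auto simp: m_def max_def)
  have "l * qf x \<le> (\<Sum>c\<in>C. (m * L) * (x c)\<^sup>2)" for x
  proof -
    have "l * qf x \<le> m * qf x" using m qf_nonneg by (intro mult_right_mono) auto
    also have "\<dots> \<le> m * (L * (\<Sum>c\<in>C. (x c)\<^sup>2))" using m qf_le by (intro mult_left_mono) auto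
    finally show ?thesis by (simp add: sum_distrib_left mult.assoc)
  qed
  then have "(\<integral>\<^sup>+x. ennreal (exp (l * qf x)) \<partial>gaussian_family C)
     \<le> (\<integral>\<^sup>+x. (\<Prod>c\<in>C. ennreal (exp ((m * L) * (x c)\<^sup>2))) \<partial>gaussian_family C)"
    using finC by (intro nn_integral_mono) (simp add: prod_ennreal exp_sum[symmetric])
  also have "\<dots> = (\<Prod>c\<in>C. \<integral>\<^sup>+x. ennreal (exp ((m * L) * x\<^sup>2)) \<partial>std_normal_distribution)"
    by (rule product_nn_integral_prod[OF finC]) measurable
  also have "\<dots> < \<infinity>"
    using nn_integral_std_normal_exp_square[OF m(1)] by (simp add: ennreal_prod_eq_top less_top[symmetric] power_eq_top_ennreal)
  finally show ?thesis .
qed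

lemma exp_qf_integrable:
  assumes "l * L \<le> 1 / 4"
  shows "integrable (gaussian_family C) (\<lambda>x. exp (l * qf x))"
  using nn_exp_qf_finite[OF assms] by (intro integrableI_nonneg) auto

lemma nn_exp_qf:
  assumes "l * L \<le> 1 / 4"
  shows "(\<integral>\<^sup>+x. ennreal (exp (l * qf x)) \<partial>gaussian_family C) = ennreal (mgf l)"
  unfolding mgf_def by (rule nn_integral_eq_integral[OF exp_qf_integrable[OF assms]]) auto

text \<open>Rotating two independent copies turns the difference of the quadratic forms into a decoupled bilinear form.\<close>

lemma mgf_decoupling:
  assumes "\<bar>l\<bar> * L \<le> 1 / 4"
  shows "mgf l * mgf (- l) \<le> mgf (2 * l\<^sup>2 * L)"
proof -
  interpret product_sigma_finite "\<lambda>_::'c. std_normal_distribution" by (rule product_sigma_finite_std_normal)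
  interpret P: prob_space "gaussian_family C" by (rule prob_space_gaussian_family)
  have l1: "l * L \<le> 1 / 4" "- l * L \<le> 1 / 4" by (rule signed_le[OF assms])+
  \<comment> \<open>The new argument stays in the range where \<open>mgf\<close> is finite, since 2
    (1/4)^2 = 1/8.\<close>
  have l2: "(2 * l\<^sup>2 * L) * L \<le> 1 / 4"
  proof -
    have "(2 * l\<^sup>2 * L) * L = 2 * (\<bar>l\<bar> * L)\<^sup>2" by (simp add: power2_eq_square)
    also have "\<dots> \<le> 2 * (1 / 4)\<^sup>2" using assms L_pos by (intro mult_left_mono power_mono) auto
    finally show ?thesis by (simp add: power2_eq_square)
  qed
  let ?e = "\<lambda>x. ennreal (exp x)"
  have "ennreal (mgf l * mgf (- l)) = (\<integral>\<^sup>+x. ?e (l * qf x) \<partial>gaussian_family C) * (\<integral>\<^sup>+x. ?e (- l * qf x) \<partial>gaussian_family C)"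
    unfolding nn_exp_qf[OF l1(1)] nn_exp_qf[OF l1(2)] by (simp add: ennreal_mult'' mgf_def)
  also have "\<dots> = (\<integral>\<^sup>+x. \<integral>\<^sup>+y. ?e (l * qf x) * ?e (- l * qf y) \<partial>gaussian_family C \<partial>gaussian_family C)"
    by (simp add: nn_integral_cmult nn_integral_multc)
  also have "\<dots> = (\<integral>\<^sup>+x. \<integral>\<^sup>+y. ?e (l * qf (\<lambda>c\<in>C. (x c + y c) / sqrt 2)) * ?e (- l * qf (\<lambda>c\<in>C. (x c - y c) / sqrt 2))
      \<partial>gaussian_family C \<partial>gaussian_family C)"
    by (rule gaussian_family_rotation[OF finC]) measurable
  also have "\<dots> = (\<integral>\<^sup>+x. \<integral>\<^sup>+y. (\<Prod>c\<in>C. ?e ((2 * l * half_grad x c) * y c)) \<partial>gaussian_family C \<partial>gaussian_family C)"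
  proof (intro nn_integral_cong)
    fix x y :: "'c \<Rightarrow> real"
    let ?a = "qf (\<lambda>c\<in>C. (x c + y c) / sqrt 2)" and ?b = "qf (\<lambda>c\<in>C. (x c - y c) / sqrt 2)"
    have "l * ?a + - l * ?b = l * (?a - ?b)" by (simp add: algebra_simps)
    also have "\<dots> = (\<Sum>c\<in>C. (2 * l * half_grad x c) * y c)"
      by (simp add: qf_rotation sum_distrib_left algebra_simps)
    finally show "?e (l * ?a) * ?e (- l * ?b) = (\<Prod>c\<in>C. ?e ((2 * l * half_grad x c) * y c))"
      using finC by (simp add: ennreal_mult'[symmetric] exp_add[symmetric] prod_ennreal exp_sum[symmetric])
  qed
  also have "\<dots> = (\<integral>\<^sup>+x. (\<Prod>c\<in>C. \<integral>\<^sup>+t. ?e ((2 * l * half_grad x c) * t) \<partial>std_normal_distribution) \<partial>gaussian_family C)"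
    by (intro nn_integral_cong product_nn_integral_prod[OF finC]) measurable
  \<comment> \<open>For fixed \<open>x\<close> the integral over \<open>y\<close> is the Laplace
    transform of a Gaussian linear form; the constant is (2 l)^2 / 2 = 2 l^2.\<close>
  also have "\<dots> = (\<integral>\<^sup>+x. ?e (2 * l\<^sup>2 * (\<Sum>c\<in>C. (half_grad x c)\<^sup>2)) \<partial>gaussian_family C)"
    using finC by (simp only: nn_integral_std_normal_exp_linear)
      (simp add: prod_ennreal exp_sum[symmetric] power_mult_distrib sum_distrib_left mult.assoc)
  \<comment> \<open>The adjoint bound turns the squared half gradient back into \<open>qf\<close>,
    so the estimate closes on \<open>mgf\<close> itself.\<close>
  also have "\<dots> \<le> (\<integral>\<^sup>+x. ?e ((2 * l\<^sup>2 * L) * qf x) \<partial>gaussian_family C)"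
    using half_grad_bound by (intro nn_integral_mono ennreal_leI) (simp add: mult.assoc mult_left_mono)
  also have "\<dots> = ennreal (mgf (2 * l\<^sup>2 * L))" by (rule nn_exp_qf[OF l2])
  finally show ?thesis by (simp add: mgf_def)
qed

text \<open>The exponential lies above its tangent at \<open>l * mean\<close>, and the linear part
  of the tangent has expectation zero.\<close>

lemma mgf_jensen:
  assumes "l * L \<le> 1 / 4"
  shows "exp (l * mean) \<le> mgf l"
proof -
  interpret P: prob_space "gaussian_family C" by (rule prob_space_gaussian_family)
  have "exp (l * mean) = (LINT x|gaussian_family C. exp (l * mean) * (1 + l * (qf x - mean)))"
    using qf_integrable by (simp add: qf_mean P.prob_space)
  also have "\<dots> \<le> mgf l"
    unfolding mgf_def
  proof (rule integral_mono)
    show "integrable (gaussian_family C) (\<lambda>x. exp (l * mean) * (1 + l * (qf x - mean)))"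
      using qf_integrable by simp
    show "integrable (gaussian_family C) (\<lambda>x. exp (l * qf x))" by (rule exp_qf_integrable[OF assms])
    fix x
    have "exp (l * mean) * (1 + l * (qf x - mean)) \<le> exp (l * mean) * exp (l * (qf x - mean))"
      by (intro mult_left_mono exp_ge_add_one_self) auto
    then show "exp (l * mean) * (1 + l * (qf x - mean)) \<le> exp (l * qf x)"
      by (simp add: exp_add[symmetric] algebra_simps)
  qed
  finally show ?thesis .
qed

lemma mgf_mono:
  assumes "k \<le> l" "l * L \<le> 1 / 4"
  shows "mgf k \<le> mgf l"
  unfolding mgf_def
proof (rule integral_mono)
  have "k * L \<le> l * L" using assms L_pos by (simp add: mult_right_mono)
  then show "integrable (gaussian_family C) (\<lambda>x. exp (k * qf x))" using assms by (intro exp_qf_integrable) auto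
  show "integrable (gaussian_family C) (\<lambda>x. exp (l * qf x))" using assms by (intro exp_qf_integrable)
  show "exp (k * qf x) \<le> exp (l * qf x)" for x using assms qf_nonneg by (simp add: mult_right_mono)
qed

text \<open>The variance of \<open>exp (l / 2 * qf x)\<close> is non-negative.\<close>

lemma mgf_half_square:
  assumes "0 \<le> l" "l * L \<le> 1 / 4"
  shows "(mgf (l / 2))\<^sup>2 \<le> mgf l"
proof -
  interpret P: prob_space "gaussian_family C" by (rule prob_space_gaussian_family)
  have h: "l / 2 * L \<le> 1 / 4" using assms L_pos mult_nonneg_nonneg[of l L] by (simp add: field_simps)
  have sq: "(exp (l / 2 * t))\<^sup>2 = exp (l * t)" for t :: real
    by (simp add: power2_eq_square exp_add[symmetric] field_simps)
  have "0 \<le> P.variance (\<lambda>x. exp (l / 2 * qf x))" by simp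
  also have "\<dots> = mgf l - (mgf (l / 2))\<^sup>2"
    by (subst P.variance_eq) (simp_all only: sq exp_qf_integrable[OF h] exp_qf_integrable[OF assms(2)] mgf_def)
  finally show ?thesis by simp
qed

text \<open>Dividing the decoupled inequality by the Jensen bound for \<open>mgf (- k)\<close> gives
  \<open>step\<close>, which replaces \<open>k\<close> by the quadratically smaller
  \<open>2 * k\<^sup>2 * L\<close>. Two applications suffice: from \<open>l\<close> to
  \<open>m = 2 * l\<^sup>2 * L\<close>, and from \<open>m\<close> to an argument at most
  \<open>m / 2\<close>, where \<open>mgf_half_square\<close> leads back to
  \<open>mgf m\<close>.\<close>

lemma mgf_bound:
  assumes "\<bar>l\<bar> * L \<le> 1 / 4"
  shows "mgf l \<le> exp (l * mean + 4 * l\<^sup>2 * L * mean)"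
proof -
  have step: "mgf k \<le> exp (k * mean) * mgf (2 * k\<^sup>2 * L)" if "\<bar>k\<bar> * L \<le> 1 / 4" for k
  proof -
    have "- k * L \<le> 1 / 4" using that by (rule signed_le)
    then have "exp (- k * mean) \<le> mgf (- k)" by (rule mgf_jensen)
    then have "mgf k * exp (- k * mean) \<le> mgf k * mgf (- k)"
      by (intro mult_left_mono) (simp_all add: mgf_def)
    also have "\<dots> \<le> mgf (2 * k\<^sup>2 * L)" by (rule mgf_decoupling[OF that])
    finally have "mgf k * exp (- k * mean) * exp (k * mean) \<le> mgf (2 * k\<^sup>2 * L) * exp (k * mean)"
      by (intro mult_right_mono) auto
    moreover have "exp (- k * mean) * exp (k * mean) = 1" by (simp add: exp_add[symmetric])
    ultimately show ?thesis by (simp only: mult.assoc mult_1_right mult.commute[of _ "exp (k * mean)"] mult.left_commute[of "exp (k * mean)"])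
  qed
  define m where "m = 2 * l\<^sup>2 * L"
  have m0: "0 \<le> m" using L_pos by (simp add: m_def)
  have m1: "m * L \<le> 1 / 8"
  proof -
    have "m * L = 2 * (\<bar>l\<bar> * L)\<^sup>2" by (simp add: power2_eq_square m_def)
    also have "\<dots> \<le> 2 * (1 / 4)\<^sup>2" using assms L_pos by (intro mult_left_mono power_mono) auto
    finally show ?thesis by (simp add: power2_eq_square)
  qed
  have "2 * m\<^sup>2 * L = 2 * (m * L) * m" by (simp add: power2_eq_square)
  also have "\<dots> \<le> 2 * (1 / 8) * m" using m0 m1 by (intro mult_right_mono mult_left_mono) auto
  finally have m2: "2 * m\<^sup>2 * L \<le> m / 2" using m0 by simp
  have mL: "m / 2 * L \<le> 1 / 4" "m * L \<le> 1 / 4" using m1 m0 L_pos mult_nonneg_nonneg[of m L] by (auto simp: algebra_simps)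
  have "mgf m \<le> exp (m * mean) * mgf (2 * m\<^sup>2 * L)" using m0 mL by (intro step) auto
  also have "\<dots> \<le> exp (m * mean) * mgf (m / 2)" using m2 mL by (intro mult_left_mono mgf_mono) auto
  finally have a: "mgf m \<le> exp (m * mean) * mgf (m / 2)" .
  \<comment> \<open>After squaring, \<open>mgf m\<close> stands on the right only to the first
    power; cancelling it leaves exp (2 m mean) = exp (4 l^2 L mean).\<close>
  have "mgf m * mgf m = (mgf m)\<^sup>2" by (simp add: power2_eq_square)
  also have "\<dots> \<le> (exp (m * mean) * mgf (m / 2))\<^sup>2" using a by (intro power_mono) (simp_all add: mgf_def)
  also have "\<dots> \<le> (exp (m * mean))\<^sup>2 * mgf m"
    unfolding power_mult_distrib using mgf_half_square[OF m0 mL(2)] by (intro mult_left_mono) auto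
  finally have b: "mgf m * mgf m \<le> (exp (m * mean))\<^sup>2 * mgf m" .
  have "0 < exp (m * mean)" by simp
  also have "\<dots> \<le> mgf m" using mL by (intro mgf_jensen) auto
  finally have "mgf m \<le> (exp (m * mean))\<^sup>2" using b by (simp only: mult_le_cancel_right_pos)
  then have c: "mgf m \<le> exp (4 * l\<^sup>2 * L * mean)"
    by (simp add: m_def exp_double[symmetric] algebra_simps)
  have "mgf l \<le> exp (l * mean) * mgf m" unfolding m_def by (rule step[OF assms])
  also have "\<dots> \<le> exp (l * mean) * exp (4 * l\<^sup>2 * L * mean)" using c by (intro mult_left_mono) auto
  finally show ?thesis by (simp add: exp_add)
qed

text \<open>Choice of the Chernoff parameter. The range of \<open>l\<close> is capped at
  \<open>1 / (4 * L)\<close>, which separates two regimes; each term of \<open>s\<close> serves one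
  of them.\<close>

lemma mgf_centered_tail:
  assumes "mean \<le> 1" "0 \<le> u"
  defines "s \<equiv> 4 * sqrt (u * L) + 8 * u * L"
  obtains l where "0 \<le> l" "l * L \<le> 1 / 4" "4 * l\<^sup>2 * L * mean - l * s \<le> - u"
proof (cases "sqrt (u * L) \<le> 1 / 2")
  case True
  \<comment> \<open>Chosen such that \<open>4 * ?l\<^sup>2 * L = u\<close>; the first term of
    \<open>s\<close> alone then contributes \<open>2 * u\<close>.\<close>
  let ?l = "sqrt (u * L) / (2 * L)"
  have sq: "sqrt (u * L) * sqrt (u * L) = u * L" using assms L_pos by simp
  have "4 * ?l\<^sup>2 * L * mean \<le> 4 * ?l\<^sup>2 * L * 1" using assms L_pos by (intro mult_left_mono) auto
  also have "\<dots> = u" using sq L_pos assms by (simp add: power2_eq_square field_simps)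
  finally have 1: "4 * ?l\<^sup>2 * L * mean \<le> u" .
  have "2 * u = ?l * (4 * sqrt (u * L))" using sq L_pos by (simp add: field_simps)
  also have "\<dots> \<le> ?l * s" unfolding s_def using L_pos assms by (intro mult_left_mono) auto
  finally have 2: "2 * u \<le> ?l * s" .
  have "?l * L = sqrt (u * L) / 2" using L_pos by simp
  then have 3: "?l * L \<le> 1 / 4" using True by simp
  have 4: "0 \<le> ?l" using L_pos assms by simp
  show ?thesis by (rule that[OF 4 3]) (use 1 2 in linarith)
next
  case False
  \<comment> \<open>The cap. The term \<open>8 * u * L\<close> of \<open>s\<close> contributes
    \<open>2 * u\<close>, and the root term, here larger than 2, pays for the quadratic
    term.\<close>
  let ?l = "1 / (4 * L)"
  have "4 * ?l\<^sup>2 * L * mean \<le> 4 * ?l\<^sup>2 * L * 1" using assms L_pos by (intro mult_left_mono) auto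
  also have "\<dots> = ?l * 1" using L_pos by (simp add: power2_eq_square field_simps)
  also have "\<dots> \<le> ?l * (4 * sqrt (u * L))" using False L_pos by (intro mult_left_mono) auto
  finally have 1: "4 * ?l\<^sup>2 * L * mean \<le> ?l * (4 * sqrt (u * L))" .
  have "?l * s = ?l * (4 * sqrt (u * L)) + 2 * u" using L_pos by (simp add: s_def field_simps)
  then show ?thesis using 1 L_pos assms by (intro that[of ?l]) auto
qed

lemma tail:
  assumes "mean \<le> 1" "0 \<le> u"
  shows "measure (gaussian_family C) {x \<in> space (gaussian_family C).
      4 * sqrt (u * L) + 8 * u * L \<le> \<bar>qf x - mean\<bar>} \<le> 2 * exp (- u)"
proof -
  interpret P: prob_space "gaussian_family C" by (rule prob_space_gaussian_family)
  define s where "s = 4 * sqrt (u * L) + 8 * u * L"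
  from mgf_centered_tail[OF assms] obtain l where
    l: "0 \<le> l" "l * L \<le> 1 / 4" "4 * l\<^sup>2 * L * mean - l * s \<le> - u" unfolding s_def by blast
  \<comment> \<open>Exponential Markov inequality for \<open>k = l\<close> and
    \<open>k = - l\<close>, the upper and the lower tail.\<close>
  have one_sided: "P.prob {x \<in> space (gaussian_family C). exp (k * mean + l * s) \<le> exp (k * qf x)} \<le> exp (- u)"
    if "\<bar>k\<bar> = l" for k
  proof -
    have kL: "k * L \<le> 1 / 4" using signed_le(1)[of k] that l by simp
    have "P.prob {x \<in> space (gaussian_family C). exp (k * mean + l * s) \<le> exp (k * qf x)}
        \<le> (LINT x|gaussian_family C. exp (k * qf x)) / exp (k * mean + l * s)"
      by (rule integral_Markov_inequality_measure[where A = "{}"]) (auto simp: exp_qf_integrable[OF kL])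
    also have "\<dots> \<le> exp (k * mean + 4 * k\<^sup>2 * L * mean) / exp (k * mean + l * s)"
      using mgf_bound[of k] that l by (intro divide_right_mono) (auto simp: mgf_def)
    also have "\<dots> = exp (4 * l\<^sup>2 * L * mean - l * s)"
      using that by (auto simp: exp_diff[symmetric] power2_abs[symmetric, of k])
    also have "\<dots> \<le> exp (- u)" using l by simp
    finally show ?thesis .
  qed
  have "P.prob {x \<in> space (gaussian_family C). s \<le> \<bar>qf x - mean\<bar>}
     \<le> P.prob ({x \<in> space (gaussian_family C). exp (l * mean + l * s) \<le> exp (l * qf x)}
       \<union> {x \<in> space (gaussian_family C). exp (- l * mean + l * s) \<le> exp (- l * qf x)})"
  proof (rule P.finite_measure_mono)
    show "{x \<in> space (gaussian_family C). s \<le> \<bar>qf x - mean\<bar>} \<subseteq>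
      {x \<in> space (gaussian_family C). exp (l * mean + l * s) \<le> exp (l * qf x)}
       \<union> {x \<in> space (gaussian_family C). exp (- l * mean + l * s) \<le> exp (- l * qf x)}"
    proof
      fix x assume x: "x \<in> {x \<in> space (gaussian_family C). s \<le> \<bar>qf x - mean\<bar>}"
      then consider "s \<le> qf x - mean" | "s \<le> mean - qf x" by force
      then show "x \<in> {x \<in> space (gaussian_family C). exp (l * mean + l * s) \<le> exp (l * qf x)}
       \<union> {x \<in> space (gaussian_family C). exp (- l * mean + l * s) \<le> exp (- l * qf x)}"
        using x l(1) mult_left_mono[of s _ l] by cases (fastforce simp: right_diff_distrib)+
    qed
  qed measurable
  also have "\<dots> \<le> exp (- u) + exp (- u)"
    by (rule order_trans[OF measure_Un_le]) (use one_sided[of l] one_sided[of "- l"] l in \<open>auto intro!: add_mono\<close>)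
  finally show ?thesis by (simp add: s_def)
qed

end

subsection \<open>Real quadratic forms and the positive semidefinite square root\<close>

lemma scalar_prod_self_nonneg: "0 \<le> v \<bullet> (v :: real vec)"
  by (simp add: scalar_prod_def sum_nonneg)

lemma scalar_prod_self_eq_0:
  assumes "v \<in> carrier_vec d" "v \<bullet> v = (0 :: real)"
  shows "v = 0\<^sub>v d"
proof -
  have "\<forall>i\<in>{0..<dim_vec v}. v $ i * v $ i = 0"
    using assms(2) by (subst (asm) scalar_prod_def, subst (asm) sum_nonneg_eq_0_iff) auto
  then show ?thesis using assms(1) by (intro eq_vecI) auto
qed

lemma bilinear_entries:
  assumes "u \<in> carrier_vec n" "M \<in> carrier_mat n m" "v \<in> carrier_vec m"
  shows "u \<bullet> (M *\<^sub>v v) = (\<Sum>i<n. \<Sum>j<m. u $ i * M $$ (i, j) * v $ j)"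
  using assms by (simp add: scalar_prod_def row_def sum_distrib_left mult.assoc atLeast0LessThan)

lemma symmetric_form_swap:
  assumes "R \<in> carrier_mat d d" "transpose_mat R = R" "u \<in> carrier_vec d" "v \<in> carrier_vec d"
  shows "u \<bullet> (R *\<^sub>v v) = (R *\<^sub>v u) \<bullet> (v :: real vec)"
  using transpose_vec_mult_scalar[of R d d v u] assms by simp

text \<open>For a symmetric matrix the quadratic form controls the operator norm: polarization at
  \<open>t \<cdot>\<^sub>v w\<close> and \<open>v\<close>, with \<open>w = R *\<^sub>v v\<close>,
  bounds \<open>w \<bullet> w\<close>, and the scale \<open>t = 1 / c\<close> balances the two
  terms.\<close>

lemma symmetric_form_norm_bound:
  fixes R :: "real mat"
  assumes R: "R \<in> carrier_mat d d" and sym: "transpose_mat R = R" and c: "0 \<le> c"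
    and form: "\<And>v. v \<in> carrier_vec d \<Longrightarrow> \<bar>v \<bullet> (R *\<^sub>v v)\<bar> \<le> c * (v \<bullet> v)"
    and v: "v \<in> carrier_vec d"
  shows "(R *\<^sub>v v) \<bullet> (R *\<^sub>v v) \<le> c\<^sup>2 * (v \<bullet> v)"
proof -
  define w where "w = R *\<^sub>v v"
  have w: "w \<in> carrier_vec d" using R v by (simp add: w_def)
  have polar: "2 * t * (w \<bullet> w) \<le> c * (t\<^sup>2 * (w \<bullet> w) + v \<bullet> v)" for t
  proof -
    let ?u = "t \<cdot>\<^sub>v w"
    have u: "?u \<in> carrier_vec d" using w by simp
    have sw: "v \<bullet> (R *\<^sub>v ?u) = ?u \<bullet> (R *\<^sub>v v)"
      using symmetric_form_swap[OF R sym v u] comm_scalar_prod[OF u, of "R *\<^sub>v v"] R v by simp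
    have p: "(?u + v) \<bullet> (R *\<^sub>v (?u + v)) = ?u \<bullet> (R *\<^sub>v ?u) + 2 * (?u \<bullet> (R *\<^sub>v v)) + v \<bullet> (R *\<^sub>v v)"
      using R u v sw by (simp add: mult_add_distrib_mat_vec[of R d d] add_scalar_prod_distrib[of _ d] scalar_prod_add_distrib[of _ d])
    have m: "(?u - v) \<bullet> (R *\<^sub>v (?u - v)) = ?u \<bullet> (R *\<^sub>v ?u) - 2 * (?u \<bullet> (R *\<^sub>v v)) + v \<bullet> (R *\<^sub>v v)"
      using R u v sw by (simp add: mult_minus_distrib_mat_vec[of R d d] minus_scalar_prod_distrib[of _ d] scalar_prod_minus_distrib[of _ d])
    have n: "(?u + v) \<bullet> (?u + v) + (?u - v) \<bullet> (?u - v) = 2 * (?u \<bullet> ?u + v \<bullet> v)"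
      using u v by (simp add: add_scalar_prod_distrib[of _ d] scalar_prod_add_distrib[of _ d]
          minus_scalar_prod_distrib[of _ d] scalar_prod_minus_distrib[of _ d] algebra_simps)
    have "4 * (?u \<bullet> (R *\<^sub>v v)) \<le> c * ((?u + v) \<bullet> (?u + v)) + c * ((?u - v) \<bullet> (?u - v))"
      using form[of "?u + v"] form[of "?u - v"] p m u v by auto
    also have "\<dots> = c * (2 * (?u \<bullet> ?u + v \<bullet> v))"
      by (simp only: distrib_left[symmetric] n)
    finally show ?thesis using w by (simp add: w_def[symmetric] power2_eq_square algebra_simps)
  qed
  show ?thesis unfolding w_def[symmetric]
  proof (cases "c = 0")
    case True
    then show "w \<bullet> w \<le> c\<^sup>2 * (v \<bullet> v)" using polar[of 1] by simp
  next
    case False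
    then have c': "c > 0" using c by simp
    then have "2 * (w \<bullet> w) \<le> w \<bullet> w + c\<^sup>2 * (v \<bullet> v)"
      using mult_left_mono[OF polar[of "1 / c"], of c] by (simp add: power2_eq_square field_simps)
    then show "w \<bullet> w \<le> c\<^sup>2 * (v \<bullet> v)" by simp
  qed
qed

text \<open>With \<open>u = R *\<^sub>v w\<close>, the form along
  \<open>t \<cdot>\<^sub>v w + u\<close> loses its quadratic term and is affine in \<open>t\<close>
  with slope \<open>2 * (u \<bullet> u)\<close>; a non-negative affine function has slope
  zero.\<close>

lemma psd_mat_form_eq_0:
  assumes R: "psd_mat d R" and w: "w \<in> carrier_vec d" and zero: "w \<bullet> (R *\<^sub>v w) = 0"
  shows "R *\<^sub>v w = 0\<^sub>v d"
proof -
  have Rc: "R \<in> carrier_mat d d" and sym: "transpose_mat R = R"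
    and nn: "\<And>v. v \<in> carrier_vec d \<Longrightarrow> 0 \<le> v \<bullet> (R *\<^sub>v v)" using R by (auto simp: psd_mat_def)
  define u where "u = R *\<^sub>v w"
  have u: "u \<in> carrier_vec d" using Rc w by (simp add: u_def)
  have "0 \<le> 2 * t * (u \<bullet> u) + u \<bullet> (R *\<^sub>v u)" for t
  proof -
    have tw: "t \<cdot>\<^sub>v w \<in> carrier_vec d" using w by simp
    have Rtw: "R *\<^sub>v (t \<cdot>\<^sub>v w) = t \<cdot>\<^sub>v u" using Rc w by (simp add: mult_mat_vec u_def)
    have sw: "(t \<cdot>\<^sub>v w) \<bullet> (R *\<^sub>v u) = t * (u \<bullet> u)"
      using symmetric_form_swap[OF Rc sym tw u] Rtw u by simp
    have "(t \<cdot>\<^sub>v w + u) \<bullet> (R *\<^sub>v (t \<cdot>\<^sub>v w + u)) = t * (t * (w \<bullet> u)) + t * (u \<bullet> u) + (t \<cdot>\<^sub>v w) \<bullet> (R *\<^sub>v u) + u \<bullet> (R *\<^sub>v u)"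
      using Rc u w tw by (simp add: Rtw mult_add_distrib_mat_vec[of R d d]
          add_scalar_prod_distrib[of _ d] scalar_prod_add_distrib[of _ d] algebra_simps)
    then have "(t \<cdot>\<^sub>v w + u) \<bullet> (R *\<^sub>v (t \<cdot>\<^sub>v w + u)) = t * (t * (w \<bullet> u)) + 2 * t * (u \<bullet> u) + u \<bullet> (R *\<^sub>v u)"
      unfolding sw by simp
    then show ?thesis using nn[of "t \<cdot>\<^sub>v w + u"] zero tw u by (simp add: u_def)
  qed
  \<comment> \<open>This \<open>t\<close> would make the affine function equal to -1.\<close>
  from this[of "- (u \<bullet> (R *\<^sub>v u) + 1) / (2 * (u \<bullet> u))"] have "u \<bullet> u = 0"
    by (cases "u \<bullet> u = 0") (auto simp: field_simps)
  then show ?thesis using scalar_prod_self_eq_0[OF u] by (simp add: u_def)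
qed

lemma sum_diag_mult_comm:
  fixes M K :: "real mat"
  assumes "M \<in> carrier_mat d d" "K \<in> carrier_mat d d"
  shows "(\<Sum>i<d. (M * K) $$ (i, i)) = (\<Sum>i<d. (K * M) $$ (i, i))"
proof -
  have "(\<Sum>i<d. (M * K) $$ (i, i)) = (\<Sum>i<d. \<Sum>j<d. M $$ (i, j) * K $$ (j, i))"
    using assms by (simp add: scalar_prod_def atLeast0LessThan)
  also have "\<dots> = (\<Sum>j<d. \<Sum>i<d. M $$ (i, j) * K $$ (j, i))" by (rule sum.swap)
  also have "\<dots> = (\<Sum>j<d. (K * M) $$ (j, j))"
    using assms by (simp add: scalar_prod_def atLeast0LessThan mult.commute)
  finally show ?thesis .
qed

text \<open>
  For \<open>D = R - S\<close> one has \<open>RD + DS = 0\<close>; hence \<open>DRD\<close> and \<open>DSD\<close>, both positive semidefinite, have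
  traces adding up to zero.
\<close>

lemma psd_sqrt_unique:
  assumes R: "psd_mat d R" and S: "psd_mat d S" and eq: "R * R = S * S"
  shows "R = S"
proof -
  have Rc: "R \<in> carrier_mat d d" "transpose_mat R = R" and Sc: "S \<in> carrier_mat d d" "transpose_mat S = S"
    using R S by (auto simp: psd_mat_def)
  define D where "D = R - S"
  have D: "D \<in> carrier_mat d d" "transpose_mat D = D"
    using Rc Sc by (auto simp: D_def transpose_minus[of R d d])
  \<comment> \<open>By symmetry \<open>w i\<close> is also row \<open>i\<close> of \<open>D\<close>,
    so the diagonal of \<open>D * (T * D)\<close> consists of the values of the form of
    \<open>T\<close> at the columns of \<open>D\<close>.\<close>
  define w where "w i = col D i" for i
  have w: "w i \<in> carrier_vec d" for i using col_dim[of D i] D by (simp add: w_def)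
  have row: "row D i = w i" if "i < d" for i
    using D that by (metis w_def carrier_matD(1) col_transpose)
  have diag: "(D * (T * D)) $$ (i, i) = w i \<bullet> (T *\<^sub>v w i)" if "T \<in> carrier_mat d d" "i < d" for T i
    using D that row by (simp add: w_def col_mult2[of T d d D d])
  have RD: "R * D + D * S = 0\<^sub>m d d"
  proof -
    have "R * D + D * S = (R * R - R * S) + (R * S - S * S)"
      using Rc Sc by (simp add: D_def mult_minus_distrib_mat[of R d d] minus_mult_distrib_mat[of R d d])
    also have "\<dots> = 0\<^sub>m d d" using Rc Sc eq by (intro eq_matI) auto
    finally show ?thesis .
  qed
  have "(\<Sum>i<d. w i \<bullet> (R *\<^sub>v w i)) + (\<Sum>i<d. w i \<bullet> (S *\<^sub>v w i)) = 0"
  proof -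
    have "(\<Sum>i<d. (D * (S * D)) $$ (i, i)) = (\<Sum>i<d. ((S * D) * D) $$ (i, i))"
      using D Sc by (intro sum_diag_mult_comm) auto
    also have "\<dots> = (\<Sum>i<d. (D * (D * S)) $$ (i, i))"
      using D Sc sum_diag_mult_comm[of S d "D * D"] by (simp add: assoc_mult_mat[of _ d d _ d _ d])
    finally have "(\<Sum>i<d. w i \<bullet> (R *\<^sub>v w i)) + (\<Sum>i<d. w i \<bullet> (S *\<^sub>v w i))
      = (\<Sum>i<d. (D * (R * D)) $$ (i, i)) + (\<Sum>i<d. (D * (D * S)) $$ (i, i))"
      using diag[OF Rc(1)] diag[OF Sc(1)] by simp
    also have "\<dots> = (\<Sum>i<d. (D * (R * D) + D * (D * S)) $$ (i, i))"
      using D Rc Sc by (simp add: sum.distrib)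
    also have "D * (R * D) + D * (D * S) = D * (R * D + D * S)"
      using D Rc Sc by (intro mult_add_distrib_mat[symmetric, of _ d d _ d]) auto
    also have "\<dots> = 0\<^sub>m d d" using RD D by simp
    finally show ?thesis by simp
  qed
  moreover have nn: "0 \<le> w i \<bullet> (R *\<^sub>v w i)" "0 \<le> w i \<bullet> (S *\<^sub>v w i)" for i
    using R S w by (auto simp: psd_mat_def)
  ultimately have "(\<Sum>i<d. w i \<bullet> (R *\<^sub>v w i)) = 0" "(\<Sum>i<d. w i \<bullet> (S *\<^sub>v w i)) = 0"
    using sum_nonneg[of "{..<d}" "\<lambda>i. w i \<bullet> (R *\<^sub>v w i)"] sum_nonneg[of "{..<d}" "\<lambda>i. w i \<bullet> (S *\<^sub>v w i)"] by auto
  then have zero: "w i \<bullet> (R *\<^sub>v w i) = 0" "w i \<bullet> (S *\<^sub>v w i) = 0" if "i < d" for i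
    using nn that by (auto simp: sum_nonneg_eq_0_iff)
  \<comment> \<open>Both forms vanish at \<open>w i\<close>, so \<open>R\<close> and
    \<open>S\<close>, and with them \<open>D\<close>, annihilate it; but entry \<open>i\<close> of
    \<open>D *\<^sub>v w i\<close> is \<open>w i \<bullet> w i\<close>.\<close>
  have "w i = 0\<^sub>v d" if i: "i < d" for i
  proof -
    have "D *\<^sub>v w i = 0\<^sub>v d"
      using psd_mat_form_eq_0[OF R w zero(1)[OF i]] psd_mat_form_eq_0[OF S w zero(2)[OF i]] Rc Sc w
      by (simp add: D_def minus_mult_distrib_mat_vec[of R d d])
    then have "w i \<bullet> w i = 0" using i D row[OF i] by (metis carrier_matD(1) index_mult_mat_vec index_zero_vec(1))
    then show ?thesis using scalar_prod_self_eq_0[OF w] by simp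
  qed
  then have "D $$ (i, j) = 0" if "i < d" "j < d" for i j
    using that D by (metis w_def carrier_matD index_col index_zero_vec(1))
  then show ?thesis using Rc Sc by (intro eq_matI) (auto simp: D_def)
qed

section \<open>Existence of the square root by the binomial series\<close>

text \<open>The coefficients of the power series of \<open>\<surd>(1 - x)\<close>.\<close>

definition sqrt_coeff :: "nat \<Rightarrow> real" where
  "sqrt_coeff k = (- 1) ^ k * ((1 / 2) gchoose k)"

text \<open>These are the coefficients of (1 - x)^(-1/2); consecutive ones have the positive ratio
  (k + 1/2) / (k + 1).\<close>

lemma neg_half_gbinomial_nonneg: "0 \<le> (- 1) ^ k * ((- 1 / 2 :: real) gchoose k)"
proof (induction k)
  case (Suc k)
  have "(- 1 / 2) * ((- 1 / 2 :: real) gchoose k) = real k * ((- 1 / 2) gchoose k) + real (Suc k) * ((- 1 / 2) gchoose Suc k)"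
    by (rule gbinomial_mult_1)
  then have "real (Suc k) * ((- 1 / 2 :: real) gchoose Suc k) = - (real k + 1 / 2) * ((- 1 / 2) gchoose k)"
    by (simp add: algebra_simps)
  then have "- ((- 1) ^ k) * (real (Suc k) * ((- 1 / 2 :: real) gchoose Suc k)) = (real k + 1 / 2) * ((- 1) ^ k * ((- 1 / 2) gchoose k))"
    by (simp only: mult_minus_left mult_minus_right minus_minus mult_ac)
  then have "real (Suc k) * ((- 1) ^ Suc k * ((- 1 / 2 :: real) gchoose Suc k)) = (real k + 1 / 2) * ((- 1) ^ k * ((- 1 / 2) gchoose k))"
    by (simp only: power_Suc mult_ac mult_minus_left mult_minus_right mult_1_left)
  also have "\<dots> \<ge> 0" by (rule mult_nonneg_nonneg) (use Suc in auto)
  finally show ?case by (simp only: zero_le_mult_iff) auto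
qed simp

lemma sqrt_coeff_0 [simp]: "sqrt_coeff 0 = 1"
  by (simp add: sqrt_coeff_def)

text \<open>The derivative of sqrt (1 - x) is -(1/2) (1 - x)^(-1/2); coefficientwise this is the
  absorption identity, so the sign comes from \<open>neg_half_gbinomial_nonneg\<close>.\<close>

lemma sqrt_coeff_nonpos:
  assumes "0 < k"
  shows "sqrt_coeff k \<le> 0"
proof -
  obtain j where k: "k = Suc j" using assms by (cases k) auto
  have "real (Suc j) * ((1 / 2) gchoose Suc j) = (1 / 2) * ((- 1 / 2 :: real) gchoose j)"
    using gbinomial_absorption[of j "1 / 2 :: real"] by simp
  then have "- ((- 1) ^ j) * (real (Suc j) * ((1 / 2) gchoose Suc j)) = - (1 / 2) * ((- 1) ^ j * ((- 1 / 2) gchoose j))"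
    by (simp only: mult_minus_left mult_minus_right mult_ac)
  then have "real (Suc j) * sqrt_coeff k = - (1 / 2) * ((- 1) ^ j * ((- 1 / 2) gchoose j))"
    by (simp only: sqrt_coeff_def k power_Suc mult_ac mult_minus_left mult_minus_right mult_1_left)
  also have "\<dots> \<le> 0" using neg_half_gbinomial_nonneg[of j] by simp
  finally show ?thesis by (simp add: mult_le_0_iff)
qed

text \<open>The partial sums are the coefficients of sqrt (1 - x) / (1 - x) = (1 -
  x)^(-1/2).\<close>

lemma sum_sqrt_coeff_nonneg: "0 \<le> (\<Sum>k\<le>n. sqrt_coeff k)"
  using gbinomial_sum_lower_neg[of "1 / 2 :: real" n] neg_half_gbinomial_nonneg[of n]
  by (simp add: sqrt_coeff_def mult.commute)

lemma summable_abs_sqrt_coeff: "summable (\<lambda>k. \<bar>sqrt_coeff k\<bar>)"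
proof (rule bounded_imp_summable)
  fix n
  \<comment> \<open>Only the coefficient at 0 is positive, and it is 1, so the absolute values sum
    to 2 minus the partial sum.\<close>
  have "(\<Sum>k\<le>n. \<bar>sqrt_coeff k\<bar>) = (\<Sum>k\<le>n. (if k = 0 then 2 else 0) - sqrt_coeff k)"
    using sqrt_coeff_nonpos by (intro sum.cong) (auto simp: abs_of_nonpos)
  also have "\<dots> \<le> 2" using sum_sqrt_coeff_nonneg[of n] by (simp add: sum_subtractf)
  finally show "(\<Sum>k\<le>n. \<bar>sqrt_coeff k\<bar>) \<le> 2" .
qed simp

text \<open>The square of the series is 1 - x, by Vandermonde's identity.\<close>

lemma sqrt_coeff_convolution: "(\<Sum>i\<le>n. sqrt_coeff i * sqrt_coeff (n - i)) = (if n = 0 then 1 else if n = 1 then - 1 else 0)"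
proof -
  have "(\<Sum>i\<le>n. sqrt_coeff i * sqrt_coeff (n - i)) = (\<Sum>i\<le>n. (- 1) ^ n * (((1 / 2) gchoose i) * ((1 / 2) gchoose (n - i))))"
  proof (intro sum.cong refl)
    fix i assume "i \<in> {..n}"
    then have "(- 1 :: real) ^ n = (- 1) ^ i * (- 1) ^ (n - i)" by (simp add: power_add[symmetric])
    then show "sqrt_coeff i * sqrt_coeff (n - i) = (- 1) ^ n * (((1 / 2) gchoose i) * ((1 / 2) gchoose (n - i)))"
      by (simp add: sqrt_coeff_def)
  qed
  also have "\<dots> = (- 1) ^ n * (1 gchoose n)"
    using gbinomial_Vandermonde[of "1 / 2 :: real" "1 / 2" n] by (simp add: sum_distrib_left[symmetric] atLeast0AtMost)
  also have "(1 :: real) gchoose n = of_nat (1 choose n)" by (simp add: binomial_gbinomial)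
  finally show ?thesis by (cases n) (auto simp: binomial_eq_0)
qed

lemma pow_mat_commute:
  assumes "X \<in> carrier_mat d d"
  shows "X ^\<^sub>m k * X = X * X ^\<^sub>m k"
proof (induction k)
  case (Suc k)
  have X: "X ^\<^sub>m k \<in> carrier_mat d d" using assms by simp
  have "X ^\<^sub>m Suc k * X = (X * X ^\<^sub>m k) * X" by (simp add: Suc)
  also have "\<dots> = X * (X ^\<^sub>m k * X)" by (rule assoc_mult_mat[OF assms X assms])
  finally show ?case by simp
qed (use assms in simp)

lemma pow_mat_add:
  assumes "X \<in> carrier_mat d d"
  shows "X ^\<^sub>m (i + j) = X ^\<^sub>m i * X ^\<^sub>m j"
proof (induction j)
  case 0
  have "X ^\<^sub>m i \<in> carrier_mat d d" using assms by simp
  then show ?case using assms by simp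
next
  case (Suc j)
  have "X ^\<^sub>m i \<in> carrier_mat d d" "X ^\<^sub>m j \<in> carrier_mat d d" using assms by auto
  then show ?case using assms Suc by (simp add: assoc_mult_mat[of _ d d _ d _ d])
qed

lemma pow_mat_symmetric:
  fixes X :: "'a :: comm_semiring_1 mat"
  assumes "X \<in> carrier_mat d d" "transpose_mat X = X"
  shows "transpose_mat (X ^\<^sub>m k) = X ^\<^sub>m k"
proof (induction k)
  case (Suc k)
  have X: "X ^\<^sub>m k \<in> carrier_mat d d" using assms by simp
  show ?case using transpose_mult[OF X assms(1)] pow_mat_commute[OF assms(1), of k] Suc assms(2) by simp
qed (use assms in simp)

lemma smult_mat_mult_vec:
  assumes "M \<in> carrier_mat n m" "v \<in> carrier_vec m"
  shows "(k \<cdot>\<^sub>m M) *\<^sub>v v = k \<cdot>\<^sub>v (M *\<^sub>v (v :: real vec))"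
  using assms by (intro eq_vecI) auto

lemma transpose_mat_smult: "transpose_mat (k \<cdot>\<^sub>m M) = k \<cdot>\<^sub>m transpose_mat M"
  by (intro eq_matI) auto

lemma mult_unit_vec_entry:
  assumes "M \<in> carrier_mat n d" "i < n" "j < d"
  shows "(M *\<^sub>v unit_vec d j) $ i = (M :: real mat) $$ (i, j)"
  using assms by simp

lemma entry_square_le:
  assumes "v \<in> carrier_vec d" "i < d"
  shows "(v $ i)\<^sup>2 \<le> v \<bullet> (v :: real vec)"
  using assms member_le_sum[of i "{0..<d}" "\<lambda>i. (v $ i)\<^sup>2"] by (simp add: scalar_prod_def power2_eq_square)

text \<open>The root is the binomial series in \<open>X = 1\<^sub>m d - P\<close>. As 0 <= P <= 1,
  all powers of \<open>X\<close> are contractions, so the series converges absolutely in every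
  entry, and the Cauchy product squares it to 1 - X = P. Positivity holds because the coefficients
  after the first are non-positive while the form of every power is at most
  \<open>v \<bullet> v\<close>: the partial sums of the form are at least the non-negative partial
  sums of the coefficients times \<open>v \<bullet> v\<close>.\<close>

lemma psd_sqrt_exists_contraction:
  assumes P: "psd_mat d P" and le: "\<And>v. v \<in> carrier_vec d \<Longrightarrow> v \<bullet> (P *\<^sub>v v) \<le> v \<bullet> v"
  shows "\<exists>S. psd_mat d S \<and> S * S = P"
proof -
  have Pc: "P \<in> carrier_mat d d" and Psym: "transpose_mat P = P"
    and Pnn: "\<And>v. v \<in> carrier_vec d \<Longrightarrow> 0 \<le> v \<bullet> (P *\<^sub>v v)" using P by (auto simp: psd_mat_def)
  define X where "X = 1\<^sub>m d - P"
  have X: "X \<in> carrier_mat d d" "transpose_mat X = X"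
    using Pc Psym by (auto simp: X_def transpose_minus[of _ d d])
  have Xform: "v \<bullet> (X *\<^sub>v v) = v \<bullet> v - v \<bullet> (P *\<^sub>v v)" if "v \<in> carrier_vec d" for v
    using that Pc by (simp add: X_def minus_mult_distrib_mat_vec[of _ d d] scalar_prod_minus_distrib[of _ d])
  have contr: "(X *\<^sub>v v) \<bullet> (X *\<^sub>v v) \<le> v \<bullet> v" if v: "v \<in> carrier_vec d" for v
    using symmetric_form_norm_bound[OF X, of 1 v] Xform Pnn le v by simp
  define Y where "Y k = X ^\<^sub>m k" for k
  have Y0: "Y 0 = 1\<^sub>m d" and Y1: "Y 1 = X" using X by (auto simp: Y_def)
  have Yadd: "Y (i + j) = Y i * Y j" for i j unfolding Y_def by (rule pow_mat_add[OF X(1)])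
  have Xk: "Y k \<in> carrier_mat d d" "transpose_mat (Y k) = Y k" for k
    using X pow_mat_symmetric[OF X] by (auto simp: Y_def)
  note Xdim = carrier_matD[OF Xk(1)]
  have contr_k: "(Y k *\<^sub>v v) \<bullet> (Y k *\<^sub>v v) \<le> v \<bullet> v" if v: "v \<in> carrier_vec d" for v k
  proof (induction k)
    case 0
    then show ?case using v by (simp add: Y0)
  next
    case (Suc k)
    have "Y (Suc k) *\<^sub>v v = X *\<^sub>v (Y k *\<^sub>v v)"
      using X v Xk(1)[of k] Yadd[of 1 k] Y1 by (simp add: assoc_mult_mat_vec[of X d d _ d])
    moreover have "Y k *\<^sub>v v \<in> carrier_vec d" by (rule mult_mat_vec_carrier[OF Xk(1) v])
    ultimately show ?case using contr[of "Y k *\<^sub>v v"] Suc by simp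
  qed
  have form_k: "v \<bullet> (Y k *\<^sub>v v) \<le> v \<bullet> v" if v: "v \<in> carrier_vec d" for v k
  proof -
    let ?w = "Y k *\<^sub>v v"
    have w: "?w \<in> carrier_vec d" by (rule mult_mat_vec_carrier[OF Xk(1) v])
    have "0 \<le> (v - ?w) \<bullet> (v - ?w)" by (rule scalar_prod_self_nonneg)
    also have "\<dots> = v \<bullet> v - 2 * (v \<bullet> ?w) + ?w \<bullet> ?w"
      using v w comm_scalar_prod[OF v w] by (simp add: minus_scalar_prod_distrib[of _ d] scalar_prod_minus_distrib[of _ d])
    finally show ?thesis using contr_k[OF v, of k] by simp
  qed
  have entry: "\<bar>Y k $$ (i, j)\<bar> \<le> 1" if "i < d" "j < d" for k i j
  proof -
    let ?w = "Y k *\<^sub>v unit_vec d j"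
    have w: "?w \<in> carrier_vec d" by (rule mult_mat_vec_carrier[OF Xk(1)]) simp
    have wi: "?w $ i = Y k $$ (i, j)" by (rule mult_unit_vec_entry[OF Xk(1) that])
    have "(?w $ i)\<^sup>2 \<le> ?w \<bullet> ?w" by (rule entry_square_le[OF w that(1)])
    also have "\<dots> \<le> unit_vec d j \<bullet> unit_vec d j" by (rule contr_k) simp
    also have "\<dots> = 1" using that by simp
    finally show ?thesis unfolding wi by (simp add: abs_square_le_1)
  qed
  have abs_sum: "summable (\<lambda>k. norm (sqrt_coeff k * Y k $$ (i, j)))" if "i < d" "j < d" for i j
    using summable_abs_sqrt_coeff entry[OF that]
    by (intro summable_comparison_test'[OF summable_abs_sqrt_coeff, of 0]) (auto simp: abs_mult mult_left_le)
  note summ = summable_norm_cancel[OF abs_sum]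
  define S where "S = mat d d (\<lambda>(i, j). \<Sum>k. sqrt_coeff k * Y k $$ (i, j))"
  have S: "S \<in> carrier_mat d d" by (simp add: S_def)
  have Sij: "S $$ (i, j) = (\<Sum>k. sqrt_coeff k * Y k $$ (i, j))" if "i < d" "j < d" for i j
    using that by (simp add: S_def)
  have Ssym: "transpose_mat S = S"
  proof (rule eq_matI)
    fix i j assume "i < dim_row S" "j < dim_col S"
    then have ij: "i < d" "j < d" using S by auto
    have "Y k $$ (j, i) = Y k $$ (i, j)" for k
      using arg_cong[OF Xk(2)[of k], of "\<lambda>M. M $$ (i, j)"] Xdim ij by simp
    then show "transpose_mat S $$ (i, j) = S $$ (i, j)" using S ij by (simp add: Sij)
  qed (use S in auto)
  have SS: "S * S = P"
  proof (rule eq_matI)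
    fix i j assume "i < dim_row P" "j < dim_col P"
    then have ij: "i < d" "j < d" using Pc by auto
    have "(S * S) $$ (i, j) = (\<Sum>l<d. (\<Sum>k. sqrt_coeff k * Y k $$ (i, l)) * (\<Sum>k. sqrt_coeff k * Y k $$ (l, j)))"
      using S ij by (simp add: scalar_prod_def Sij atLeast0LessThan)
    also have "\<dots> = (\<Sum>l<d. \<Sum>n. \<Sum>k\<le>n. (sqrt_coeff k * Y k $$ (i, l)) * (sqrt_coeff (n - k) * Y (n - k) $$ (l, j)))"
      using ij by (intro sum.cong refl Cauchy_product abs_sum) auto
    also have "\<dots> = (\<Sum>n. \<Sum>l<d. \<Sum>k\<le>n. (sqrt_coeff k * Y k $$ (i, l)) * (sqrt_coeff (n - k) * Y (n - k) $$ (l, j)))"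
      using ij by (intro suminf_sum[symmetric] sums_summable[OF Cauchy_product_sums] abs_sum) auto
    also have "\<dots> = (\<Sum>n. (\<Sum>k\<le>n. sqrt_coeff k * sqrt_coeff (n - k)) * Y n $$ (i, j))"
    proof (intro suminf_cong)
      fix n
      have "(\<Sum>l<d. \<Sum>k\<le>n. (sqrt_coeff k * Y k $$ (i, l)) * (sqrt_coeff (n - k) * Y (n - k) $$ (l, j)))
        = (\<Sum>k\<le>n. \<Sum>l<d. (sqrt_coeff k * Y k $$ (i, l)) * (sqrt_coeff (n - k) * Y (n - k) $$ (l, j)))"
        by (rule sum.swap)
      also have "\<dots> = (\<Sum>k\<le>n. sqrt_coeff k * sqrt_coeff (n - k) * Y n $$ (i, j))"
      proof (intro sum.cong refl)
        fix k assume "k \<in> {..n}"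
        then have "Y n = Y k * Y (n - k)" using Yadd[of k "n - k"] by simp
        then have "Y n $$ (i, j) = (\<Sum>l<d. Y k $$ (i, l) * Y (n - k) $$ (l, j))"
          using Xdim ij by (simp add: scalar_prod_def atLeast0LessThan)
        then show "(\<Sum>l<d. (sqrt_coeff k * Y k $$ (i, l)) * (sqrt_coeff (n - k) * Y (n - k) $$ (l, j)))
            = sqrt_coeff k * sqrt_coeff (n - k) * Y n $$ (i, j)"
          by (simp add: sum_distrib_left mult_ac)
      qed
      finally show "(\<Sum>l<d. \<Sum>k\<le>n. (sqrt_coeff k * Y k $$ (i, l)) * (sqrt_coeff (n - k) * Y (n - k) $$ (l, j)))
        = (\<Sum>k\<le>n. sqrt_coeff k * sqrt_coeff (n - k)) * Y n $$ (i, j)" by (simp add: sum_distrib_right)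
    qed
    also have "\<dots> = (\<Sum>n\<in>{0, 1}. (\<Sum>k\<le>n. sqrt_coeff k * sqrt_coeff (n - k)) * Y n $$ (i, j))"
      by (intro suminf_finite) (auto simp: sqrt_coeff_convolution)
    also have "\<dots> = Y 0 $$ (i, j) - Y 1 $$ (i, j)"
      by (simp add: sqrt_coeff_convolution)
    also have "\<dots> = P $$ (i, j)" using Pc ij by (simp add: X_def Y0 Y1[unfolded One_nat_def])
    finally show "(S * S) $$ (i, j) = P $$ (i, j)" .
  qed (use S Pc in auto)
  have "0 \<le> v \<bullet> (S *\<^sub>v v)" if v: "v \<in> carrier_vec d" for v
  proof -
    have "(\<lambda>k. \<Sum>i<d. \<Sum>j<d. v $ i * (sqrt_coeff k * Y k $$ (i, j)) * v $ j) sums (\<Sum>i<d. \<Sum>j<d. v $ i * S $$ (i, j) * v $ j)"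
      by (intro sums_sum sums_mult sums_mult2) (simp add: Sij summ summable_sums)
    moreover have "(\<Sum>i<d. \<Sum>j<d. v $ i * (sqrt_coeff k * Y k $$ (i, j)) * v $ j) = sqrt_coeff k * (v \<bullet> (Y k *\<^sub>v v))" for k
      using bilinear_entries[OF v Xk(1)[of k] v] by (simp add: sum_distrib_left mult_ac)
    ultimately have "(\<lambda>k. sqrt_coeff k * (v \<bullet> (Y k *\<^sub>v v))) sums (v \<bullet> (S *\<^sub>v v))"
      using bilinear_entries[OF v S v] by simp
    then have lim: "(\<lambda>n. \<Sum>k\<le>n. sqrt_coeff k * (v \<bullet> (Y k *\<^sub>v v))) \<longlonglongrightarrow> v \<bullet> (S *\<^sub>v v)"
      by (simp add: sums_def_le)
    have "0 \<le> (\<Sum>k\<le>n. sqrt_coeff k * (v \<bullet> (Y k *\<^sub>v v)))" for n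
    proof -
      have "0 \<le> (\<Sum>k\<le>n. sqrt_coeff k) * (v \<bullet> v)"
        by (intro mult_nonneg_nonneg sum_sqrt_coeff_nonneg scalar_prod_self_nonneg)
      also have "\<dots> \<le> (\<Sum>k\<le>n. sqrt_coeff k * (v \<bullet> (Y k *\<^sub>v v)))"
        unfolding sum_distrib_right
      proof (intro sum_mono)
        fix k
        show "sqrt_coeff k * (v \<bullet> v) \<le> sqrt_coeff k * (v \<bullet> (Y k *\<^sub>v v))"
        proof (cases "k = 0")
          case True
          then show ?thesis using v by (simp add: Y0)
        next
          case False
          then show ?thesis using sqrt_coeff_nonpos[of k] form_k[OF v] by (intro mult_left_mono_neg) auto
        qed
      qed
      finally show ?thesis .
    qed
    then show ?thesis using lim by (intro LIMSEQ_le_const[OF lim]) auto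
  qed
  then have "psd_mat d S" using S Ssym by (simp add: psd_mat_def)
  then show ?thesis using SS by blast
qed

lemma psd_sqrt_exists:
  assumes P: "psd_mat d P"
  shows "\<exists>S. psd_mat d S \<and> S * S = P"
proof -
  have Pc: "P \<in> carrier_mat d d" and Psym: "transpose_mat P = P"
    and Pnn: "\<And>v. v \<in> carrier_vec d \<Longrightarrow> 0 \<le> v \<bullet> (P *\<^sub>v v)" using P by (auto simp: psd_mat_def)
  \<comment> \<open>The entry sum bounds the form, and the summand 1 keeps \<open>K\<close> positive
    even for \<open>P = 0\<close>; dividing by \<open>K\<close> reduces to the contraction
    case.\<close>
  define K where "K = 1 + (\<Sum>i<d. \<Sum>j<d. \<bar>P $$ (i, j)\<bar>)"
  have K: "K > 0" unfolding K_def by (intro add_pos_nonneg sum_nonneg) auto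
  have le: "v \<bullet> (P *\<^sub>v v) \<le> K * (v \<bullet> v)" if v: "v \<in> carrier_vec d" for v
  proof -
    note sq = entry_square_le[OF v]
    have "v $ i * P $$ (i, j) * v $ j \<le> \<bar>P $$ (i, j)\<bar> * (v \<bullet> v)" if "i < d" "j < d" for i j
    proof -
      have "v $ i * P $$ (i, j) * v $ j \<le> \<bar>P $$ (i, j)\<bar> * \<bar>v $ i * v $ j\<bar>"
        using abs_ge_self[of "v $ i * P $$ (i, j) * v $ j"] by (simp add: abs_mult mult_ac)
      also have "\<bar>v $ i * v $ j\<bar> \<le> v \<bullet> v"
        using sq[OF that(1)] sq[OF that(2)] sum_squares_bound[of "\<bar>v $ i\<bar>" "\<bar>v $ j\<bar>"] by (simp add: abs_mult)
      finally show ?thesis by (simp add: mult_left_mono)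
    qed
    then have "v \<bullet> (P *\<^sub>v v) \<le> (\<Sum>i<d. \<Sum>j<d. \<bar>P $$ (i, j)\<bar> * (v \<bullet> v))"
      unfolding bilinear_entries[OF v Pc v] by (intro sum_mono) auto
    also have "\<dots> \<le> K * (v \<bullet> v)" using scalar_prod_self_nonneg[of v]
      by (simp add: K_def sum_distrib_right[symmetric] distrib_right)
    finally show ?thesis .
  qed
  let ?P = "(1 / K) \<cdot>\<^sub>m P"
  have form: "v \<bullet> (?P *\<^sub>v v) = v \<bullet> (P *\<^sub>v v) / K" if v: "v \<in> carrier_vec d" for v
    using v Pc by (simp add: smult_mat_mult_vec[OF Pc v])
  have "psd_mat d ?P"
    using Pc Psym K Pnn form by (auto simp: psd_mat_def transpose_mat_smult)
  moreover have "v \<bullet> (?P *\<^sub>v v) \<le> v \<bullet> v" if v: "v \<in> carrier_vec d" for v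
    using form[OF v] le[OF v] K by (simp add: divide_le_eq mult.commute)
  ultimately obtain S where S: "psd_mat d S" "S * S = ?P" using psd_sqrt_exists_contraction by blast
  have Sc: "S \<in> carrier_mat d d" using S by (simp add: psd_mat_def)
  let ?S = "sqrt K \<cdot>\<^sub>m S"
  have "?S * ?S = P"
    using Sc S(2) Pc K by (simp add: mult_smult_distrib[of _ d d _ d] mult_smult_assoc_mat[of _ d d _ d]) (auto intro!: eq_matI simp: mult.assoc[symmetric])
  moreover have "psd_mat d ?S"
    using S Sc K by (auto simp: psd_mat_def transpose_mat_smult smult_mat_mult_vec[OF Sc])
  ultimately show ?thesis by blast
qed

lemma psd_sqrt_spec:
  assumes "psd_mat d P"
  shows "psd_mat d (psd_sqrt P)" "psd_sqrt P * psd_sqrt P = P"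
proof -
  have d: "dim_row P = d" using assms by (auto simp: psd_mat_def)
  have "\<exists>!R. psd_mat d R \<and> R * R = P"
    using psd_sqrt_exists[OF assms] psd_sqrt_unique by metis
  from theI'[OF this] show "psd_mat d (psd_sqrt P)" "psd_sqrt P * psd_sqrt P = P"
    by (auto simp: psd_sqrt_def d)
qed

lemma inv_sqrt_spec:
  assumes P: "P \<in> carrier_mat d d" "transpose_mat P = P"
    and pos: "\<And>v. v \<in> carrier_vec d \<Longrightarrow> v \<noteq> 0\<^sub>v d \<Longrightarrow> 0 < v \<bullet> (P *\<^sub>v v)"
  shows "inv_sqrt P \<in> carrier_mat d d" "transpose_mat (inv_sqrt P) = inv_sqrt P"
    "inv_sqrt P * P * inv_sqrt P = 1\<^sub>m d"
proof -
  have "Determinant.det P \<noteq> 0"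
  proof
    assume "Determinant.det P = 0"
    then obtain v where v: "v \<in> carrier_vec d" "v \<noteq> 0\<^sub>v d" "P *\<^sub>v v = 0\<^sub>v d"
      using det_0_iff_vec_prod_zero_field[OF P(1)] by blast
    then show False using pos[of v] by simp
  qed
  then have "P \<in> Units (ring_mat TYPE(real) d ())" by (rule det_non_zero_imp_unit[OF P(1)])
  then obtain K where K: "mat_inverse P = Some K" using mat_inverse(1)[where b = "()", OF P(1)] by (cases "mat_inverse P") auto
  from mat_inverse(2)[OF P(1) K] have Ki: "P * K = 1\<^sub>m d" "K * P = 1\<^sub>m d" "K \<in> carrier_mat d d" by auto
  have Ksym: "transpose_mat K = K"
  proof -
    have "transpose_mat K * P = 1\<^sub>m d"
      using transpose_mult[OF P(1) Ki(3)] Ki(1) P(2) by simp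
    then have "transpose_mat K * P * K = K" using Ki(3) by simp
    then show ?thesis using Ki P by (simp add: assoc_mult_mat[of _ d d _ d _ d])
  qed
  have "0 \<le> v \<bullet> (K *\<^sub>v v)" if v: "v \<in> carrier_vec d" for v
  proof -
    have w: "K *\<^sub>v v \<in> carrier_vec d" using Ki v by simp
    have "v = P *\<^sub>v (K *\<^sub>v v)" using Ki P v by (simp add: assoc_mult_mat_vec[of P d d K d v, symmetric])
    then have "v \<bullet> (K *\<^sub>v v) = (K *\<^sub>v v) \<bullet> (P *\<^sub>v (K *\<^sub>v v))" using comm_scalar_prod[OF v w] by simp
    also have "\<dots> \<ge> 0" using pos[OF w] P by (cases "K *\<^sub>v v = 0\<^sub>v d") auto
    finally show ?thesis .
  qed
  then have "psd_mat d K" using Ki Ksym by (simp add: psd_mat_def)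
  note spec = psd_sqrt_spec[OF this]
  have Q: "inv_sqrt P = psd_sqrt K" by (simp add: inv_sqrt_def K)
  show c: "inv_sqrt P \<in> carrier_mat d d" and "transpose_mat (inv_sqrt P) = inv_sqrt P"
    using spec by (auto simp: Q psd_mat_def)
  \<comment> \<open>\<open>inv_sqrt P\<close> squares to the inverse of \<open>P\<close>, so
    \<open>inv_sqrt P * P\<close> is its right inverse, and for square matrices also its left
    inverse.\<close>
  have "inv_sqrt P * (inv_sqrt P * P) = 1\<^sub>m d"
    using spec(2) Ki c P by (simp add: Q[symmetric] assoc_mult_mat[of _ d d _ d _ d, symmetric])
  then show "inv_sqrt P * P * inv_sqrt P = 1\<^sub>m d"
    using c P by (intro mat_mult_left_right_inverse[of "inv_sqrt P" d]) auto
qed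

subsection \<open>The operator norm\<close>

lemma euclid_norm_nonneg: "0 \<le> euclid_norm v"
  by (simp add: euclid_norm_def L2_set_nonneg)

lemma euclid_norm_real: "euclid_norm v = sqrt (v \<bullet> (v :: real vec))"
  by (simp add: euclid_norm_def L2_set_def scalar_prod_def power2_eq_square atLeast0LessThan)

lemma euclid_norm_real_square: "(euclid_norm v)\<^sup>2 = v \<bullet> (v :: real vec)"
  by (simp add: euclid_norm_real scalar_prod_self_nonneg)

lemma euclid_norm_smult: "euclid_norm (k \<cdot>\<^sub>v v) = norm k * euclid_norm v"
  by (simp add: euclid_norm_def L2_set_def norm_mult power_mult_distrib sum_distrib_left[symmetric] real_sqrt_mult)

lemma euclid_norm_zero [simp]: "euclid_norm (0\<^sub>v n) = 0"
  by (simp add: euclid_norm_def L2_set_def)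

lemma norm_entry_le:
  assumes "i < dim_vec v"
  shows "norm (v $ i) \<le> euclid_norm v"
  using assms unfolding euclid_norm_def by (intro member_le_L2_set) auto

lemma euclid_norm_eq_0:
  assumes "v \<in> carrier_vec n" "euclid_norm v = 0"
  shows "v = 0\<^sub>v n"
proof (rule eq_vecI)
  fix i assume "i < dim_vec (0\<^sub>v n :: 'a vec)"
  then show "v $ i = 0\<^sub>v n $ i" using assms norm_entry_le[of i v] by auto
qed (use assms in auto)

lemma scalar_prod_le_euclid_norm:
  assumes "u \<in> carrier_vec n" "v \<in> carrier_vec n"
  shows "\<bar>u \<bullet> v\<bar> \<le> euclid_norm u * euclid_norm (v :: real vec)"
proof -
  have "\<bar>u \<bullet> v\<bar> \<le> (\<Sum>i<n. \<bar>u $ i\<bar> * \<bar>v $ i\<bar>)"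
    using assms sum_abs[of "\<lambda>i. u $ i * v $ i" "{..<n}"] by (simp add: scalar_prod_def abs_mult atLeast0LessThan)
  also have "\<dots> \<le> L2_set (\<lambda>i. u $ i) {..<n} * L2_set (\<lambda>i. v $ i) {..<n}" by (rule L2_set_mult_ineq)
  finally show ?thesis using assms by (simp add: euclid_norm_def L2_set_def)
qed

text \<open>A crude bound that shows the suprema in \<open>op_norm\<close> and \<open>L_sup\<close>
  to be taken over bounded sets; on an unbounded set \<open>SUP\<close> would carry no
  information.\<close>

definition entry_sum :: "'a::real_normed_field mat \<Rightarrow> real" where
  "entry_sum M = (\<Sum>i<dim_row M. \<Sum>j<dim_col M. norm (M $$ (i, j)))"

lemma euclid_norm_le_entry_sum:
  assumes "v \<in> carrier_vec (dim_col M)" "euclid_norm v \<le> 1"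
  shows "euclid_norm (M *\<^sub>v v) \<le> entry_sum M"
proof -
  have "euclid_norm (M *\<^sub>v v) \<le> (\<Sum>i<dim_row M. norm ((M *\<^sub>v v) $ i))"
    unfolding euclid_norm_def by (simp del: index_mult_mat_vec) (rule L2_set_le_sum, simp)
  also have "\<dots> \<le> entry_sum M"
    unfolding entry_sum_def
  proof (rule sum_mono)
    fix i assume "i \<in> {..<dim_row M}"
    then have "(M *\<^sub>v v) $ i = (\<Sum>j<dim_col M. M $$ (i, j) * v $ j)"
      using assms(1) by (simp add: scalar_prod_def row_def atLeast0LessThan)
    then have "norm ((M *\<^sub>v v) $ i) \<le> (\<Sum>j<dim_col M. norm (M $$ (i, j)) * norm (v $ j))"
      using norm_sum[of "\<lambda>j. M $$ (i, j) * v $ j" "{..<dim_col M}"] by (simp add: norm_mult)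
    also have "\<dots> \<le> (\<Sum>j<dim_col M. norm (M $$ (i, j)) * 1)"
      using assms norm_entry_le[of _ v] by (intro sum_mono mult_left_mono) (auto intro: order_trans)
    finally show "norm ((M *\<^sub>v v) $ i) \<le> (\<Sum>j<dim_col M. norm (M $$ (i, j)))" by simp
  qed
  finally show ?thesis .
qed

lemma op_norm_upper:
  assumes "v \<in> carrier_vec (dim_col M)" "euclid_norm v \<le> 1"
  shows "euclid_norm (M *\<^sub>v v) \<le> op_norm M"
  unfolding op_norm_def
proof (rule cSUP_upper)
  show "bdd_above ((\<lambda>v. euclid_norm (M *\<^sub>v v)) ` {v \<in> carrier_vec (dim_col M). euclid_norm v \<le> 1})"
    using euclid_norm_le_entry_sum by (auto simp: bdd_above_def)
qed (use assms in auto)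

lemma op_norm_le:
  assumes "\<And>v. v \<in> carrier_vec (dim_col M) \<Longrightarrow> euclid_norm v \<le> 1 \<Longrightarrow> euclid_norm (M *\<^sub>v v) \<le> c"
  shows "op_norm M \<le> c"
  unfolding op_norm_def
proof (rule cSUP_least)
  have "euclid_norm (0\<^sub>v (dim_col M) :: 'a vec) \<le> 1" by simp
  then show "{v :: 'a vec. v \<in> carrier_vec (dim_col M) \<and> euclid_norm v \<le> 1} \<noteq> {}" by (auto intro: zero_carrier_vec)
qed (use assms in auto)

lemma op_norm_nonneg: "0 \<le> op_norm M"
  using op_norm_upper[of "0\<^sub>v (dim_col M)" M] euclid_norm_nonneg[of "M *\<^sub>v 0\<^sub>v (dim_col M)"]
  by simp

lemma op_norm_le_entry_sum: "op_norm M \<le> entry_sum M"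
  by (rule op_norm_le) (rule euclid_norm_le_entry_sum)

lemma op_norm_bound:
  fixes M :: "'a::real_normed_field mat"
  assumes M: "M \<in> carrier_mat n m" and v: "v \<in> carrier_vec m"
  shows "euclid_norm (M *\<^sub>v v) \<le> op_norm M * euclid_norm v"
proof (cases "euclid_norm v = 0")
  case True
  then have "M *\<^sub>v v = 0\<^sub>v n" using euclid_norm_eq_0[OF v] M by auto
  then show ?thesis using True by simp
next
  case False
  then have pos: "euclid_norm v > 0" using euclid_norm_nonneg[of v] by simp
  define k :: 'a where "k = of_real (inverse (euclid_norm v))"
  have nk: "norm k = inverse (euclid_norm v)" using pos by (simp add: k_def norm_inverse)
  have "euclid_norm (M *\<^sub>v (k \<cdot>\<^sub>v v)) \<le> op_norm M"
    using v M pos by (intro op_norm_upper) (auto simp: euclid_norm_smult nk)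
  also have "M *\<^sub>v (k \<cdot>\<^sub>v v) = k \<cdot>\<^sub>v (M *\<^sub>v v)" by (rule mult_mat_vec[OF M v])
  finally show ?thesis using pos by (simp add: euclid_norm_smult nk field_simps)
qed

text \<open>Replacing \<open>v\<close> by a net point \<open>p\<close> changes the form by \<open>(v
  - p) \<bullet> (W *\<^sub>v v) + (v - p) \<bullet> (W *\<^sub>v p)\<close>, at most twice a
  quarter of the norm. As \<open>W\<close> is symmetric, a bound on its form bounds its norm, hence
  norm <= c + norm / 2.\<close>

lemma op_norm_le_net:
  fixes W :: "real mat"
  assumes W: "W \<in> carrier_mat d d" "transpose_mat W = W"
    and net: "\<And>v. v \<in> carrier_vec d \<Longrightarrow> euclid_norm v \<le> 1 \<Longrightarrow>
       \<exists>p\<in>T. p \<in> carrier_vec d \<and> euclid_norm p \<le> 1 \<and> euclid_norm (v - p) \<le> 1 / 4"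
    and c: "0 \<le> c" "\<And>p. p \<in> T \<Longrightarrow> \<bar>p \<bullet> (W *\<^sub>v p)\<bar> \<le> c"
  shows "op_norm W \<le> 2 * c"
proof -
  let ?o = "op_norm W"
  have ball: "\<bar>v \<bullet> (W *\<^sub>v v)\<bar> \<le> c + ?o / 2" if v: "v \<in> carrier_vec d" "euclid_norm v \<le> 1" for v
  proof -
    obtain p where p: "p \<in> T" "p \<in> carrier_vec d" "euclid_norm p \<le> 1" "euclid_norm (v - p) \<le> 1 / 4"
      using net[OF v] by blast
    have vp: "v - p \<in> carrier_vec d" using v p by simp
    have small: "\<bar>(v - p) \<bullet> (W *\<^sub>v u)\<bar> \<le> ?o / 4" if u: "u \<in> carrier_vec d" "euclid_norm u \<le> 1" for u
    proof -
      have Wu: "W *\<^sub>v u \<in> carrier_vec d" using W u by simp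
      have "\<bar>(v - p) \<bullet> (W *\<^sub>v u)\<bar> \<le> euclid_norm (v - p) * euclid_norm (W *\<^sub>v u)"
        by (rule scalar_prod_le_euclid_norm[OF vp Wu])
      also have "\<dots> \<le> 1 / 4 * ?o"
        using p(4) u W by (intro mult_mono op_norm_upper euclid_norm_nonneg) auto
      finally show ?thesis by simp
    qed
    have "p \<bullet> (W *\<^sub>v (v - p)) = (v - p) \<bullet> (W *\<^sub>v p)"
      using symmetric_form_swap[OF W p(2) vp] comm_scalar_prod[OF vp, of "W *\<^sub>v p"] W p(2) by simp
    then have "v \<bullet> (W *\<^sub>v v) = p \<bullet> (W *\<^sub>v p) + (v - p) \<bullet> (W *\<^sub>v v) + (v - p) \<bullet> (W *\<^sub>v p)"
      using W v p by (simp add: mult_minus_distrib_mat_vec[of _ d d] minus_scalar_prod_distrib[of _ d] scalar_prod_minus_distrib[of _ d])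
    then show ?thesis using c(2)[OF p(1)] small[OF v] small[OF p(2,3)] by linarith
  qed
  have form: "\<bar>v \<bullet> (W *\<^sub>v v)\<bar> \<le> (c + ?o / 2) * (v \<bullet> v)" if v: "v \<in> carrier_vec d" for v
  proof (cases "euclid_norm v = 0")
    case True
    then show ?thesis using euclid_norm_eq_0[OF v] W by simp
  next
    case False
    then have pos: "euclid_norm v > 0" using euclid_norm_nonneg[of v] by simp
    let ?k = "inverse (euclid_norm v)"
    have "\<bar>(?k \<cdot>\<^sub>v v) \<bullet> (W *\<^sub>v (?k \<cdot>\<^sub>v v))\<bar> \<le> c + ?o / 2"
      using v pos by (intro ball) (auto simp: euclid_norm_smult)
    also have "(?k \<cdot>\<^sub>v v) \<bullet> (W *\<^sub>v (?k \<cdot>\<^sub>v v)) = ?k * (?k * (v \<bullet> (W *\<^sub>v v)))"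
      using v W by (simp add: mult_mat_vec[OF W(1) v])
    finally show ?thesis using pos
      by (simp add: euclid_norm_real_square[symmetric] abs_mult power2_eq_square field_simps)
  qed
  have nn: "0 \<le> c + ?o / 2" using c op_norm_nonneg[of W] by simp
  have "?o \<le> c + ?o / 2"
  proof (rule op_norm_le)
    fix v :: "real vec" assume "v \<in> carrier_vec (dim_col W)" and v1: "euclid_norm v \<le> 1"
    then have v: "v \<in> carrier_vec d" using W by simp
    have "(euclid_norm (W *\<^sub>v v))\<^sup>2 \<le> (c + ?o / 2)\<^sup>2 * (euclid_norm v)\<^sup>2"
      using symmetric_form_norm_bound[OF W nn form v] by (simp add: euclid_norm_real_square)
    then have "euclid_norm (W *\<^sub>v v) \<le> (c + ?o / 2) * euclid_norm v"
      by (intro power2_le_imp_le[OF _ mult_nonneg_nonneg[OF nn euclid_norm_nonneg]]) (simp only: power_mult_distrib)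
    also have "\<dots> \<le> c + ?o / 2" using mult_left_mono[OF v1 nn] by simp
    finally show "euclid_norm (W *\<^sub>v v) \<le> c + ?o / 2" .
  qed
  then show ?thesis by simp
qed

lemma Collect_all_le:
  fixes a :: "'a \<Rightarrow> 'b \<Rightarrow> real"
  shows "{x \<in> S. \<forall>f\<in>D. a x f \<le> b f} = S - (\<Union>f\<in>D. {x \<in> S. b f < a x f})"
  by (auto simp: not_less)

text \<open>The supremum runs over an uncountable ball. By continuity the homogeneous inequality |W
  x| <= c |x| need only be tested at rational \<open>x\<close>; in this form the rational
  approximations may leave the ball.\<close>

lemma op_norm_le_sets:
  fixes W :: "'w \<Rightarrow> real mat"
  assumes W: "\<And>\<omega>. \<omega> \<in> space M \<Longrightarrow> W \<omega> \<in> carrier_mat n m"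
    and meas: "\<And>i j. i < n \<Longrightarrow> j < m \<Longrightarrow> (\<lambda>\<omega>. W \<omega> $$ (i, j)) \<in> borel_measurable M"
  shows "{\<omega> \<in> space M. op_norm (W \<omega>) \<le> c} \<in> sets M"
proof (cases "0 \<le> c")
  case False
  then have "{\<omega> \<in> space M. op_norm (W \<omega>) \<le> c} = {}"
    using op_norm_nonneg order_trans by blast
  then show ?thesis by (simp only: sets.empty_sets)
next
  case True
  define N where "N w x = sqrt (\<Sum>i<n. (\<Sum>j<m. w $$ (i, j) * x j)\<^sup>2)" for w :: "real mat" and x :: "nat \<Rightarrow> real"
  define E where "E x = sqrt (\<Sum>j<m. (x j)\<^sup>2)" for x :: "nat \<Rightarrow> real"
  have N: "euclid_norm (w *\<^sub>v vec m x) = N w x" if "w \<in> carrier_mat n m" for w x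
    using that by (simp add: euclid_norm_def L2_set_def N_def scalar_prod_def row_def atLeast0LessThan)
  have E: "euclid_norm (vec m x) = E x" for x by (simp add: euclid_norm_def L2_set_def E_def)
  let ?D = "PiE {..<m} (\<lambda>_. UNIV :: rat set)"
  have count: "countable ?D" by (intro countable_PiE) auto
  have iff: "op_norm w \<le> c \<longleftrightarrow> (\<forall>f\<in>?D. N w (\<lambda>i. of_rat (f i)) \<le> c * E (\<lambda>i. of_rat (f i)))"
    if w: "w \<in> carrier_mat n m" for w
  proof
    assume le: "op_norm w \<le> c"
    show "\<forall>f\<in>?D. N w (\<lambda>i. of_rat (f i)) \<le> c * E (\<lambda>i. of_rat (f i))"
    proof
      fix f assume "f \<in> ?D"
      have "euclid_norm (w *\<^sub>v vec m (\<lambda>i. of_rat (f i))) \<le> op_norm w * euclid_norm (vec m (\<lambda>i. of_rat (f i)) :: real vec)"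
        by (rule op_norm_bound[OF w]) simp
      also have "\<dots> \<le> c * euclid_norm (vec m (\<lambda>i. of_rat (f i)) :: real vec)"
        by (intro mult_right_mono le euclid_norm_nonneg)
      finally show "N w (\<lambda>i. of_rat (f i)) \<le> c * E (\<lambda>i. of_rat (f i))" by (simp add: N[OF w] E)
    qed
  next
    assume dense: "\<forall>f\<in>?D. N w (\<lambda>i. of_rat (f i)) \<le> c * E (\<lambda>i. of_rat (f i))"
    show "op_norm w \<le> c"
    proof (rule op_norm_le)
      fix v :: "real vec" assume "v \<in> carrier_vec (dim_col w)" and v1: "euclid_norm v \<le> 1"
      then have v: "v \<in> carrier_vec m" using w by simp
      have "\<exists>q :: rat. v $ i < of_rat q \<and> of_rat q < v $ i + 1 / real (Suc k)" for i k
        by (rule of_rat_dense) simp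
      then obtain q :: "nat \<Rightarrow> nat \<Rightarrow> rat" where
        q: "\<And>i k. v $ i < of_rat (q i k) \<and> of_rat (q i k) < v $ i + 1 / real (Suc k)" by metis
      have lim: "(\<lambda>k. of_rat (q i k) :: real) \<longlonglongrightarrow> v $ i" for i
      proof (rule tendsto_sandwich[of "\<lambda>_. v $ i" _ _ "\<lambda>k. v $ i + 1 / real (Suc k)"])
        show "(\<lambda>k. v $ i + 1 / real (Suc k)) \<longlonglongrightarrow> v $ i"
          using tendsto_add[OF tendsto_const LIMSEQ_inverse_real_of_nat, of "v $ i"] by (simp add: inverse_eq_divide)
        show "\<forall>\<^sub>F k in sequentially. v $ i \<le> of_rat (q i k)"
          by (intro always_eventually allI less_imp_le conjunct1[OF q])
        show "\<forall>\<^sub>F k in sequentially. of_rat (q i k) \<le> v $ i + 1 / real (Suc k)"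
          by (intro always_eventually allI less_imp_le conjunct2[OF q])
      qed simp
      have "N w (\<lambda>i. of_rat (q i k)) \<le> c * E (\<lambda>i. of_rat (q i k))" for k
      proof -
        have "restrict (\<lambda>i. q i k) {..<m} \<in> ?D" by simp
        from bspec[OF dense this] show ?thesis by (simp add: N_def E_def)
      qed
      moreover have "(\<lambda>k. N w (\<lambda>i. of_rat (q i k))) \<longlonglongrightarrow> N w (\<lambda>i. v $ i)"
        unfolding N_def by (intro tendsto_intros lim)
      moreover have "(\<lambda>k. c * E (\<lambda>i. of_rat (q i k))) \<longlonglongrightarrow> c * E (\<lambda>i. v $ i)"
        unfolding E_def by (intro tendsto_intros lim)
      ultimately have "N w (\<lambda>i. v $ i) \<le> c * E (\<lambda>i. v $ i)" by (intro LIMSEQ_le) auto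
      moreover have "vec m (\<lambda>i. v $ i) = v" using v by auto
      ultimately have "euclid_norm (w *\<^sub>v v) \<le> c * euclid_norm v"
        using N[OF w, of "\<lambda>i. v $ i"] E[of "\<lambda>i. v $ i"] by simp
      also have "\<dots> \<le> c" using mult_left_mono[OF v1 True] by simp
      finally show "euclid_norm (w *\<^sub>v v) \<le> c" .
    qed
  qed
  have "{\<omega> \<in> space M. op_norm (W \<omega>) \<le> c}
     = {\<omega> \<in> space M. \<forall>f\<in>?D. N (W \<omega>) (\<lambda>i. of_rat (f i)) \<le> c * E (\<lambda>i. of_rat (f i))}"
    using iff[OF W] by auto
  also have "\<dots> = space M - (\<Union>f\<in>?D. {\<omega> \<in> space M. c * E (\<lambda>i. of_rat (f i)) < N (W \<omega>) (\<lambda>i. of_rat (f i))})"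
    by (rule Collect_all_le)
  also have "\<dots> \<in> sets M"
  proof (intro sets.Diff sets.top sets.countable_UN'' count)
    fix f assume "f \<in> ?D"
    have "(\<lambda>\<omega>. \<Sum>i<n. (\<Sum>j<m. W \<omega> $$ (i, j) * of_rat (f j))\<^sup>2) \<in> borel_measurable M"
      by (intro borel_measurable_sum borel_measurable_power borel_measurable_times borel_measurable_const meas) auto
    then have [measurable]: "(\<lambda>\<omega>. N (W \<omega>) (\<lambda>i. of_rat (f i))) \<in> borel_measurable M"
      unfolding N_def by measurable
    show "{\<omega> \<in> space M. c * E (\<lambda>i. of_rat (f i)) < N (W \<omega>) (\<lambda>i. of_rat (f i))} \<in> sets M" by measurable
  qed
  finally show ?thesis .
qed

subsection \<open>A lattice net of the unit ball\<close>

text \<open>Rounding towards zero never increases the absolute value, so rounded points of the unit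
  ball stay in the ball.\<close>

definition trunc_int :: "real \<Rightarrow> int" where
  "trunc_int x = (if 0 \<le> x then \<lfloor>x\<rfloor> else \<lceil>x\<rceil>)"

lemma trunc_int_bounds: "\<bar>of_int (trunc_int x)\<bar> \<le> \<bar>x\<bar>" "\<bar>x - of_int (trunc_int x)\<bar> \<le> 1"
proof -
  have "0 \<le> x \<Longrightarrow> 0 \<le> real_of_int \<lfloor>x\<rfloor>" "x \<le> 0 \<Longrightarrow> real_of_int \<lceil>x\<rceil> \<le> 0" by auto
  then show "\<bar>of_int (trunc_int x)\<bar> \<le> \<bar>x\<bar>" "\<bar>x - of_int (trunc_int x)\<bar> \<le> 1"
    using floor_correct[of x] ceiling_correct[of x] unfolding trunc_int_def by (simp_all split: if_splits; linarith)+
qed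

lemma sum_half_power_abs: "(\<Sum>j\<in>{- int m..int m}. (1 / 2) ^ nat \<bar>j\<bar>) = 3 - 2 * (1 / 2 :: real) ^ m"
proof (induction m)
  case (Suc m)
  have "{- int (Suc m)..int (Suc m)} = insert (- int (Suc m)) (insert (int (Suc m)) {- int m..int m})" by auto
  moreover have "nat \<bar>1 + int m\<bar> = Suc m" "nat \<bar>- 1 - int m\<bar> = Suc m" by auto
  ultimately show ?case using Suc by simp
qed simp

text \<open>Counting by weights: each such \<open>k\<close> has weight 2^(-|k|_1) >= 2^(-16 d),
  while the weights of all points of the box factor over the coordinates and sum to at most 3^d,
  whatever the side of the box.\<close>

lemma card_lattice_l1_ball:
  "card {k \<in> PiE {..<d} (\<lambda>_. {- int m..int m}). (\<Sum>i<d. \<bar>k i\<bar>) \<le> int (16 * d)} \<le> (3 * 2 ^ 16) ^ d"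
proof -
  let ?P = "PiE {..<d} (\<lambda>_. {- int m..int m})"
  let ?K = "{k \<in> ?P. (\<Sum>i<d. \<bar>k i\<bar>) \<le> int (16 * d)}"
  have fin: "finite ?P" by (intro finite_PiE) auto
  have one: "1 \<le> 2 ^ (16 * d) * (\<Prod>i<d. (1 / 2 :: real) ^ nat \<bar>k i\<bar>)" if "k \<in> ?K" for k
  proof -
    have "int (\<Sum>i<d. nat \<bar>k i\<bar>) \<le> int (16 * d)" using that by simp
    then have le: "(\<Sum>i<d. nat \<bar>k i\<bar>) \<le> 16 * d" by (simp only: of_nat_le_iff)
    have "(\<Prod>i<d. (1 / 2 :: real) ^ nat \<bar>k i\<bar>) = (1 / 2) ^ (\<Sum>i<d. nat \<bar>k i\<bar>)" by (simp add: power_sum)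
    also have "\<dots> \<ge> (1 / 2) ^ (16 * d)" using le by (intro power_decreasing) auto
    finally have "2 ^ (16 * d) * (1 / 2 :: real) ^ (16 * d) \<le> 2 ^ (16 * d) * (\<Prod>i<d. (1 / 2 :: real) ^ nat \<bar>k i\<bar>)"
      by (intro mult_left_mono) auto
    then show ?thesis by (simp add: power_mult_distrib[symmetric] del: power_mult)
  qed
  have "real (card ?K) = (\<Sum>k\<in>?K. 1)" by simp
  also have "\<dots> \<le> (\<Sum>k\<in>?K. 2 ^ (16 * d) * (\<Prod>i<d. (1 / 2 :: real) ^ nat \<bar>k i\<bar>))"
    by (intro sum_mono one)
  also have "\<dots> \<le> (\<Sum>k\<in>?P. 2 ^ (16 * d) * (\<Prod>i<d. (1 / 2 :: real) ^ nat \<bar>k i\<bar>))"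
    using fin by (intro sum_mono2) (auto simp: prod_nonneg)
  also have "\<dots> = 2 ^ (16 * d) * (\<Prod>i<d. \<Sum>j\<in>{- int m..int m}. (1 / 2 :: real) ^ nat \<bar>j\<bar>)"
    by (subst prod_sum_PiE) (auto simp: sum_distrib_left)
  also have "\<dots> \<le> 2 ^ (16 * d) * (\<Prod>i<d. 3)"
  proof -
    have "(\<Sum>j\<in>{- int m..int m}. (1 / 2 :: real) ^ nat \<bar>j\<bar>) \<le> 3" unfolding sum_half_power_abs by simp
    then show ?thesis by (intro mult_left_mono prod_mono conjI sum_nonneg) auto
  qed
  also have "\<dots> = real ((3 * 2 ^ 16) ^ d)" by (simp add: power_mult flip: power_mult_distrib)
  finally show ?thesis by (simp only: of_nat_le_iff)
qed

text \<open>Points of the ball are rounded to the lattice of mesh \<open>1 / h\<close>. The error is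
  at most sqrt d / h = 1/4, and the integer coordinates satisfy |k|_2^2 <= h^2 = 16 d. Integers
  satisfy |x| <= x^2, so the l1 norm is at most 16 d as well, which keeps the count exponential in
  \<open>d\<close>.\<close>

lemma unit_ball_net:
  assumes d: "1 \<le> d"
  obtains T :: "real vec set" where "finite T" "card T \<le> (3 * 2 ^ 16) ^ d"
    "\<And>p. p \<in> T \<Longrightarrow> p \<in> carrier_vec d \<and> euclid_norm p \<le> 1"
    "\<And>v. v \<in> carrier_vec d \<Longrightarrow> euclid_norm v \<le> 1 \<Longrightarrow> \<exists>p\<in>T. euclid_norm (v - p) \<le> 1 / 4"
proof -
  define h where "h = 4 * sqrt (real d)"
  have h: "h > 0" "h\<^sup>2 = 16 * real d" using d by (auto simp: h_def power_mult_distrib)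
  let ?K = "{k \<in> PiE {..<d} (\<lambda>_. {- int (16 * d)..int (16 * d)}). (\<Sum>i<d. \<bar>k i\<bar>) \<le> int (16 * d)}"
  let ?p = "\<lambda>k. vec d (\<lambda>i. of_int (k i) / h)"
  define T where "T = ?p ` ?K \<inter> {p. euclid_norm p \<le> 1}"
  have finK: "finite ?K" by (rule finite_subset[of _ "PiE {..<d} (\<lambda>_. {- int (16 * d)..int (16 * d)})"]) (auto intro: finite_PiE)
  have "card T \<le> card (?p ` ?K)" unfolding T_def using finK by (intro card_mono) auto
  also have "\<dots> \<le> card ?K" by (rule card_image_le[OF finK])
  also have "\<dots> \<le> (3 * 2 ^ 16) ^ d" by (rule card_lattice_l1_ball)
  finally have card: "card T \<le> (3 * 2 ^ 16) ^ d" .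
  show thesis
  proof (rule that[OF _ card])
    show "finite T" unfolding T_def using finK by auto
    show "p \<in> carrier_vec d \<and> euclid_norm p \<le> 1" if "p \<in> T" for p
    proof -
      from that obtain k where "p = ?p k" "euclid_norm p \<le> 1" unfolding T_def by blast
      then show ?thesis by simp
    qed
    fix v :: "real vec" assume v: "v \<in> carrier_vec d" "euclid_norm v \<le> 1"
    define k where "k = restrict (\<lambda>i. trunc_int (h * v $ i)) {..<d}"
    have v2: "(\<Sum>i<d. (v $ i)\<^sup>2) \<le> 1"
    proof -
      have "(\<Sum>i<d. (v $ i)\<^sup>2) = (euclid_norm v)\<^sup>2" using v(1) by (simp add: euclid_norm_def L2_set_def sum_nonneg)
      also have "\<dots> \<le> 1\<^sup>2" by (rule power_mono[OF v(2) euclid_norm_nonneg])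
      finally show ?thesis by simp
    qed
    have abs_k: "\<bar>of_int (k i)\<bar> \<le> \<bar>h * v $ i\<bar>" if "i < d" for i
      using that trunc_int_bounds(1) by (simp add: k_def)
    have sq: "(\<Sum>i<d. (of_int (k i))\<^sup>2) \<le> 16 * real d"
    proof -
      have "(\<Sum>i<d. (real_of_int (k i))\<^sup>2) \<le> (\<Sum>i<d. h\<^sup>2 * (v $ i)\<^sup>2)"
        using abs_k by (intro sum_mono) (auto simp: power_mult_distrib[symmetric] abs_le_square_iff)
      also have "\<dots> = h\<^sup>2 * (\<Sum>i<d. (v $ i)\<^sup>2)" by (simp add: sum_distrib_left)
      also have "\<dots> \<le> h\<^sup>2 * 1" by (intro mult_left_mono v2) auto
      finally show ?thesis by (simp add: h)
    qed
    have int_le: "\<bar>x\<bar> \<le> x\<^sup>2" for x :: int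
      using self_le_power[of "\<bar>x\<bar>" 2] by (cases "x = 0") auto
    have "real_of_int (\<Sum>i<d. (k i)\<^sup>2) \<le> real_of_int (int (16 * d))" using sq by simp
    then have "(\<Sum>i<d. (k i)\<^sup>2) \<le> int (16 * d)" by (simp only: of_int_le_iff)
    then have l1: "(\<Sum>i<d. \<bar>k i\<bar>) \<le> int (16 * d)"
      using sum_mono[of "{..<d}" "\<lambda>i. \<bar>k i\<bar>" "\<lambda>i. (k i)\<^sup>2"] int_le by (meson order_trans)
    have bound: "k i \<in> {- int (16 * d)..int (16 * d)}" if "i < d" for i
    proof -
      have "\<bar>k i\<bar> \<le> int (16 * d)"
        using l1 member_le_sum[of i "{..<d}" "\<lambda>i. \<bar>k i\<bar>"] that by simp
      then show ?thesis unfolding atLeastAtMost_iff by linarith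
    qed
    have "k \<in> PiE {..<d} (\<lambda>_. {- int (16 * d)..int (16 * d)})"
      by (rule PiE_I) (use bound in \<open>simp_all add: k_def\<close>)
    then have kK: "k \<in> ?K" using l1 by simp
    have "(euclid_norm (?p k))\<^sup>2 = (\<Sum>i<d. (of_int (k i))\<^sup>2) / h\<^sup>2"
      by (simp add: euclid_norm_def L2_set_def sum_nonneg power_divide sum_divide_distrib)
    also have "\<dots> \<le> 1" using sq d by (simp add: h)
    finally have "euclid_norm (?p k) \<le> 1" using euclid_norm_nonneg by (simp add: power_le_one_iff abs_square_le_1)
    then have pT: "?p k \<in> T" using kK by (auto simp: T_def)
    have "(euclid_norm (v - ?p k))\<^sup>2 = (\<Sum>i<d. (v $ i - of_int (k i) / h)\<^sup>2)"
      using v by (simp add: euclid_norm_def L2_set_def sum_nonneg)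
    also have "\<dots> \<le> (\<Sum>i<d. (1 / h)\<^sup>2)"
    proof (intro sum_mono)
      fix i assume "i \<in> {..<d}"
      then have "\<bar>h * v $ i - of_int (k i)\<bar> \<le> 1" using trunc_int_bounds(2)[of "h * v $ i"] by (simp add: k_def)
      then have "\<bar>v $ i - of_int (k i) / h\<bar> \<le> 1 / h" using h
        by (simp add: field_simps abs_le_iff)
      then show "(v $ i - of_int (k i) / h)\<^sup>2 \<le> (1 / h)\<^sup>2" using h by (subst abs_le_square_iff[symmetric]) simp
    qed
    also have "\<dots> = (1 / 4)\<^sup>2" using d by (simp add: power_divide h)
    finally have "euclid_norm (v - ?p k) \<le> 1 / 4" by (rule power2_le_imp_le) simp
    then show "\<exists>p\<in>T. euclid_norm (v - p) \<le> 1 / 4" using pT by blast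
  qed
qed

subsection \<open>Discrete Fourier transform and the convolution bound\<close>

definition dft_root :: "nat \<Rightarrow> complex" where
  "dft_root n = cis (2 * pi / real n)"

lemma norm_dft_root [simp]: "norm (dft_root n) = 1"
  by (simp add: dft_root_def)

lemma dft_root_power: "dft_root n ^ k = cis (2 * pi * real k / real n)"
  unfolding dft_root_def Complex.DeMoivre by (simp add: mult_ac)

lemma dft_root_power_cnj: "dft_root n ^ k * cnj (dft_root n ^ k) = 1"
  using complex_norm_square[of "dft_root n ^ k"] by (simp add: norm_power del: complex_cnj_power)

lemma dft_root_orthogonal:
  assumes "u < n" "v < n"
  shows "(\<Sum>l<n. (dft_root n ^ u * cnj (dft_root n ^ v)) ^ l) = (if u = v then of_nat n else 0)"
proof (cases "u = v")
  case True
  then show ?thesis by (simp add: dft_root_power_cnj del: complex_cnj_power)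
next
  case False
  have n: "n > 0" using assms by simp
  let ?q = "dft_root n ^ u * cnj (dft_root n ^ v)"
  have root: "(dft_root n ^ k) ^ n = 1" for k
    using n by (simp add: dft_root_power Complex.DeMoivre)
  have "?q ^ n = 1" using root[of u] root[of v] by (simp add: power_mult_distrib flip: complex_cnj_power)
  moreover have "?q \<noteq> 1"
  proof
    assume "?q = 1"
    then have "?q * dft_root n ^ v = dft_root n ^ v" by simp
    moreover have "cnj (dft_root n ^ v) * dft_root n ^ v = 1"
      using dft_root_power_cnj[of n v] by (simp only: mult.commute)
    ultimately have "dft_root n ^ u = dft_root n ^ v" by (simp only: mult.assoc mult_1_right)
    then have "cis (2 * pi * real u / real n) = cis (2 * pi * real v / real n)" by (simp only: dft_root_power)
    then show False
      using bij_betw_imp_inj_on[OF Complex.bij_betw_roots_unity[OF n]] assms False by (auto simp: inj_on_def)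
  qed
  ultimately show ?thesis using False by (simp add: geometric_sum)
qed

lemma dft_parseval:
  "(\<Sum>l<n. (norm (\<Sum>u<n. c u * dft_root n ^ (u * l)))\<^sup>2) = real n * (\<Sum>u<n. (norm (c u))\<^sup>2)"
proof -
  let ?w = "dft_root n"
  have "complex_of_real (\<Sum>l<n. (norm (\<Sum>u<n. c u * ?w ^ (u * l)))\<^sup>2)
      = (\<Sum>l<n. \<Sum>u<n. \<Sum>v<n. c u * cnj (c v) * (?w ^ u * cnj (?w ^ v)) ^ l)"
    unfolding of_real_sum complex_norm_square cnj_sum sum_product
    by (intro sum.cong refl) (simp only: power_mult power_mult_distrib complex_cnj_mult complex_cnj_power, simp only: mult_ac)
  also have "\<dots> = (\<Sum>u<n. \<Sum>v<n. \<Sum>l<n. c u * cnj (c v) * (?w ^ u * cnj (?w ^ v)) ^ l)"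
    by (rule trans[OF sum.swap], rule sum.cong[OF refl], rule sum.swap)
  also have "\<dots> = (\<Sum>u<n. \<Sum>v<n. c u * cnj (c v) * (if u = v then of_nat n else 0))"
    by (intro sum.cong refl) (simp only: sum_distrib_left[symmetric] dft_root_orthogonal lessThan_iff)
  also have "\<dots> = (\<Sum>u<n. of_nat n * (c u * cnj (c u)))"
    by (intro sum.cong refl) (simp add: if_distrib[of "\<lambda>z. _ * z"] mult.commute cong: if_cong)
  also have "\<dots> = complex_of_real (real n * (\<Sum>u<n. (norm (c u))\<^sup>2))"
    by (simp add: complex_norm_square[symmetric] sum_distrib_left)
  finally show ?thesis by (simp only: of_real_eq_iff)
qed

text \<open>
  The cross correlation of \<open>y\<close> and \<open>a\<close> is stored at the indices \<open>i - m + N\<close>, which do not wrap around modulo \<open>2N\<close>.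
\<close>

lemma correlation_dft:
  fixes y a :: "nat \<Rightarrow> real"
  assumes N: "1 \<le> N"
  shows "2 * real N * (\<Sum>k<N. (\<Sum>i<N. if k < i then a (i - 1 - k) * y i else 0)\<^sup>2)
    \<le> (\<Sum>l<2 * N. (norm (\<Sum>i<N. y i * dft_root (2 * N) ^ (i * l)))\<^sup>2
        * (norm (\<Sum>m<N. a m * dft_root (2 * N) ^ (m * l)))\<^sup>2)"
proof -
  let ?n = "2 * N" and ?w = "dft_root (2 * N)"
  define c where "c u = (\<Sum>i<N. \<Sum>m<N. if u + m = i + N then y i * a m else 0)" for u
  have ck: "c (N + k + 1) = (\<Sum>i<N. if k < i then a (i - 1 - k) * y i else 0)" for k
    unfolding c_def
  proof (intro sum.cong refl)
    fix i assume i: "i \<in> {..<N}"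
    have "(\<Sum>m<N. if N + k + 1 + m = i + N then y i * a m else 0) = (\<Sum>m<N. if m = i - 1 - k then (if k < i then y i * a m else 0) else 0)"
      by (intro sum.cong refl) auto
    also have "\<dots> = (if k < i then a (i - 1 - k) * y i else 0)"
      using i by (cases "k < i") auto
    finally show "(\<Sum>m<N. if N + k + 1 + m = i + N then y i * a m else 0) = (if k < i then a (i - 1 - k) * y i else 0)" .
  qed
  \<comment> \<open>The index belonging to \<open>k = N - 1\<close> is \<open>2 * N\<close>, outside
    one period; its value is zero because no \<open>i < N\<close> exceeds
    \<open>N - 1\<close>.\<close>
  have last: "c (N + (N - 1) + 1) = 0" unfolding ck by (intro sum.neutral) auto
  have "(\<Sum>k<N. (c (N + k + 1))\<^sup>2) = (\<Sum>k<N - 1. (c (N + k + 1))\<^sup>2)"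
    using N last by (cases N) auto
  also have "\<dots> = (\<Sum>u\<in>(\<lambda>k. N + k + 1) ` {..<N - 1}. (c u)\<^sup>2)"
    by (subst sum.reindex) (auto simp: inj_on_def)
  also have "\<dots> \<le> (\<Sum>u<?n. (c u)\<^sup>2)"
    by (intro sum_mono2) auto
  finally have le: "(\<Sum>k<N. (c (N + k + 1))\<^sup>2) \<le> (\<Sum>u<?n. (c u)\<^sup>2)" .
  \<comment> \<open>A correlation transforms into a product with one conjugated factor;
    \<open>?w ^ (N * l)\<close> comes from the shift by \<open>N\<close> and has modulus 1.\<close>
  have prod: "(\<Sum>u<?n. complex_of_real (c u) * ?w ^ (u * l))
     = ?w ^ (N * l) * (\<Sum>i<N. y i * ?w ^ (i * l)) * cnj (\<Sum>m<N. a m * ?w ^ (m * l))" for l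
  proof -
    have "(\<Sum>u<?n. complex_of_real (c u) * ?w ^ (u * l))
      = (\<Sum>u<?n. \<Sum>i<N. \<Sum>m<N. if u + m = i + N then complex_of_real (y i * a m) * ?w ^ (u * l) else 0)"
      by (simp add: c_def sum_distrib_right if_distrib[of complex_of_real] if_distrib[of "\<lambda>z. z * _"] cong: if_cong)
    also have "\<dots> = (\<Sum>i<N. \<Sum>m<N. \<Sum>u<?n. if u + m = i + N then complex_of_real (y i * a m) * ?w ^ (u * l) else 0)"
      by (rule trans[OF sum.swap], rule sum.cong[OF refl], rule sum.swap)
    also have "\<dots> = (\<Sum>i<N. \<Sum>m<N. complex_of_real (y i * a m) * ?w ^ ((i + N - m) * l))"
    proof (intro sum.cong refl)
      fix i m assume im: "i \<in> {..<N}" "m \<in> {..<N}"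
      have "(\<Sum>u<?n. if u + m = i + N then complex_of_real (y i * a m) * ?w ^ (u * l) else 0)
        = (\<Sum>u<?n. if u = i + N - m then complex_of_real (y i * a m) * ?w ^ (u * l) else 0)"
        using im by (intro sum.cong refl) auto
      also have "\<dots> = complex_of_real (y i * a m) * ?w ^ ((i + N - m) * l)"
        using im by (simp add: sum.delta')
      finally show "(\<Sum>u<?n. if u + m = i + N then complex_of_real (y i * a m) * ?w ^ (u * l) else 0)
        = complex_of_real (y i * a m) * ?w ^ ((i + N - m) * l)" .
    qed
    also have "\<dots> = (\<Sum>i<N. \<Sum>m<N. ?w ^ (N * l) * (y i * ?w ^ (i * l)) * cnj (a m * ?w ^ (m * l)))"
    proof (intro sum.cong refl)
      fix i m assume im: "i \<in> {..<N}" "m \<in> {..<N}"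
      have "?w ^ ((i + N - m) * l) = ?w ^ ((i + N - m) * l) * (?w ^ (m * l) * cnj (?w ^ (m * l)))"
        by (simp only: dft_root_power_cnj mult_1_right)
      also have "\<dots> = ?w ^ ((i + N - m) * l + m * l) * cnj (?w ^ (m * l))" by (simp only: power_add mult.assoc)
      also have "(i + N - m) * l + m * l = N * l + i * l" using im by (simp add: add_mult_distrib[symmetric])
      finally show "complex_of_real (y i * a m) * ?w ^ ((i + N - m) * l) = ?w ^ (N * l) * (y i * ?w ^ (i * l)) * cnj (a m * ?w ^ (m * l))"
        by (simp add: power_add mult_ac)
    qed
    also have "\<dots> = ?w ^ (N * l) * (\<Sum>i<N. y i * ?w ^ (i * l)) * cnj (\<Sum>m<N. a m * ?w ^ (m * l))"
      by (simp only: cnj_sum mult.assoc sum_product) (simp only: sum_distrib_left mult.assoc)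
    finally show ?thesis .
  qed
  have "(norm (\<Sum>u<?n. complex_of_real (c u) * ?w ^ (u * l)))\<^sup>2
     = (norm (\<Sum>i<N. y i * ?w ^ (i * l)))\<^sup>2 * (norm (\<Sum>m<N. a m * ?w ^ (m * l)))\<^sup>2" for l
    unfolding prod norm_mult complex_mod_cnj by (simp add: norm_power power_mult_distrib)
  then have "(\<Sum>l<?n. (norm (\<Sum>i<N. y i * ?w ^ (i * l)))\<^sup>2 * (norm (\<Sum>m<N. a m * ?w ^ (m * l)))\<^sup>2)
     = real ?n * (\<Sum>u<?n. (c u)\<^sup>2)"
    using dft_parseval[where n = ?n and c = "\<lambda>u. complex_of_real (c u)"] by simp
  also have "\<dots> \<ge> real ?n * (\<Sum>k<N. (c (N + k + 1))\<^sup>2)" by (intro mult_left_mono le) simp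
  finally show ?thesis unfolding ck by simp
qed

text \<open>The left side is the squared norm of the transposed block Toeplitz matrix applied to
  \<open>y\<close>. Each component is a correlation of \<open>y\<close> with \<open>h\<close>, which
  the transform turns into a product; the transfer function is bounded by \<open>K\<close> at every
  frequency l / (2 N), and Parseval returns to \<open>y\<close>.\<close>

lemma correlation_bound:
  fixes h :: "nat \<Rightarrow> nat \<Rightarrow> real" and y :: "nat \<Rightarrow> real"
  assumes N: "1 \<le> N"
    and K: "\<And>s. 0 \<le> s \<Longrightarrow> s \<le> 1 \<Longrightarrow>
      (\<Sum>j<d. (norm (\<Sum>m<N. h m j * exp (\<i> * complex_of_real (2 * pi * real m * s))))\<^sup>2) \<le> K"
  shows "(\<Sum>k<N. \<Sum>j<d. (\<Sum>i<N. if k < i then h (i - 1 - k) j * y i else 0)\<^sup>2) \<le> K * (\<Sum>i<N. (y i)\<^sup>2)"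
proof -
  let ?n = "2 * N" and ?w = "dft_root (2 * N)"
  let ?Y = "\<lambda>l. (norm (\<Sum>i<N. y i * ?w ^ (i * l)))\<^sup>2"
  have H: "(\<Sum>j<d. (norm (\<Sum>m<N. h m j * ?w ^ (m * l)))\<^sup>2) \<le> K" if "l < ?n" for l
  proof -
    have "?w ^ (m * l) = exp (\<i> * complex_of_real (2 * pi * real m * (real l / real ?n)))" for m
      by (simp add: dft_root_power cis_conv_exp mult_ac)
    then show ?thesis using K[of "real l / real ?n"] that by simp
  qed
  have Y: "(\<Sum>l<?n. ?Y l) = real ?n * (\<Sum>i<N. (y i)\<^sup>2)"
  proof -
    \<comment> \<open>\<open>y\<close> is padded with zeros to the period
      \<open>2 * N\<close>.\<close>
    have "(\<Sum>u<?n. complex_of_real (if u < N then y u else 0) * ?w ^ (u * l)) = (\<Sum>i<N. y i * ?w ^ (i * l))" for l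
      by (rule sum.mono_neutral_cong_right) auto
    moreover have "(\<Sum>u<?n. (norm (complex_of_real (if u < N then y u else 0)))\<^sup>2) = (\<Sum>i<N. (y i)\<^sup>2)"
      by (rule sum.mono_neutral_cong_right) auto
    ultimately show ?thesis
      using dft_parseval[where n = ?n and c = "\<lambda>u. complex_of_real (if u < N then y u else 0)"] by simp
  qed
  have "2 * real N * (\<Sum>k<N. \<Sum>j<d. (\<Sum>i<N. if k < i then h (i - 1 - k) j * y i else 0)\<^sup>2)
     = (\<Sum>j<d. 2 * real N * (\<Sum>k<N. (\<Sum>i<N. if k < i then h (i - 1 - k) j * y i else 0)\<^sup>2))"
    by (subst sum.swap) (simp add: sum_distrib_left)
  also have "\<dots> \<le> (\<Sum>j<d. \<Sum>l<?n. ?Y l * (norm (\<Sum>m<N. h m j * ?w ^ (m * l)))\<^sup>2)"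
    by (intro sum_mono correlation_dft[OF N, where a = "\<lambda>m. h m _"])
  also have "\<dots> = (\<Sum>l<?n. ?Y l * (\<Sum>j<d. (norm (\<Sum>m<N. h m j * ?w ^ (m * l)))\<^sup>2))"
    by (subst sum.swap) (simp add: sum_distrib_left)
  also have "\<dots> \<le> (\<Sum>l<?n. ?Y l * K)"
    using H by (intro sum_mono mult_left_mono) auto
  also have "\<dots> = 2 * real N * (K * (\<Sum>i<N. (y i)\<^sup>2))"
    using Y by (simp add: sum_distrib_right[symmetric])
  finally show ?thesis using N by simp
qed

subsection \<open>The law of the noise\<close>

lemma space_vec_borel [simp]: "space (vec_borel d) = carrier_vec d"
  by (simp add: vec_borel_def)

lemma measurable_vec_borelI:
  assumes "\<And>\<omega>. \<omega> \<in> space M \<Longrightarrow> f \<omega> \<in> carrier_vec d"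
    and "\<And>j. j < d \<Longrightarrow> (\<lambda>\<omega>. f \<omega> $ j) \<in> borel_measurable M"
  shows "f \<in> M \<rightarrow>\<^sub>M vec_borel d"
  unfolding vec_borel_def
  by (rule measurable_vimage_algebra2) (use assms in \<open>auto intro!: measurable_restrict\<close>)

lemma measurable_vec_entry:
  assumes "j < d"
  shows "(\<lambda>v. v $ j) \<in> borel_measurable (vec_borel d)"
proof -
  have "(\<lambda>v. \<lambda>i\<in>{..<d}. v $ i) \<in> vec_borel d \<rightarrow>\<^sub>M Pi\<^sub>M {..<d} (\<lambda>_. borel :: real measure)"
    unfolding vec_borel_def by (rule measurable_vimage_algebra1) (auto simp: space_PiM)
  from measurable_compose[OF this measurable_component_singleton[of j "{..<d}" "\<lambda>_. borel"]]
  show ?thesis using assms by simp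
qed

lemma measurable_vec: "vec d \<in> Pi\<^sub>M {..<d} (\<lambda>_. std_normal_distribution) \<rightarrow>\<^sub>M vec_borel d"
  by (rule measurable_vec_borelI) auto

lemma prob_space_std_gaussian: "prob_space (std_gaussian d)"
  unfolding std_gaussian_def by (intro prob_space.prob_space_distr prob_space_gaussian_family measurable_vec)

lemma sets_std_gaussian [simp, measurable_cong]: "sets (std_gaussian d) = sets (vec_borel d)"
  by (simp add: std_gaussian_def)

lemma indep_vars_PiM_coordinates:
  assumes I: "I \<noteq> {}" and M: "\<And>i. i \<in> I \<Longrightarrow> prob_space (M i)" and sets: "\<And>i. i \<in> I \<Longrightarrow> sets (M' i) = sets (M i)"
  shows "prob_space.indep_vars (Pi\<^sub>M I M) M' (\<lambda>i \<omega>. \<omega> i) I"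
proof -
  interpret prob_space "Pi\<^sub>M I M" by (intro prob_space_PiM M)
  have meas: "(\<lambda>\<omega>. \<omega> i) \<in> Pi\<^sub>M I M \<rightarrow>\<^sub>M M' i" if "i \<in> I" for i
    using that measurable_component_singleton[of i I M] measurable_cong_sets[OF refl sets[OF that], of "Pi\<^sub>M I M"] by auto
  have "distr (Pi\<^sub>M I M) (M' i) (\<lambda>\<omega>. \<omega> i) = M i" if "i \<in> I" for i
    using distr_PiM_component[OF M that] distr_cong[OF refl sets[OF that], of "Pi\<^sub>M I M" "\<lambda>\<omega>. \<omega> i" "\<lambda>\<omega>. \<omega> i"] by simp
  then have "(\<Pi>\<^sub>M i\<in>I. distr (Pi\<^sub>M I M) (M' i) (\<lambda>\<omega>. \<omega> i)) = Pi\<^sub>M I M" by (intro PiM_cong) auto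
  moreover have "distr (Pi\<^sub>M I M) (Pi\<^sub>M I M') (\<lambda>x. \<lambda>i\<in>I. x i) = distr (Pi\<^sub>M I M) (Pi\<^sub>M I M) (\<lambda>x. x)"
    by (rule distr_cong) (auto intro!: sets_PiM_cong sets simp: space_PiM)
  ultimately show ?thesis using meas by (subst indep_vars_iff_distr_eq_PiM'[OF I]) (auto simp: distr_id)
qed

text \<open>Independence and the marginals together fix one law on a product space, so whatever
  depends on the noise only through its law agrees on all sample spaces.\<close>

lemma iid_noise_law:
  assumes N: "1 \<le> N" and M: "prob_space M" and iid: "iid_std_gaussian M d N \<epsilon>"
  shows "(\<lambda>\<omega>. \<lambda>i\<in>{..<N}. \<epsilon> i \<omega>) \<in> M \<rightarrow>\<^sub>M Pi\<^sub>M {..<N} (\<lambda>_. vec_borel d)"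
    and "distr M (Pi\<^sub>M {..<N} (\<lambda>_. vec_borel d)) (\<lambda>\<omega>. \<lambda>i\<in>{..<N}. \<epsilon> i \<omega>) = Pi\<^sub>M {..<N} (\<lambda>_. std_gaussian d)"
proof -
  interpret prob_space M by (rule M)
  have ind: "indep_vars (\<lambda>_. vec_borel d) \<epsilon> {..<N}" and law: "\<And>i. i < N \<Longrightarrow> distr M (vec_borel d) (\<epsilon> i) = std_gaussian d"
    using iid by (auto simp: iid_std_gaussian_def)
  have rv: "\<And>i. i \<in> {..<N} \<Longrightarrow> \<epsilon> i \<in> M \<rightarrow>\<^sub>M vec_borel d" using ind by (auto simp: indep_vars_def)
  then show "(\<lambda>\<omega>. \<lambda>i\<in>{..<N}. \<epsilon> i \<omega>) \<in> M \<rightarrow>\<^sub>M Pi\<^sub>M {..<N} (\<lambda>_. vec_borel d)" by (intro measurable_restrict)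
  have ne: "{..<N} \<noteq> {}" using N by (auto simp: lessThan_empty_iff)
  have "distr M (Pi\<^sub>M {..<N} (\<lambda>_. vec_borel d)) (\<lambda>\<omega>. \<lambda>i\<in>{..<N}. \<epsilon> i \<omega>)
      = Pi\<^sub>M {..<N} (\<lambda>i. distr M (vec_borel d) (\<epsilon> i))"
    using indep_vars_iff_distr_eq_PiM'[OF ne rv] ind by simp
  also have "\<dots> = Pi\<^sub>M {..<N} (\<lambda>_. std_gaussian d)" by (intro PiM_cong) (auto simp: law)
  finally show "distr M (Pi\<^sub>M {..<N} (\<lambda>_. vec_borel d)) (\<lambda>\<omega>. \<lambda>i\<in>{..<N}. \<epsilon> i \<omega>) = Pi\<^sub>M {..<N} (\<lambda>_. std_gaussian d)" .
qed

lemma iid_std_gaussian_product: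
  assumes "1 \<le> N"
  shows "iid_std_gaussian (Pi\<^sub>M {..<N} (\<lambda>_. std_gaussian d)) d N (\<lambda>i \<omega>. \<omega> i)"
  unfolding iid_std_gaussian_def
proof (intro conjI allI impI)
  show "prob_space.indep_vars (Pi\<^sub>M {..<N} (\<lambda>_. std_gaussian d)) (\<lambda>_. vec_borel d) (\<lambda>i \<omega>. \<omega> i) {..<N}"
    using assms by (intro indep_vars_PiM_coordinates prob_space_std_gaussian) (auto simp: lessThan_empty_iff)
  fix i assume i: "i < N"
  have "distr (Pi\<^sub>M {..<N} (\<lambda>_. std_gaussian d)) (vec_borel d) (\<lambda>\<omega>. \<omega> i)
     = distr (Pi\<^sub>M {..<N} (\<lambda>_. std_gaussian d)) (std_gaussian d) (\<lambda>\<omega>. \<omega> i)"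
    by (rule distr_cong) auto
  also have "\<dots> = std_gaussian d"
    using i distr_PiM_component[of "{..<N}" "\<lambda>_. std_gaussian d" i] by (simp add: prob_space_std_gaussian)
  finally show "distr (Pi\<^sub>M {..<N} (\<lambda>_. std_gaussian d)) (vec_borel d) (\<lambda>\<omega>. \<omega> i) = std_gaussian d" .
qed

abbreviation canonical_noise :: "nat \<Rightarrow> nat \<Rightarrow> (nat \<times> nat \<Rightarrow> real) measure" where
  "canonical_noise N d \<equiv> gaussian_family ({..<N} \<times> {..<d})"

abbreviation canonical_vec :: "nat \<Rightarrow> nat \<Rightarrow> (nat \<times> nat \<Rightarrow> real) \<Rightarrow> real vec" where
  "canonical_vec d i g \<equiv> vec d (\<lambda>j. g (i, j))"

text \<open>Disjoint blocks of independent scalar coordinates are independent, and block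
  \<open>i\<close> is the noise vector at time \<open>i\<close>.\<close>

lemma iid_std_gaussian_canonical:
  assumes "1 \<le> N" "1 \<le> d"
  shows "iid_std_gaussian (canonical_noise N d) d N (canonical_vec d)"
  unfolding iid_std_gaussian_def
proof (intro conjI allI impI)
  interpret prob_space "canonical_noise N d" by (rule prob_space_gaussian_family)
  let ?C = "{..<N} \<times> {..<d}"
  have "?C \<noteq> {}" using assms by (auto simp: lessThan_empty_iff)
  then have "indep_vars (\<lambda>_. std_normal_distribution) (\<lambda>c g. g c) ?C"
    by (intro indep_vars_PiM_coordinates prob_space_std_normal) auto
  then have "indep_vars (\<lambda>i. Pi\<^sub>M ({i} \<times> {..<d}) (\<lambda>_. std_normal_distribution)) (\<lambda>i g. restrict (\<lambda>c. g c) ({i} \<times> {..<d})) {..<N}"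
    by (rule indep_vars_restrict) (auto simp: disjoint_family_on_def)
  then have "indep_vars (\<lambda>_. vec_borel d) (\<lambda>i g. canonical_vec d i (restrict (\<lambda>c. g c) ({i} \<times> {..<d}))) {..<N}"
    by (rule indep_vars_compose2) (auto intro!: measurable_vec_borelI)
  then show "indep_vars (\<lambda>_. vec_borel d) (canonical_vec d) {..<N}"
    by (rule indep_vars_cong[THEN iffD1, rotated -1]) (auto intro!: eq_vecI simp: fun_eq_iff)
  fix i assume i: "i < N"
  have inj: "inj_on (Pair i) {..<d}" "Pair i \<in> {..<d} \<rightarrow> ?C" using i by (auto simp: inj_on_def)
  have "std_gaussian d = distr (distr (canonical_noise N d) (gaussian_family {..<d}) (\<lambda>g. \<lambda>j\<in>{..<d}. g (i, j))) (vec_borel d) (vec d)"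
    using distr_PiM_reindex[OF prob_space_std_normal inj] by (simp add: std_gaussian_def)
  also have "\<dots> = distr (canonical_noise N d) (vec_borel d) (vec d \<circ> (\<lambda>g. \<lambda>j\<in>{..<d}. g (i, j)))"
    using i by (intro distr_distr measurable_vec measurable_restrict) auto
  also have "vec d \<circ> (\<lambda>g. \<lambda>j\<in>{..<d}. g (i, j)) = canonical_vec d i" by (auto simp: fun_eq_iff)
  finally show "distr (canonical_noise N d) (vec_borel d) (canonical_vec d i) = std_gaussian d" ..
qed

subsection \<open>The state and its Gram matrix\<close>

lemma state_carrier:
  assumes "A \<in> carrier_mat d d" "B \<in> carrier_mat d d"
  shows "state A B e i \<in> carrier_vec d"
  using assms by (cases i) (auto intro!: carrier_vecI)

lemma state_cong:
  assumes "\<And>k. k < i \<Longrightarrow> e k = e' k"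
  shows "state A B e i = state A B e' i"
  using assms by (induction i) auto

text \<open>Noise that is \<open>m\<close> steps old enters the state through
  \<open>A ^\<^sub>m m * B\<close>; this is the transpose of that factor applied to the direction
  \<open>v\<close>.\<close>

definition response :: "real mat \<Rightarrow> real mat \<Rightarrow> nat \<Rightarrow> real vec \<Rightarrow> real vec" where
  "response A B m v = transpose_mat B *\<^sub>v (transpose_mat A ^\<^sub>m m *\<^sub>v v)"

text \<open>Unrolls the recursion from its last step by moving \<open>A\<close> to the other side of
  the scalar product. This changes the direction, so the induction is over all
  \<open>v\<close>.\<close>

lemma scalar_prod_state:
  assumes A: "A \<in> carrier_mat d d" and B: "B \<in> carrier_mat d d"
    and v: "v \<in> carrier_vec d" and e: "\<And>k. k < i \<Longrightarrow> e k \<in> carrier_vec d"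
  shows "v \<bullet> state A B e i = (\<Sum>k<i. response A B (i - 1 - k) v \<bullet> e k)"
  using v e
proof (induction i arbitrary: v)
  case 0
  then show ?case using A by simp
next
  case (Suc i)
  have At: "transpose_mat A \<in> carrier_mat d d" using A by simp
  have x: "state A B e i \<in> carrier_vec d" by (rule state_carrier[OF A B])
  have Av: "transpose_mat A *\<^sub>v v \<in> carrier_vec d" using A Suc.prems by simp
  have "v \<bullet> state A B e (Suc i) = v \<bullet> (A *\<^sub>v state A B e i) + v \<bullet> (B *\<^sub>v e i)"
    using A B Suc.prems x by (simp add: scalar_prod_add_distrib[of _ d])
  also have "v \<bullet> (A *\<^sub>v state A B e i) = (transpose_mat A *\<^sub>v v) \<bullet> state A B e i"
    using transpose_vec_mult_scalar[OF A x Suc.prems(1)] by simp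
  also have "\<dots> = (\<Sum>k<i. response A B (i - 1 - k) (transpose_mat A *\<^sub>v v) \<bullet> e k)"
    using Suc.prems by (intro Suc.IH Av) auto
  also have "\<dots> = (\<Sum>k<i. response A B (Suc i - 1 - k) v \<bullet> e k)"
  proof (intro sum.cong refl)
    fix k assume "k \<in> {..<i}"
    then have "Suc i - 1 - k = Suc (i - 1 - k)" by auto
    moreover have "response A B (Suc m) v = response A B m (transpose_mat A *\<^sub>v v)" for m
      using pow_carrier_mat[OF At, of m] At Suc.prems(1)
      by (simp add: response_def assoc_mult_mat_vec[of _ d d _ d])
    ultimately show "response A B (i - 1 - k) (transpose_mat A *\<^sub>v v) \<bullet> e k = response A B (Suc i - 1 - k) v \<bullet> e k"
      by simp
  qed
  also have "v \<bullet> (B *\<^sub>v e i) = response A B (Suc i - 1 - i) v \<bullet> e i"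
    using transpose_vec_mult_scalar[OF B Suc.prems(2)[of i] Suc.prems(1)] A Suc.prems(1)
    by (simp add: response_def)
  finally show ?case by simp
qed

lemma gram_carrier: "gram N A B e \<in> carrier_mat (dim_row A) (dim_row A)"
  by (simp add: gram_def mat_sum_def)

lemma gram_entry:
  assumes A: "A \<in> carrier_mat d d" "B \<in> carrier_mat d d" and "a < d" "b < d"
  shows "gram N A B e $$ (a, b) = (\<Sum>i\<in>{1..N - 1}. state A B e i $ a * state A B e i $ b)"
  using assms carrier_vecD[OF state_carrier[OF A, of e]] by (simp add: gram_def mat_sum_def outer_prod_def)

text \<open>Allows the noise to be restricted to \<open>{..<N}\<close> and thus regarded as a point
  of the product space.\<close>

lemma gram_cong:
  assumes "\<And>k. k < N \<Longrightarrow> e k = e' k"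
  shows "gram N A B e = gram N A B e'"
proof -
  have "state A B e i = state A B e' i" if "i \<in> {1..N - 1}" for i
    using that assms by (intro state_cong) auto
  then show ?thesis by (auto simp: gram_def mat_sum_def intro!: eq_matI sum.cong)
qed

lemma state_entry_measurable:
  assumes A: "A \<in> carrier_mat d d" and B: "B \<in> carrier_mat d d" and "i \<le> N" "a < d"
  shows "(\<lambda>e. state A B e i $ a) \<in> borel_measurable (Pi\<^sub>M {..<N} (\<lambda>_. vec_borel d))"
  using assms(3,4)
proof (induction i arbitrary: a)
  case 0
  then show ?case using A by simp
next
  case (Suc i)
  let ?P = "Pi\<^sub>M {..<N} (\<lambda>_. vec_borel d)"
  have "(\<lambda>e. e i $ b) \<in> borel_measurable ?P" if "b < d" for b
    using Suc.prems measurable_compose[OF measurable_component_singleton[of i "{..<N}" "\<lambda>_. vec_borel d"] measurable_vec_entry[OF that]] by auto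
  then have "(\<lambda>e. (\<Sum>b<d. A $$ (a, b) * state A B e i $ b) + (\<Sum>b<d. B $$ (a, b) * e i $ b)) \<in> borel_measurable ?P"
    using Suc.prems Suc.IH by (intro borel_measurable_add borel_measurable_sum borel_measurable_times borel_measurable_const) auto
  moreover have "state A B e (Suc i) $ a = (\<Sum>b<d. A $$ (a, b) * state A B e i $ b) + (\<Sum>b<d. B $$ (a, b) * e i $ b)"
    if "e \<in> space ?P" for e
  proof -
    have "i \<in> {..<N}" using Suc.prems by simp
    then have e: "e i \<in> carrier_vec d"
      using measurable_space[OF measurable_component_singleton that] by simp
    have "state A B e (Suc i) $ a = row A a \<bullet> state A B e i + row B a \<bullet> e i"
      using A B Suc.prems by simp
    moreover have "row A a \<bullet> state A B e i = (\<Sum>b<d. A $$ (a, b) * state A B e i $ b)"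
      using A Suc.prems carrier_vecD[OF state_carrier[OF A B, of e i]] by (simp add: scalar_prod_def atLeast0LessThan)
    moreover have "row B a \<bullet> e i = (\<Sum>b<d. B $$ (a, b) * e i $ b)"
      using B Suc.prems carrier_vecD[OF e] by (simp add: scalar_prod_def atLeast0LessThan)
    ultimately show ?thesis by simp
  qed
  ultimately show ?case by (rule measurable_cong[THEN iffD2, rotated])
qed

lemma gram_entry_measurable:
  assumes A: "A \<in> carrier_mat d d" and B: "B \<in> carrier_mat d d" and "a < d" "b < d"
  shows "(\<lambda>e. gram N A B e $$ (a, b)) \<in> borel_measurable (Pi\<^sub>M {..<N} (\<lambda>_. vec_borel d))"
  unfolding gram_entry[OF assms]
proof (intro borel_measurable_sum borel_measurable_times)
  fix i assume "i \<in> {1..N - 1}"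
  then have i: "i \<le> N" by auto
  show "(\<lambda>e. state A B e i $ a) \<in> borel_measurable (Pi\<^sub>M {..<N} (\<lambda>_. vec_borel d))"
    "(\<lambda>e. state A B e i $ b) \<in> borel_measurable (Pi\<^sub>M {..<N} (\<lambda>_. vec_borel d))"
    by (rule state_entry_measurable[OF A B i]; fact)+
qed

text \<open>The expectation under the product law; \<open>Psi_eq_noise_Psi\<close> shows that
  \<open>Psi\<close> takes this value on every sample space.\<close>

definition noise_Psi :: "nat \<Rightarrow> nat \<Rightarrow> real mat \<Rightarrow> real mat \<Rightarrow> real mat" where
  "noise_Psi d N A B = mat d d (\<lambda>(i, j). LINT e|Pi\<^sub>M {..<N} (\<lambda>_. std_gaussian d). gram N A B e $$ (i, j))"

lemma Psi_eq_noise_Psi: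
  assumes "1 \<le> N" "prob_space M" "iid_std_gaussian M d N \<epsilon>" and A: "A \<in> carrier_mat d d" "B \<in> carrier_mat d d"
  shows "Psi M N A B \<epsilon> = noise_Psi d N A B"
proof (rule eq_matI)
  fix i j assume "i < dim_row (noise_Psi d N A B)" "j < dim_col (noise_Psi d N A B)"
  then have ij: "i < d" "j < d" by (auto simp: noise_Psi_def)
  note law = iid_noise_law[OF assms(1-3)]
  have "noise_Psi d N A B $$ (i, j) = (LINT \<omega>|M. gram N A B (\<lambda>k\<in>{..<N}. \<epsilon> k \<omega>) $$ (i, j))"
    using ij integral_distr[OF law(1) gram_entry_measurable[OF A ij]] by (simp add: noise_Psi_def law(2))
  also have "\<dots> = (LINT \<omega>|M. gram N A B (\<lambda>k. \<epsilon> k \<omega>) $$ (i, j))"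
    by (intro Bochner_Integration.integral_cong refl arg_cong[where f = "\<lambda>M. M $$ (i, j)"] gram_cong) simp
  finally show "Psi M N A B \<epsilon> $$ (i, j) = noise_Psi d N A B $$ (i, j)" using A ij by (simp add: Psi_def)
qed (use A in \<open>auto simp: Psi_def noise_Psi_def\<close>)

lemma gram_event_transfer:
  assumes "1 \<le> N" "prob_space M" "iid_std_gaussian M d N \<epsilon>"
    and S: "{e \<in> space (Pi\<^sub>M {..<N} (\<lambda>_. vec_borel d)). R (gram N A B e)} \<in> sets (Pi\<^sub>M {..<N} (\<lambda>_. vec_borel d))"
  shows "{\<omega> \<in> space M. R (gram N A B (\<lambda>k. \<epsilon> k \<omega>))} \<in> sets M"
    and "measure M {\<omega> \<in> space M. R (gram N A B (\<lambda>k. \<epsilon> k \<omega>))}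
    = measure (Pi\<^sub>M {..<N} (\<lambda>_. std_gaussian d)) {e \<in> space (Pi\<^sub>M {..<N} (\<lambda>_. vec_borel d)). R (gram N A B e)}"
proof -
  let ?S = "{e \<in> space (Pi\<^sub>M {..<N} (\<lambda>_. vec_borel d)). R (gram N A B e)}"
  note law = iid_noise_law[OF assms(1-3)]
  have "gram N A B (\<lambda>k\<in>{..<N}. \<epsilon> k \<omega>) = gram N A B (\<lambda>k. \<epsilon> k \<omega>)" for \<omega> by (rule gram_cong) simp
  then have eq: "(\<lambda>\<omega>. \<lambda>i\<in>{..<N}. \<epsilon> i \<omega>) -` ?S \<inter> space M = {\<omega> \<in> space M. R (gram N A B (\<lambda>k. \<epsilon> k \<omega>))}"
    using measurable_space[OF law(1)] by auto
  show "{\<omega> \<in> space M. R (gram N A B (\<lambda>k. \<epsilon> k \<omega>))} \<in> sets M"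
    using measurable_sets[OF law(1) S] unfolding eq .
  show "measure M {\<omega> \<in> space M. R (gram N A B (\<lambda>k. \<epsilon> k \<omega>))} = measure (Pi\<^sub>M {..<N} (\<lambda>_. std_gaussian d)) ?S"
    unfolding law(2)[symmetric] measure_distr[OF law(1) S] eq ..
qed

text \<open>The matrix \<open>\<Gamma>\<close> of the overview: rows are times, columns are noise
  coordinates \<open>(k, j)\<close>. It is strictly lower triangular because the noise at time
  \<open>k\<close> first enters the state at time \<open>k + 1\<close>.\<close>

definition gain :: "real mat \<Rightarrow> real mat \<Rightarrow> real vec \<Rightarrow> nat \<Rightarrow> nat \<times> nat \<Rightarrow> real" where
  "gain A B v i = (\<lambda>(k, j). if k < i then response A B (i - 1 - k) v $ j else 0)"

lemma scalar_prod_state_canonical: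
  assumes A: "A \<in> carrier_mat d d" "B \<in> carrier_mat d d" and v: "v \<in> carrier_vec d" and i: "i \<le> N"
  shows "v \<bullet> state A B (\<lambda>k. canonical_vec d k g) i = (\<Sum>c\<in>{..<N} \<times> {..<d}. gain A B v i c * g c)"
proof -
  have "v \<bullet> state A B (\<lambda>k. canonical_vec d k g) i
      = (\<Sum>k<i. \<Sum>j<d. response A B (i - 1 - k) v $ j * g (k, j))"
    using scalar_prod_state[OF A v, of i "\<lambda>k. canonical_vec d k g"]
    by (simp add: scalar_prod_def atLeast0LessThan)
  also have "\<dots> = (\<Sum>k<N. \<Sum>j<d. gain A B v i (k, j) * g (k, j))"
    using i by (intro sum.mono_neutral_cong_left) (auto simp: gain_def)
  also have "\<dots> = (\<Sum>c\<in>{..<N} \<times> {..<d}. gain A B v i c * g c)"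
    by (simp add: sum.cartesian_product)
  finally show ?thesis .
qed

lemma gram_form:
  assumes A: "A \<in> carrier_mat d d" "B \<in> carrier_mat d d" and v: "v \<in> carrier_vec d" and N: "1 \<le> N"
  shows "v \<bullet> (gram N A B e *\<^sub>v v) = (\<Sum>i<N. (v \<bullet> state A B e i)\<^sup>2)"
proof -
  have G: "gram N A B e \<in> carrier_mat d d" using gram_carrier[of N A B e] A by simp
  have x: "v \<bullet> state A B e i = (\<Sum>a<d. v $ a * state A B e i $ a)" for i
    using v carrier_vecD[OF state_carrier[OF A, of e i]] by (simp add: scalar_prod_def atLeast0LessThan)
  have "v \<bullet> (gram N A B e *\<^sub>v v) = (\<Sum>a<d. \<Sum>b<d. \<Sum>i\<in>{1..N - 1}. (v $ a * state A B e i $ a) * (v $ b * state A B e i $ b))"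
    unfolding bilinear_entries[OF v G v]
    by (intro sum.cong refl) (simp add: gram_entry[OF A] sum_distrib_left sum_distrib_right mult_ac)
  also have "\<dots> = (\<Sum>a<d. \<Sum>i\<in>{1..N - 1}. \<Sum>b<d. (v $ a * state A B e i $ a) * (v $ b * state A B e i $ b))"
    by (rule sum.cong[OF refl], rule sum.swap)
  also have "\<dots> = (\<Sum>i\<in>{1..N - 1}. \<Sum>a<d. \<Sum>b<d. (v $ a * state A B e i $ a) * (v $ b * state A B e i $ b))"
    by (rule sum.swap)
  also have "\<dots> = (\<Sum>i\<in>{1..N - 1}. (v \<bullet> state A B e i)\<^sup>2)"
    by (simp only: x power2_eq_square sum_product)
  \<comment> \<open>The term \<open>i = 0\<close> vanishes because the state starts at zero; with it
    the rows are indexed by \<open>{..<N}\<close>.\<close>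
  also have "\<dots> = (\<Sum>i<N. (v \<bullet> state A B e i)\<^sup>2)"
    using v A N by (intro sum.mono_neutral_left) (auto simp: not_le Suc_le_eq)
  finally show ?thesis .
qed

lemma noise_Psi_carrier: "noise_Psi d N A B \<in> carrier_mat d d"
  by (simp add: noise_Psi_def)

lemma noise_Psi_symmetric:
  assumes A: "A \<in> carrier_mat d d" "B \<in> carrier_mat d d"
  shows "transpose_mat (noise_Psi d N A B) = noise_Psi d N A B"
  by (rule eq_matI) (auto simp: noise_Psi_def gram_entry[OF A] mult.commute)

text \<open>Evaluated on the canonical space, where \<open>v \<bullet> state\<close> is an explicit
  linear form in independent standard normals, whose second moment is the sum of its squared
  coefficients.\<close>

lemma noise_Psi_form:
  assumes A: "A \<in> carrier_mat d d" "B \<in> carrier_mat d d" and v: "v \<in> carrier_vec d" and N: "1 \<le> N" and d: "1 \<le> d"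
  shows "v \<bullet> (noise_Psi d N A B *\<^sub>v v) = (\<Sum>i<N. \<Sum>c\<in>{..<N} \<times> {..<d}. (gain A B v i c)\<^sup>2)"
proof -
  let ?C = "{..<N} \<times> {..<d}"
  let ?G = "\<lambda>g. gram N A B (\<lambda>k. canonical_vec d k g)"
  have finC: "finite ?C" by simp
  have Psi: "noise_Psi d N A B = Psi (canonical_noise N d) N A B (canonical_vec d)"
    by (rule Psi_eq_noise_Psi[OF N prob_space_gaussian_family iid_std_gaussian_canonical[OF N d] A, symmetric])
  have G: "?G g \<in> carrier_mat d d" for g using gram_carrier[of N A B] A by simp
  have entry: "state A B (\<lambda>k. canonical_vec d k g) i $ a = (\<Sum>c\<in>?C. gain A B (unit_vec d a) i c * g c)"
    if "a < d" "i \<le> N" for a i g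
    using scalar_prod_state_canonical[OF A unit_vec_carrier that(2), of a g] that(1)
      scalar_prod_left_unit[OF state_carrier[OF A] that(1)] by simp
  have int: "integrable (canonical_noise N d) (\<lambda>g. ?G g $$ (a, b))" if "a < d" "b < d" for a b
  proof -
    have "integrable (canonical_noise N d) (\<lambda>g. \<Sum>i\<in>{1..N - 1}.
        (\<Sum>c\<in>?C. gain A B (unit_vec d a) i c * g c) * (\<Sum>c\<in>?C. gain A B (unit_vec d b) i c * g c))"
      by (intro Bochner_Integration.integrable_sum gaussian_family_square_linear finC)
    moreover have "?G g $$ (a, b) = (\<Sum>i\<in>{1..N - 1}.
        (\<Sum>c\<in>?C. gain A B (unit_vec d a) i c * g c) * (\<Sum>c\<in>?C. gain A B (unit_vec d b) i c * g c))" for g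
      unfolding gram_entry[OF A that] using that by (intro sum.cong refl arg_cong2[where f = "(*)"] entry) auto
    ultimately show ?thesis by simp
  qed
  have "v \<bullet> (noise_Psi d N A B *\<^sub>v v)
      = (\<Sum>a<d. \<Sum>b<d. v $ a * (LINT g|canonical_noise N d. ?G g $$ (a, b)) * v $ b)"
    unfolding bilinear_entries[OF v noise_Psi_carrier v] using A by (simp add: Psi Psi_def)
  also have "\<dots> = (LINT g|canonical_noise N d. (\<Sum>a<d. \<Sum>b<d. v $ a * ?G g $$ (a, b) * v $ b))"
  proof -
    have int': "integrable (canonical_noise N d) (\<lambda>g. v $ a * ?G g $$ (a, b) * v $ b)" if "a \<in> {..<d}" "b \<in> {..<d}" for a b
      using int[of a b] that by (intro integrable_mult_left integrable_mult_right) auto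
    have "(LINT g|canonical_noise N d. (\<Sum>a<d. \<Sum>b<d. v $ a * ?G g $$ (a, b) * v $ b))
      = (\<Sum>a<d. \<Sum>b<d. LINT g|canonical_noise N d. v $ a * ?G g $$ (a, b) * v $ b)"
      by (simp only: Bochner_Integration.integral_sum Bochner_Integration.integrable_sum int' cong: sum.cong)
    then show ?thesis by simp
  qed
  also have "\<dots> = (LINT g|canonical_noise N d. (\<Sum>i<N. (\<Sum>c\<in>?C. gain A B v i c * g c) * (\<Sum>c\<in>?C. gain A B v i c * g c)))"
  proof (intro Bochner_Integration.integral_cong refl)
    fix g
    have "(\<Sum>a<d. \<Sum>b<d. v $ a * ?G g $$ (a, b) * v $ b) = (\<Sum>i<N. (v \<bullet> state A B (\<lambda>k. canonical_vec d k g) i)\<^sup>2)"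
      unfolding bilinear_entries[OF v G v, symmetric] by (rule gram_form[OF A v N])
    also have "\<dots> = (\<Sum>i<N. (\<Sum>c\<in>?C. gain A B v i c * g c) * (\<Sum>c\<in>?C. gain A B v i c * g c))"
      by (intro sum.cong refl) (simp add: scalar_prod_state_canonical[OF A v, where N = N] power2_eq_square)
    finally show "(\<Sum>a<d. \<Sum>b<d. v $ a * ?G g $$ (a, b) * v $ b)
      = (\<Sum>i<N. (\<Sum>c\<in>?C. gain A B v i c * g c) * (\<Sum>c\<in>?C. gain A B v i c * g c))" .
  qed
  also have "\<dots> = (\<Sum>i<N. LINT g|canonical_noise N d. (\<Sum>c\<in>?C. gain A B v i c * g c) * (\<Sum>c\<in>?C. gain A B v i c * g c))"
    by (intro Bochner_Integration.integral_sum gaussian_family_square_linear finC)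
  also have "\<dots> = (\<Sum>i<N. \<Sum>c\<in>?C. (gain A B v i c)\<^sup>2)"
    by (simp only: gaussian_family_square_linear[OF finC] power2_eq_square)
  finally show ?thesis .
qed

text \<open>The first state alone suffices: it is \<open>B\<close> applied to the first noise
  vector, so the form is at least |B^T v|^2, which is positive for invertible \<open>B\<close>. By
  \<open>2 \<le> N\<close> this state belongs to the sum.\<close>

lemma noise_Psi_positive:
  assumes A: "A \<in> carrier_mat d d" "B \<in> carrier_mat d d" and inv: "invertible_mat B"
    and v: "v \<in> carrier_vec d" "v \<noteq> 0\<^sub>v d" and N: "2 \<le> N" and d: "1 \<le> d"
  shows "0 < v \<bullet> (noise_Psi d N A B *\<^sub>v v)"
proof -
  have N1: "1 \<le> N" using N by simp
  let ?w = "transpose_mat B *\<^sub>v v"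
  have w: "?w \<in> carrier_vec d" using A v by simp
  obtain K where K: "B * K = 1\<^sub>m d" "K * B = 1\<^sub>m (dim_row K)"
    using inv A by (auto simp: invertible_mat_def inverts_mat_def)
  have "dim_col K = d" "dim_row K = d"
    using arg_cong[OF K(1), of dim_col] arg_cong[OF K(2), of dim_col] A by auto
  then have Kc: "K \<in> carrier_mat d d" by auto
  have "?w \<noteq> 0\<^sub>v d"
  proof
    assume "?w = 0\<^sub>v d"
    then have "transpose_mat K *\<^sub>v ?w = 0\<^sub>v d" using Kc by auto
    moreover have "transpose_mat K *\<^sub>v ?w = (transpose_mat K * transpose_mat B) *\<^sub>v v"
      using Kc A v by (simp add: assoc_mult_mat_vec[of _ d d _ d])
    moreover have "transpose_mat K * transpose_mat B = 1\<^sub>m d"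
      using transpose_mult[OF A(2) Kc] K(1) by simp
    ultimately show False using v by simp
  qed
  then have "0 < ?w \<bullet> ?w" using scalar_prod_self_eq_0[OF w] scalar_prod_self_nonneg[of ?w] by fastforce
  also have "?w \<bullet> ?w = (\<Sum>j<d. (response A B 0 v $ j)\<^sup>2)"
    using A v carrier_vecD[OF w] by (simp add: response_def scalar_prod_def[of ?w ?w] power2_eq_square atLeast0LessThan)
  also have "\<dots> = (\<Sum>c\<in>{0} \<times> {..<d}. (gain A B v 1 c)\<^sup>2)"
    by (rule sum.reindex_bij_witness[of _ snd "Pair 0"]) (auto simp: gain_def)
  also have "\<dots> \<le> (\<Sum>c\<in>{..<N} \<times> {..<d}. (gain A B v 1 c)\<^sup>2)"
    using N by (intro sum_mono2) auto
  also have "\<dots> \<le> (\<Sum>i<N. \<Sum>c\<in>{..<N} \<times> {..<d}. (gain A B v i c)\<^sup>2)"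
    using N by (intro member_le_sum[where f = "\<lambda>i. \<Sum>c\<in>{..<N} \<times> {..<d}. (gain A B v i c)\<^sup>2"] sum_nonneg) auto
  finally show ?thesis by (simp only: noise_Psi_form[OF A v(1) N1 d])
qed

text \<open>Duality: if \<open>w\<close> is the conjugate of p^T M, then |w|^2 = p^T M w is at most
  |p| |w| times the operator norm, and one factor |w| cancels.\<close>

lemma op_norm_adjoint_bound:
  fixes M :: "complex mat" and p :: "real vec"
  assumes M: "M \<in> carrier_mat n m" and p: "p \<in> carrier_vec n"
  shows "(\<Sum>j<m. (norm (\<Sum>a<n. complex_of_real (p $ a) * M $$ (a, j)))\<^sup>2) \<le> (op_norm M)\<^sup>2 * (p \<bullet> p)"
proof -
  define y where "y j = (\<Sum>a<n. complex_of_real (p $ a) * M $$ (a, j))" for j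
  define w where "w = vec m (\<lambda>j. cnj (y j))"
  define S where "S = (\<Sum>j<m. (norm (y j))\<^sup>2)"
  have w: "w \<in> carrier_vec m" by (simp add: w_def)
  have Sw: "S = (euclid_norm w)\<^sup>2" by (simp add: S_def euclid_norm_def L2_set_def w_def sum_nonneg)
  have Mw: "(M *\<^sub>v w) $ a = (\<Sum>j<m. M $$ (a, j) * cnj (y j))" if "a < n" for a
    using M that by (simp add: w_def scalar_prod_def row_def atLeast0LessThan)
  have "complex_of_real S = (\<Sum>j<m. y j * cnj (y j))" by (simp add: S_def complex_norm_square[symmetric])
  also have "\<dots> = (\<Sum>j<m. \<Sum>a<n. complex_of_real (p $ a) * M $$ (a, j) * cnj (y j))"
    by (simp only: y_def[of j for j] sum_distrib_right)
  also have "\<dots> = (\<Sum>a<n. \<Sum>j<m. complex_of_real (p $ a) * M $$ (a, j) * cnj (y j))" by (rule sum.swap)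
  also have "\<dots> = (\<Sum>a<n. complex_of_real (p $ a) * (M *\<^sub>v w) $ a)"
    by (intro sum.cong refl) (simp add: Mw sum_distrib_left mult.assoc)
  finally have eq: "complex_of_real S = (\<Sum>a<n. complex_of_real (p $ a) * (M *\<^sub>v w) $ a)" .
  have S0: "0 \<le> S" by (simp add: S_def sum_nonneg)
  have "S = norm (complex_of_real S)" using S0 by simp
  also have "\<dots> \<le> (\<Sum>a<n. \<bar>p $ a\<bar> * \<bar>norm ((M *\<^sub>v w) $ a)\<bar>)"
    unfolding eq by (rule order_trans[OF norm_sum]) (simp add: norm_mult)
  also have "\<dots> \<le> L2_set (\<lambda>a. p $ a) {..<n} * L2_set (\<lambda>a. norm ((M *\<^sub>v w) $ a)) {..<n}" by (rule L2_set_mult_ineq)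
  also have "\<dots> = euclid_norm p * euclid_norm (M *\<^sub>v w)"
    using p M by (simp add: euclid_norm_def L2_set_def)
  also have "\<dots> \<le> euclid_norm p * (op_norm M * euclid_norm w)"
    by (intro mult_left_mono op_norm_bound[OF M w] euclid_norm_nonneg)
  finally have le: "(euclid_norm w)\<^sup>2 \<le> (euclid_norm p * op_norm M) * euclid_norm w" by (simp add: Sw mult.assoc)
  have "euclid_norm w \<le> euclid_norm p * op_norm M"
  proof (cases "euclid_norm w = 0")
    case True
    then show ?thesis by (simp add: euclid_norm_nonneg op_norm_nonneg)
  next
    case False
    then have "0 < euclid_norm w" using euclid_norm_nonneg[of w] by simp
    then show ?thesis using le by (simp only: power2_eq_square mult_le_cancel_right_pos)
  qed
  then have "(euclid_norm w)\<^sup>2 \<le> (euclid_norm p * op_norm M)\<^sup>2" by (rule power_mono) (rule euclid_norm_nonneg)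
  then show ?thesis by (simp add: Sw[symmetric] S_def y_def power_mult_distrib euclid_norm_real_square mult.commute)
qed

lemma transpose_pow_mat:
  fixes A :: "'a :: comm_semiring_1 mat"
  assumes "A \<in> carrier_mat d d"
  shows "transpose_mat (A ^\<^sub>m k) = transpose_mat A ^\<^sub>m k"
proof (induction k)
  case (Suc k)
  have X: "A ^\<^sub>m k \<in> carrier_mat d d" using assms by simp
  have At: "transpose_mat A \<in> carrier_mat d d" using assms by simp
  show ?case using transpose_mult[OF X assms] pow_mat_commute[OF At, of k] Suc by simp
qed (use assms in simp)

lemma triple_product_entry:
  fixes X Y Z :: "'a :: semiring_0 mat"
  assumes "X \<in> carrier_mat d d" "Y \<in> carrier_mat d d" "Z \<in> carrier_mat d d" "a < d" "j < d"
  shows "(X * Y * Z) $$ (a, j) = (\<Sum>c<d. (\<Sum>b<d. X $$ (a, b) * Y $$ (b, c)) * Z $$ (c, j))"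
proof -
  have XY: "X * Y \<in> carrier_mat d d" using assms by simp
  have "(X * Y * Z) $$ (a, j) = (\<Sum>c<d. (X * Y) $$ (a, c) * Z $$ (c, j))"
    using carrier_matD[OF XY] assms
    by (subst index_mult_mat) (auto simp: scalar_prod_def row_def col_def atLeast0LessThan simp del: index_mult_mat(1))
  also have "\<dots> = (\<Sum>c<d. (\<Sum>b<d. X $$ (a, b) * Y $$ (b, c)) * Z $$ (c, j))"
    using assms by (intro sum.cong refl) (simp add: scalar_prod_def row_def col_def atLeast0LessThan)
  finally show ?thesis .
qed

lemma transpose_mult_vec_entry:
  fixes M :: "real mat"
  assumes "M \<in> carrier_mat n m" "p \<in> carrier_vec n" "j < m"
  shows "(transpose_mat M *\<^sub>v p) $ j = (\<Sum>a<n. p $ a * M $$ (a, j))"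
  using assms by (simp add: scalar_prod_def col_def atLeast0LessThan mult.commute)

lemma normalized_sum_entry:
  assumes A: "A \<in> carrier_mat d d" "B \<in> carrier_mat d d" and Q: "Q \<in> carrier_mat d d" and "a < d" "j < d"
  shows "(cmat Q * mat_sum d (\<lambda>k. f k \<cdot>\<^sub>m cmat (A ^\<^sub>m k)) I * cmat B) $$ (a, j)
    = (\<Sum>k\<in>I. f k * complex_of_real ((Q * A ^\<^sub>m k * B) $$ (a, j)))"
proof -
  let ?M = "mat_sum d (\<lambda>k. f k \<cdot>\<^sub>m cmat (A ^\<^sub>m k)) I"
  have M: "?M \<in> carrier_mat d d" by (simp add: mat_sum_def)
  have Ak: "A ^\<^sub>m k \<in> carrier_mat d d" for k using A by simp
  note Akd = carrier_matD[OF Ak]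
  have Me: "?M $$ (b, c) = (\<Sum>k\<in>I. f k * complex_of_real ((A ^\<^sub>m k) $$ (b, c)))" if "b < d" "c < d" for b c
    using that Akd by (simp add: mat_sum_def del: pow_mat_dim pow_mat_dim_square)
  have real_entry: "(Q * A ^\<^sub>m k * B) $$ (a, j) = (\<Sum>c<d. (\<Sum>b<d. Q $$ (a, b) * (A ^\<^sub>m k) $$ (b, c)) * B $$ (c, j))" for k
    by (rule triple_product_entry[OF Q Ak A(2) assms(4,5)])
  have "(cmat Q * ?M * cmat B) $$ (a, j)
    = (\<Sum>c<d. (\<Sum>b<d. complex_of_real (Q $$ (a, b)) * ?M $$ (b, c)) * complex_of_real (B $$ (c, j)))"
    using assms M by (subst triple_product_entry[where d = d]) auto
  also have "\<dots> = (\<Sum>c<d. \<Sum>b<d. \<Sum>k\<in>I. f k * complex_of_real (Q $$ (a, b) * (A ^\<^sub>m k) $$ (b, c) * B $$ (c, j)))"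
    by (intro sum.cong refl) (simp add: Me sum_distrib_left sum_distrib_right mult_ac)
  also have "\<dots> = (\<Sum>c<d. \<Sum>k\<in>I. \<Sum>b<d. f k * complex_of_real (Q $$ (a, b) * (A ^\<^sub>m k) $$ (b, c) * B $$ (c, j)))"
    by (rule sum.cong[OF refl], rule sum.swap)
  also have "\<dots> = (\<Sum>k\<in>I. \<Sum>c<d. \<Sum>b<d. f k * complex_of_real (Q $$ (a, b) * (A ^\<^sub>m k) $$ (b, c) * B $$ (c, j)))"
    by (rule sum.swap)
  also have "\<dots> = (\<Sum>k\<in>I. f k * complex_of_real ((Q * A ^\<^sub>m k * B) $$ (a, j)))"
    by (simp only: real_entry sum_distrib_left sum_distrib_right of_real_sum)
  finally show ?thesis .
qed

lemma response_entry:
  assumes A: "A \<in> carrier_mat d d" "B \<in> carrier_mat d d" and Q: "Q \<in> carrier_mat d d" "transpose_mat Q = Q"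
    and p: "p \<in> carrier_vec d" and j: "j < d"
  shows "response A B k (Q *\<^sub>v p) $ j = (\<Sum>a<d. p $ a * (Q * A ^\<^sub>m k * B) $$ (a, j))"
proof -
  have Ak: "A ^\<^sub>m k \<in> carrier_mat d d" using A by simp
  have QA: "Q * A ^\<^sub>m k \<in> carrier_mat d d" by (rule mult_carrier_mat[OF Q(1) Ak])
  have QAB: "Q * A ^\<^sub>m k * B \<in> carrier_mat d d" by (rule mult_carrier_mat[OF QA A(2)])
  have t: "transpose_mat (Q * A ^\<^sub>m k * B) = transpose_mat B * (transpose_mat A ^\<^sub>m k * Q)"
    using transpose_mult[OF QA A(2)] transpose_mult[OF Q(1) Ak] transpose_pow_mat[OF A(1), of k] Q(2) by simp
  have At: "transpose_mat A ^\<^sub>m k \<in> carrier_mat d d" using A by simp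
  have Qp: "Q *\<^sub>v p \<in> carrier_vec d" using Q p by simp
  have "transpose_mat (Q * A ^\<^sub>m k * B) *\<^sub>v p = response A B k (Q *\<^sub>v p)"
    unfolding t response_def
    using assoc_mult_mat_vec[OF _ mult_carrier_mat[OF At Q(1)] p, of "transpose_mat B" d] assoc_mult_mat_vec[OF At Q(1) p] A
    by simp
  then have "response A B k (Q *\<^sub>v p) $ j = (transpose_mat (Q * A ^\<^sub>m k * B) *\<^sub>v p) $ j" by simp
  also have "\<dots> = (\<Sum>a<d. p $ a * (Q * A ^\<^sub>m k * B) $$ (a, j))"
    by (rule transpose_mult_vec_entry[OF QAB p j])
  finally show ?thesis .
qed

text \<open>At each frequency the components under the norm form the vector p^T T(s), where
  \<open>T s\<close> is the matrix inside \<open>L_sup\<close>. The cutoff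
  \<open>m \<le> N - 2\<close> matches the range of the sum there.\<close>

lemma response_frequency_bound:
  fixes P :: "real mat"
  assumes A: "A \<in> carrier_mat d d" "B \<in> carrier_mat d d"
    and Q: "inv_sqrt P \<in> carrier_mat d d" "transpose_mat (inv_sqrt P) = inv_sqrt P"
    and p: "p \<in> carrier_vec d" and s: "0 \<le> s" "s \<le> 1" and N: "2 \<le> N"
  shows "(\<Sum>j<d. (norm (\<Sum>m<N. (if m \<le> N - 2 then response A B m (inv_sqrt P *\<^sub>v p) $ j else 0)
      * exp (\<i> * complex_of_real (2 * pi * real m * s))))\<^sup>2) \<le> L_sup P N A B * (p \<bullet> p)"
proof -
  let ?Q = "inv_sqrt P"
  define E where "E s k = exp (\<i> * complex_of_real (2 * pi * real k * s))" for s :: real and k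
  define T where "T s = cmat ?Q * mat_sum (dim_row A) (\<lambda>k. E s k \<cdot>\<^sub>m cmat (A ^\<^sub>m k)) {0..N - 2} * cmat B" for s
  have dA: "dim_row A = d" using A by simp
  have T: "T s \<in> carrier_mat d d" for s
    using A Q by (auto simp: T_def mat_sum_def intro!: mult_carrier_mat[of _ d d])
  have Te: "T s $$ (a, j) = (\<Sum>k\<in>{0..N - 2}. E s k * complex_of_real ((?Q * A ^\<^sub>m k * B) $$ (a, j)))"
    if "a < d" "j < d" for s a j
    unfolding T_def dA by (rule normalized_sum_entry[OF A Q(1) that])
  have nE: "norm (E s k) = 1" for s k by (simp add: E_def)
  have L: "L_sup P N A B = (SUP s\<in>{0..1}. (op_norm (T s))\<^sup>2)" by (simp add: L_sup_def T_def E_def)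
  \<comment> \<open>A bound on \<open>op_norm (T s)\<close> uniform in \<open>s\<close>, since the
    phases have modulus 1; it is what makes the supremum in \<open>L_sup\<close> an upper
    bound.\<close>
  define K where "K = (\<Sum>a<d. \<Sum>j<d. \<Sum>k\<in>{0..N - 2}. \<bar>(?Q * A ^\<^sub>m k * B) $$ (a, j)\<bar>)"
  have "op_norm (T s) \<le> K" for s
  proof -
    have "op_norm (T s) \<le> (\<Sum>a<d. \<Sum>j<d. norm (T s $$ (a, j)))"
      using op_norm_le_entry_sum[of "T s"] T[of s] by (simp add: entry_sum_def)
    also have "\<dots> \<le> K"
      unfolding K_def
      by (intro sum_mono) (simp add: Te, rule order_trans[OF norm_sum], simp add: norm_mult nE)
    finally show ?thesis .
  qed
  then have "(op_norm (T s))\<^sup>2 \<le> K\<^sup>2" for s by (intro power_mono op_norm_nonneg)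
  then have bdd: "bdd_above ((\<lambda>s. (op_norm (T s))\<^sup>2) ` {0..1})" by (auto simp: bdd_above_def)
  have sum_eq: "(\<Sum>m<N. complex_of_real (if m \<le> N - 2 then response A B m (?Q *\<^sub>v p) $ j else 0) * E s m)
     = (\<Sum>a<d. complex_of_real (p $ a) * T s $$ (a, j))" if j: "j < d" for j
  proof -
    have "(\<Sum>m<N. complex_of_real (if m \<le> N - 2 then response A B m (?Q *\<^sub>v p) $ j else 0) * E s m)
      = (\<Sum>m\<in>{0..N - 2}. complex_of_real (response A B m (?Q *\<^sub>v p) $ j) * E s m)"
      using N by (intro sum.mono_neutral_cong_right) auto
    also have "\<dots> = (\<Sum>m\<in>{0..N - 2}. \<Sum>a<d. complex_of_real (p $ a) * (E s m * complex_of_real ((?Q * A ^\<^sub>m m * B) $$ (a, j))))"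
      by (intro sum.cong refl) (simp only: response_entry[OF A Q p j] of_real_sum of_real_mult sum_distrib_left sum_distrib_right mult_ac)
    also have "\<dots> = (\<Sum>a<d. complex_of_real (p $ a) * T s $$ (a, j))"
      by (subst sum.swap) (use j in \<open>simp add: Te sum_distrib_left\<close>)
    finally show ?thesis .
  qed
  have "(\<Sum>j<d. (norm (\<Sum>m<N. complex_of_real (if m \<le> N - 2 then response A B m (?Q *\<^sub>v p) $ j else 0) * E s m))\<^sup>2)
    = (\<Sum>j<d. (norm (\<Sum>a<d. complex_of_real (p $ a) * T s $$ (a, j)))\<^sup>2)"
    by (intro sum.cong refl) (simp only: sum_eq lessThan_iff)
  also have "\<dots> \<le> (op_norm (T s))\<^sup>2 * (p \<bullet> p)" by (rule op_norm_adjoint_bound[OF T p])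
  also have "\<dots> \<le> L_sup P N A B * (p \<bullet> p)"
    unfolding L using s by (intro mult_right_mono cSUP_upper bdd scalar_prod_self_nonneg) auto
  finally show ?thesis by (simp only: E_def)
qed

lemma gain_adjoint_bound:
  assumes A: "A \<in> carrier_mat d d" "B \<in> carrier_mat d d"
    and Q: "inv_sqrt P \<in> carrier_mat d d" "transpose_mat (inv_sqrt P) = inv_sqrt P"
    and p: "p \<in> carrier_vec d" and N: "2 \<le> N"
  shows "(\<Sum>c\<in>{..<N} \<times> {..<d}. (\<Sum>i<N. gain A B (inv_sqrt P *\<^sub>v p) i c * y i)\<^sup>2)
    \<le> (L_sup P N A B * (p \<bullet> p)) * (\<Sum>i<N. (y i)\<^sup>2)"
proof -
  \<comment> \<open>The cutoff loses nothing here: \<open>k < i\<close> and \<open>i < N\<close>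
    give \<open>i - 1 - k \<le> N - 2\<close>.\<close>
  let ?h = "\<lambda>m j. if m \<le> N - 2 then response A B m (inv_sqrt P *\<^sub>v p) $ j else 0"
  have "(\<Sum>c\<in>{..<N} \<times> {..<d}. (\<Sum>i<N. gain A B (inv_sqrt P *\<^sub>v p) i c * y i)\<^sup>2)
    = (\<Sum>k<N. \<Sum>j<d. (\<Sum>i<N. if k < i then ?h (i - 1 - k) j * y i else 0)\<^sup>2)"
    unfolding sum.cartesian_product
    by (intro sum.cong refl) (auto simp: gain_def intro!: arg_cong[where f = "\<lambda>x. x\<^sup>2"] sum.cong)
  also have "\<dots> \<le> (L_sup P N A B * (p \<bullet> p)) * (\<Sum>i<N. (y i)\<^sup>2)"
    using N by (intro correlation_bound response_frequency_bound[OF A Q p _ _ N]) auto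
  finally show ?thesis .
qed

subsection \<open>The deviation bound\<close>

lemma normalized_gram_symmetric:
  assumes A: "A \<in> carrier_mat d d" "B \<in> carrier_mat d d" and Q: "Q \<in> carrier_mat d d" "transpose_mat Q = Q"
  shows "Q * gram N A B e * Q - 1\<^sub>m d \<in> carrier_mat d d"
    and "transpose_mat (Q * gram N A B e * Q - 1\<^sub>m d) = Q * gram N A B e * Q - 1\<^sub>m d"
proof -
  have G: "gram N A B e \<in> carrier_mat d d" using gram_carrier[of N A B e] A by simp
  have Gs: "transpose_mat (gram N A B e) = gram N A B e"
    by (rule eq_matI) (use G in \<open>auto simp: gram_entry[OF A] mult.commute\<close>)
  have QG: "Q * gram N A B e \<in> carrier_mat d d" by (rule mult_carrier_mat[OF Q(1) G])
  have QGQ: "Q * gram N A B e * Q \<in> carrier_mat d d" by (rule mult_carrier_mat[OF QG Q(1)])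
  show "Q * gram N A B e * Q - 1\<^sub>m d \<in> carrier_mat d d" by (rule minus_carrier_mat[OF one_carrier_mat])
  have "transpose_mat (Q * gram N A B e * Q) = Q * (gram N A B e * Q)"
    by (simp only: transpose_mult[OF QG Q(1)] transpose_mult[OF Q(1) G] Gs Q(2))
  also have "\<dots> = Q * gram N A B e * Q" by (rule assoc_mult_mat[OF Q(1) G Q(1), symmetric])
  finally show "transpose_mat (Q * gram N A B e * Q - 1\<^sub>m d) = Q * gram N A B e * Q - 1\<^sub>m d"
    by (simp only: transpose_minus[OF QGQ one_carrier_mat] transpose_one)
qed

lemma normalized_form:
  fixes Q G :: "real mat"
  assumes Q: "Q \<in> carrier_mat d d" "transpose_mat Q = Q" and G: "G \<in> carrier_mat d d" and p: "p \<in> carrier_vec d"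
  shows "p \<bullet> ((Q * G * Q) *\<^sub>v p) = (Q *\<^sub>v p) \<bullet> (G *\<^sub>v (Q *\<^sub>v p))"
proof -
  have Qp: "Q *\<^sub>v p \<in> carrier_vec d" using Q p by simp
  have GQp: "G *\<^sub>v (Q *\<^sub>v p) \<in> carrier_vec d" using G Qp by simp
  have QG: "Q * G \<in> carrier_mat d d" by (rule mult_carrier_mat[OF Q(1) G])
  have "(Q * G * Q) *\<^sub>v p = Q *\<^sub>v (G *\<^sub>v (Q *\<^sub>v p))"
    using assoc_mult_mat_vec[OF QG Q(1) p] assoc_mult_mat_vec[OF Q(1) G Qp] by simp
  then show ?thesis using symmetric_form_swap[OF Q p GQp] by simp
qed

lemma deviation_event_sets:
  assumes A: "A \<in> carrier_mat d d" "B \<in> carrier_mat d d" and Q: "Q \<in> carrier_mat d d" "transpose_mat Q = Q"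
  shows "{e \<in> space (Pi\<^sub>M {..<N} (\<lambda>_. vec_borel d)). op_norm (Q * gram N A B e * Q - 1\<^sub>m d) \<le> c}
    \<in> sets (Pi\<^sub>M {..<N} (\<lambda>_. vec_borel d))"
proof (rule op_norm_le_sets[OF normalized_gram_symmetric(1)[OF A Q]])
  fix i j assume ij: "i < d" "j < d"
  have G: "gram N A B e \<in> carrier_mat d d" for e using gram_carrier[of N A B e] A by simp
  have "(Q * gram N A B e * Q - 1\<^sub>m d) $$ (i, j)
    = (\<Sum>c<d. (\<Sum>b<d. Q $$ (i, b) * gram N A B e $$ (b, c)) * Q $$ (c, j)) - (if i = j then 1 else 0)" for e
    using triple_product_entry[OF Q(1) G Q(1) ij] ij normalized_gram_symmetric(1)[OF A Q]
    by (subst index_minus_mat) auto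
  then show "(\<lambda>e. (Q * gram N A B e * Q - 1\<^sub>m d) $$ (i, j)) \<in> borel_measurable (Pi\<^sub>M {..<N} (\<lambda>_. vec_borel d))"
    using ij by (simp only:) (intro borel_measurable_diff borel_measurable_sum borel_measurable_times
        borel_measurable_const gram_entry_measurable[OF A]; simp)
qed

locale state_space =
  fixes d N :: nat and A B :: "real mat"
  assumes A: "A \<in> carrier_mat d d" "B \<in> carrier_mat d d" and inv: "invertible_mat B"
    and d: "1 \<le> d" and N: "2 \<le> N"
begin

lemma N1: "1 \<le> N"
  using N by simp

definition P :: "real mat" where "P = noise_Psi d N A B"
definition Q :: "real mat" where "Q = inv_sqrt P"
definition L :: real where "L = L_sup P N A B"

lemma inv_sqrt_P:
  "inv_sqrt P \<in> carrier_mat d d" "transpose_mat (inv_sqrt P) = inv_sqrt P" "inv_sqrt P * P * inv_sqrt P = 1\<^sub>m d"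
  using inv_sqrt_spec[OF noise_Psi_carrier noise_Psi_symmetric[OF A] noise_Psi_positive[OF A inv _ _ N d]]
  by (auto simp: P_def)

lemma Q: "Q \<in> carrier_mat d d" "transpose_mat Q = Q" "Q * P * Q = 1\<^sub>m d"
  using inv_sqrt_P by (simp_all add: Q_def)

text \<open>The normalization \<open>Q * P * Q = 1\<^sub>m d\<close>, read as a statement about the
  Frobenius norm of the gain matrix in direction \<open>p\<close>.\<close>

lemma gain_mean:
  assumes p: "p \<in> carrier_vec d"
  shows "(\<Sum>i<N. \<Sum>c\<in>{..<N} \<times> {..<d}. (gain A B (Q *\<^sub>v p) i c)\<^sup>2) = p \<bullet> p"
proof -
  have Qp: "Q *\<^sub>v p \<in> carrier_vec d" using Q p by simp
  have "(\<Sum>i<N. \<Sum>c\<in>{..<N} \<times> {..<d}. (gain A B (Q *\<^sub>v p) i c)\<^sup>2) = (Q *\<^sub>v p) \<bullet> (P *\<^sub>v (Q *\<^sub>v p))"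
    unfolding P_def by (rule noise_Psi_form[OF A Qp N1 d, symmetric])
  also have "\<dots> = p \<bullet> ((Q * P * Q) *\<^sub>v p)"
    by (rule normalized_form[OF Q(1,2) _ p, symmetric]) (simp add: P_def noise_Psi_carrier)
  also have "\<dots> = p \<bullet> p" using p by (simp add: Q(3))
  finally show ?thesis .
qed

text \<open>Testing the adjoint bound with the unit vector at time \<open>r\<close> bounds the
  squared norm of row \<open>r\<close> of the gain matrix by \<open>L\<close>. For a unit direction
  these add up to 1, hence 1 <= N L.\<close>

lemma L_pos: "0 < L"
proof -
  let ?p = "unit_vec d 0 :: real vec"
  have p: "?p \<in> carrier_vec d" by simp
  have pp: "?p \<bullet> ?p = 1" using d by simp
  have "1 = (\<Sum>r<N. \<Sum>c\<in>{..<N} \<times> {..<d}. (gain A B (Q *\<^sub>v ?p) r c)\<^sup>2)"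
    using gain_mean[OF p] pp by simp
  also have "\<dots> \<le> (\<Sum>r<N. L)"
  proof (rule sum_mono)
    fix r assume r: "r \<in> {..<N}"
    have "(\<Sum>c\<in>{..<N} \<times> {..<d}. (\<Sum>i<N. gain A B (Q *\<^sub>v ?p) i c * (if i = r then 1 else 0))\<^sup>2)
      \<le> (L * (?p \<bullet> ?p)) * (\<Sum>i<N. (if i = r then 1 else 0)\<^sup>2)"
      unfolding L_def Q_def by (rule gain_adjoint_bound[OF A inv_sqrt_P(1,2) p N])
    moreover have "(\<Sum>i<N. (if i = r then 1 else 0 :: real)\<^sup>2) = 1" using r by (simp add: if_distrib[of "\<lambda>x. x\<^sup>2"] cong: if_cong)
    moreover have "(\<Sum>i<N. gain A B (Q *\<^sub>v ?p) i c * (if i = r then 1 else 0)) = gain A B (Q *\<^sub>v ?p) r c" for c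
      using r by (simp add: if_distrib[of "\<lambda>x. _ * x"] cong: if_cong)
    ultimately show "(\<Sum>c\<in>{..<N} \<times> {..<d}. (gain A B (Q *\<^sub>v ?p) r c)\<^sup>2) \<le> L" by (simp only: pp mult_1_right)
  qed
  finally have "1 \<le> real N * L" by simp
  then show ?thesis using N by (smt (verit) mult_nonneg_nonpos of_nat_0_le_iff)
qed

lemma direction_tail:
  assumes p: "p \<in> carrier_vec d" "euclid_norm p \<le> 1" and u: "0 \<le> u"
  defines "X \<equiv> \<lambda>g. p \<bullet> ((Q * gram N A B (\<lambda>k. canonical_vec d k g) * Q - 1\<^sub>m d) *\<^sub>v p)"
  shows "{g \<in> space (canonical_noise N d). 4 * sqrt (u * L) + 8 * u * L \<le> \<bar>X g\<bar>} \<in> sets (canonical_noise N d)"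
    and "measure (canonical_noise N d) {g \<in> space (canonical_noise N d). 4 * sqrt (u * L) + 8 * u * L \<le> \<bar>X g\<bar>} \<le> 2 * exp (- u)"
proof -
  have Qp: "Q *\<^sub>v p \<in> carrier_vec d" using Q p by simp
  have pp: "p \<bullet> p \<le> 1"
    using power_mono[OF p(2) euclid_norm_nonneg, of 2] by (simp add: euclid_norm_real_square)
  interpret gc: gaussian_chaos "{..<N} \<times> {..<d}" "{..<N}" "gain A B (Q *\<^sub>v p)" L
  proof
    fix y :: "nat \<Rightarrow> real"
    have "(\<Sum>c\<in>{..<N} \<times> {..<d}. (\<Sum>i<N. gain A B (Q *\<^sub>v p) i c * y i)\<^sup>2) \<le> (L * (p \<bullet> p)) * (\<Sum>i<N. (y i)\<^sup>2)"
      unfolding L_def Q_def by (rule gain_adjoint_bound[OF A inv_sqrt_P(1,2) p(1) N])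
    also have "\<dots> \<le> (L * 1) * (\<Sum>i<N. (y i)\<^sup>2)"
      using L_pos pp by (intro mult_right_mono mult_left_mono sum_nonneg) auto
    finally show "(\<Sum>c\<in>{..<N} \<times> {..<d}. (\<Sum>i<N. gain A B (Q *\<^sub>v p) i c * y i)\<^sup>2) \<le> L * (\<Sum>i<N. (y i)\<^sup>2)" by simp
  qed (use L_pos in auto)
  \<comment> \<open>Net points lie in the ball and not only on the sphere, so the mean is at most 1
    rather than equal to 1.\<close>
  have mean: "gc.mean = p \<bullet> p" unfolding gc.mean_def by (rule gain_mean[OF p(1)])
  have X: "X g = gc.qf g - gc.mean" for g
  proof -
    let ?G = "gram N A B (\<lambda>k. canonical_vec d k g)"
    have G: "?G \<in> carrier_mat d d" using gram_carrier[of N A B] A by simp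
    have QGQ: "Q * ?G * Q \<in> carrier_mat d d" by (rule mult_carrier_mat[OF mult_carrier_mat[OF Q(1) G] Q(1)])
    have "X g = p \<bullet> ((Q * ?G * Q) *\<^sub>v p) - p \<bullet> p"
      unfolding X_def using p minus_mult_distrib_mat_vec[OF QGQ one_carrier_mat p(1)]
        scalar_prod_minus_distrib[OF p(1) mult_mat_vec_carrier[OF QGQ p(1)] p(1)] by simp
    also have "p \<bullet> ((Q * ?G * Q) *\<^sub>v p) = (Q *\<^sub>v p) \<bullet> (?G *\<^sub>v (Q *\<^sub>v p))"
      by (rule normalized_form[OF Q(1,2) G p(1)])
    also have "\<dots> = gc.qf g"
      unfolding gram_form[OF A Qp N1] gc.qf_def gc.lin_def
      by (intro sum.cong refl arg_cong[where f = "\<lambda>x. x\<^sup>2"] scalar_prod_state_canonical[OF A Qp]) simp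
    finally show ?thesis by (simp add: mean)
  qed
  show "{g \<in> space (canonical_noise N d). 4 * sqrt (u * L) + 8 * u * L \<le> \<bar>X g\<bar>} \<in> sets (canonical_noise N d)"
    unfolding X by measurable
  show "measure (canonical_noise N d) {g \<in> space (canonical_noise N d). 4 * sqrt (u * L) + 8 * u * L \<le> \<bar>X g\<bar>} \<le> 2 * exp (- u)"
    unfolding X by (rule gc.tail) (use mean pp u in auto)
qed

lemma net_constant: "2 * real ((3 * 2 ^ 16) ^ d) \<le> exp (19 * max (real d) t)"
proof -
  let ?m = "max (real d) t"
  have e: "2 \<le> exp (1 :: real)" using exp_ge_add_one_self[of 1] by simp
  \<comment> \<open>Each dimension costs a factor at most e^18, the two-sided tail one more e; since
    \<open>1 \<le> d\<close>, both fit into the exponent 19.\<close>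
  have "(3 * 2 ^ 16 :: real) \<le> 2 ^ 18" by simp
  also have "\<dots> \<le> exp 1 ^ 18" using e by (intro power_mono) auto
  finally have k: "(3 * 2 ^ 16 :: real) \<le> exp 18" by (simp add: exp_of_nat_mult[symmetric])
  have "2 * real ((3 * 2 ^ 16) ^ d) = 2 * (3 * 2 ^ 16) ^ d" by simp
  also have "\<dots> \<le> exp 1 * exp 18 ^ d" using e k by (intro mult_mono power_mono) auto
  also have "\<dots> = exp (1 + 18 * real d)" by (simp add: exp_add exp_of_nat_mult[symmetric] mult.commute)
  also have "\<dots> \<le> exp (19 * ?m)" using d by simp
  finally show ?thesis .
qed

lemma canonical_deviation:
  assumes t: "1 \<le> t"
  defines "E \<equiv> {g \<in> space (canonical_noise N d).
      op_norm (Q * gram N A B (\<lambda>k. canonical_vec d k g) * Q - 1\<^sub>m d) \<le> 320 * Delta P N A B t}"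
  shows "1 - exp (- t) \<le> measure (canonical_noise N d) E"
proof -
  interpret prob_space "canonical_noise N d" by (rule prob_space_gaussian_family)
  define m where "m = max (real d) t"
  \<comment> \<open>The union bound costs exp (19 m), so 20 leaves exp (- m), which is at most exp
    (- t).\<close>
  define u where "u = 20 * m"
  define s where "s = 4 * sqrt (u * L) + 8 * u * L"
  have m: "1 \<le> m" "t \<le> m" using t by (auto simp: m_def)
  have u0: "0 \<le> u" using m by (simp add: u_def)
  have s0: "0 \<le> s" using u0 L_pos by (simp add: s_def)
  have Delta: "Delta P N A B t = m * L + sqrt m * sqrt L"
    using A by (simp add: Delta_def m_def L_def Let_def)
  \<comment> \<open>\<open>8 * u * L\<close> is \<open>160 * (m * L)\<close>, and the factor 2 is
    the loss of the net; the root term needs only 4 sqrt 20 <= 20.\<close>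
  have s_le: "2 * s \<le> 320 * Delta P N A B t"
  proof -
    have "sqrt 20 \<le> sqrt (5\<^sup>2)" by (rule real_sqrt_le_mono) simp
    then have "sqrt 20 \<le> 5" by simp
    moreover define w where "w = sqrt m * sqrt L"
    ultimately have w: "sqrt 20 * w \<le> 5 * w" "0 \<le> w" using m L_pos by (auto intro: mult_right_mono)
    have "s = 4 * (sqrt 20 * w) + 160 * (m * L)" by (simp add: s_def w_def u_def real_sqrt_mult)
    moreover have "4 * (sqrt 20 * w) \<le> 160 * w" using w by linarith
    ultimately have "s \<le> 160 * (m * L + w)" by (simp only: distrib_left)
    then show ?thesis by (simp add: Delta w_def)
  qed
  obtain T :: "real vec set" where T: "finite T" "card T \<le> (3 * 2 ^ 16) ^ d"
    "\<And>p. p \<in> T \<Longrightarrow> p \<in> carrier_vec d \<and> euclid_norm p \<le> 1"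
    "\<And>v. v \<in> carrier_vec d \<Longrightarrow> euclid_norm v \<le> 1 \<Longrightarrow> \<exists>p\<in>T. euclid_norm (v - p) \<le> 1 / 4"
    using unit_ball_net[OF d] by metis
  let ?W = "\<lambda>g. Q * gram N A B (\<lambda>k. canonical_vec d k g) * Q - 1\<^sub>m d"
  define bad where "bad p = {g \<in> space (canonical_noise N d). s \<le> \<bar>p \<bullet> (?W g *\<^sub>v p)\<bar>}" for p
  have bad: "bad p \<in> events" "prob (bad p) \<le> 2 * exp (- u)" if "p \<in> T" for p
    unfolding bad_def s_def using T(3)[OF that] by (blast intro: direction_tail u0)+
  have Eev: "E \<in> events"
    unfolding E_def
    by (rule gram_event_transfer(1)[OF N1 prob_space_axioms iid_std_gaussian_canonical[OF N1 d],
        where R = "\<lambda>G. op_norm (Q * G * Q - 1\<^sub>m d) \<le> 320 * Delta P N A B t"])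
      (rule deviation_event_sets[OF A Q(1,2)])
  have "space (canonical_noise N d) - E \<subseteq> (\<Union>p\<in>T. bad p)"
  proof
    fix g assume g: "g \<in> space (canonical_noise N d) - E"
    show "g \<in> (\<Union>p\<in>T. bad p)"
    proof (rule ccontr)
      assume "g \<notin> (\<Union>p\<in>T. bad p)"
      then have small: "\<bar>p \<bullet> (?W g *\<^sub>v p)\<bar> \<le> s" if p: "p \<in> T" for p
      proof -
        have "g \<notin> bad p" using p \<open>g \<notin> (\<Union>p\<in>T. bad p)\<close> by blast
        moreover have "g \<in> space (canonical_noise N d)" using g by blast
        ultimately have "\<not> s \<le> \<bar>p \<bullet> (?W g *\<^sub>v p)\<bar>" unfolding bad_def by blast
        then show ?thesis by linarith
      qed
      have "op_norm (?W g) \<le> 2 * s"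
      proof (rule op_norm_le_net[OF normalized_gram_symmetric[OF A Q(1,2)] _ s0 small])
        fix v :: "real vec" assume "v \<in> carrier_vec d" "euclid_norm v \<le> 1"
        then show "\<exists>p\<in>T. p \<in> carrier_vec d \<and> euclid_norm p \<le> 1 \<and> euclid_norm (v - p) \<le> 1 / 4"
          using T(3,4) by blast
      qed
      then have "op_norm (?W g) \<le> 320 * Delta P N A B t" using s_le by (rule order_trans)
      then show False using g unfolding E_def by blast
    qed
  qed
  then have "prob (space (canonical_noise N d) - E) \<le> prob (\<Union>p\<in>T. bad p)"
    using bad T(1) by (intro finite_measure_mono sets.finite_UN) auto
  also have "\<dots> \<le> (\<Sum>p\<in>T. prob (bad p))"
    using bad T(1) by (intro finite_measure_subadditive_finite) auto
  also have "\<dots> \<le> (\<Sum>p\<in>T. 2 * exp (- u))" by (intro sum_mono bad)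
  also have "\<dots> = 2 * real (card T) * exp (- u)" by simp
  also have "\<dots> \<le> 2 * real ((3 * 2 ^ 16) ^ d) * exp (- u)"
    using T(2) by (intro mult_right_mono mult_left_mono of_nat_mono) auto
  also have "\<dots> \<le> exp (19 * m) * exp (- u)"
    unfolding m_def by (intro mult_right_mono net_constant) auto
  also have "\<dots> = exp (- m)" by (simp add: exp_add[symmetric] u_def)
  also have "\<dots> \<le> exp (- t)" using m by simp
  finally have "prob (space (canonical_noise N d) - E) \<le> exp (- t)" .
  then show ?thesis using prob_compl[OF Eev] by simp
qed

lemma deviation_measure:
  assumes M: "prob_space M" "iid_std_gaussian M d N \<epsilon>"
  shows "measure M {\<omega> \<in> space M. op_norm (Q * gram N A B (\<lambda>k. \<epsilon> k \<omega>) * Q - 1\<^sub>m d) \<le> c}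
    = measure (Pi\<^sub>M {..<N} (\<lambda>_. std_gaussian d))
       {e \<in> space (Pi\<^sub>M {..<N} (\<lambda>_. vec_borel d)). op_norm (Q * gram N A B e * Q - 1\<^sub>m d) \<le> c}"
  by (rule gram_event_transfer(2)[OF N1 M, where R = "\<lambda>G. op_norm (Q * G * Q - 1\<^sub>m d) \<le> c"])
    (rule deviation_event_sets[OF A Q(1,2)])

lemma Psi_eq_P:
  assumes "prob_space M" "iid_std_gaussian M d N \<epsilon>"
  shows "Psi M N A B \<epsilon> = P"
  unfolding P_def by (rule Psi_eq_noise_Psi[OF N1 assms A])

end

text \<open>After this rewriting the sample space occurs only in the premise that it carries the
  noise, while the conclusion speaks of the product law. A type on which the noise exists for all
  \<open>d\<close> and \<open>N\<close> therefore yields the bound for every other type.\<close>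

lemma deviation_bound_iff:
  "deviation_bound C TYPE('w) \<longleftrightarrow> (\<forall>d N A B (M :: 'w measure) \<epsilon>. state_space d N A B \<and> prob_space M \<and> iid_std_gaussian M d N \<epsilon> \<longrightarrow>
     (\<forall>t\<ge>1. 1 - exp (- t) \<le> measure (Pi\<^sub>M {..<N} (\<lambda>_. std_gaussian d)) {e \<in> space (Pi\<^sub>M {..<N} (\<lambda>_. vec_borel d)).
       op_norm (state_space.Q d N A B * gram N A B e * state_space.Q d N A B - 1\<^sub>m d)
         \<le> C * Delta (state_space.P d N A B) N A B t}))" (is "?l \<longleftrightarrow> ?r")
proof -
  have *: "(let P = Psi M N A B \<epsilon>; Q = inv_sqrt P in
          \<forall>t\<ge>1. measure M {\<omega> \<in> space M. op_norm (Q * gram N A B (\<lambda>k. \<epsilon> k \<omega>) * Q - 1\<^sub>m d) \<le> C * Delta P N A B t}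
           \<ge> 1 - exp (- t))
    \<longleftrightarrow> (\<forall>t\<ge>1. 1 - exp (- t) \<le> measure (Pi\<^sub>M {..<N} (\<lambda>_. std_gaussian d)) {e \<in> space (Pi\<^sub>M {..<N} (\<lambda>_. vec_borel d)).
       op_norm (state_space.Q d N A B * gram N A B e * state_space.Q d N A B - 1\<^sub>m d)
         \<le> C * Delta (state_space.P d N A B) N A B t})"
    if S: "state_space d N A B" and M: "prob_space M" "iid_std_gaussian M d N \<epsilon>" for d N A B and M :: "'w measure" and \<epsilon>
  proof -
    interpret state_space d N A B by (rule S)
    show ?thesis unfolding Let_def Psi_eq_P[OF M] Q_def[symmetric] deviation_measure[OF M] ..
  qed
  have **: "(1 \<le> d \<and> 2 \<le> N \<and> A \<in> carrier_mat d d \<and> B \<in> carrier_mat d d \<and> invertible_mat B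
        \<and> prob_space M \<and> iid_std_gaussian M d N \<epsilon>) \<longleftrightarrow> state_space d N A B \<and> prob_space M \<and> iid_std_gaussian M d N \<epsilon>"
    for d N A B and M :: "'w measure" and \<epsilon>
    by (auto simp: state_space_def)
  show ?thesis unfolding deviation_bound_def ** using * by meson
qed

theorem proposition2p1:
  "(\<exists>C>0. deviation_bound C TYPE(nat \<Rightarrow> real vec))
   \<and> (\<forall>C>0. deviation_bound C TYPE(nat \<Rightarrow> real vec) \<longrightarrow> deviation_bound C TYPE('w))"
proof (intro conjI allI impI)
  have "deviation_bound 320 TYPE(nat \<Rightarrow> real vec)"
    unfolding deviation_bound_iff
  proof (intro allI impI)
    fix d N A B and M :: "(nat \<Rightarrow> real vec) measure" and \<epsilon> and t :: real
    assume "state_space d N A B \<and> prob_space M \<and> iid_std_gaussian M d N \<epsilon>" and t: "1 \<le> t"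
    then interpret state_space d N A B by simp
    show "1 - exp (- t) \<le> measure (Pi\<^sub>M {..<N} (\<lambda>_. std_gaussian d)) {e \<in> space (Pi\<^sub>M {..<N} (\<lambda>_. vec_borel d)).
       op_norm (Q * gram N A B e * Q - 1\<^sub>m d) \<le> 320 * Delta P N A B t}"
      using canonical_deviation[OF t]
      unfolding deviation_measure[OF prob_space_gaussian_family iid_std_gaussian_canonical[OF N1 d]] .
  qed
  then show "\<exists>C>0. deviation_bound C TYPE(nat \<Rightarrow> real vec)" by (intro exI[of _ 320]) simp
next
  fix C :: real
  assume C: "deviation_bound C TYPE(nat \<Rightarrow> real vec)"
  show "deviation_bound C TYPE('w)"
    unfolding deviation_bound_iff
  proof (intro allI impI)
    fix d N A B and M :: "'w measure" and \<epsilon> and t :: real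
    assume S: "state_space d N A B \<and> prob_space M \<and> iid_std_gaussian M d N \<epsilon>" and t: "1 \<le> t"
    then have S': "state_space d N A B" by simp
    \<comment> \<open>The coordinates of the product space realize the noise on
      \<open>nat \<Rightarrow> real vec\<close> for the given \<open>d\<close> and \<open>N\<close>,
      so the premise of the assumed bound is met.\<close>
    have "iid_std_gaussian (Pi\<^sub>M {..<N} (\<lambda>_. std_gaussian d)) d N (\<lambda>i \<omega>. \<omega> i)"
      using state_space.N1[OF S'] by (rule iid_std_gaussian_product)
    moreover have "prob_space (Pi\<^sub>M {..<N} (\<lambda>_. std_gaussian d))"
      by (intro prob_space_PiM prob_space_std_gaussian)
    ultimately show "1 - exp (- t) \<le> measure (Pi\<^sub>M {..<N} (\<lambda>_. std_gaussian d)) {e \<in> space (Pi\<^sub>M {..<N} (\<lambda>_. vec_borel d)).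
       op_norm (state_space.Q d N A B * gram N A B e * state_space.Q d N A B - 1\<^sub>m d)
         \<le> C * Delta (state_space.P d N A B) N A B t}"
      using C[unfolded deviation_bound_iff] S' t by blast
  qed
qed

end
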